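(* Let $r\ge 1$ be a fixed integer and let $D = \dfrac{\zeta(r+2)\,H_r(2)}{2\,\zeta(r+3)}$. Then $$\sum_{n\leqslant x}\sigma^{(r)}(n) = D x^2 + \Omega_{\pm}\left(x\log\log x\right) \qquad (x\to\infty),$$ that is, $$\limsup_{x\to\infty}\frac{\sum_{n\le x}\sigma^{(r)}(n)-Dx^2}{x\log\log x}>0 \quad\text{and}\quad \liminf_{x\to\infty}\frac{\sum_{n\le x}\sigma^{(r)}(n)-Dx^2}{x\log\log x}<0.$$
   Context: For an integer $r\ge 0$, $\sigma^{(r)}$ is the multiplicative arithmetic function (sum of "divisors of order $r$") with $\sigma^{(r)}(p^a)=p^a$ for $1\le a\le r$ and $\sigma^{(r)}(p^a)=p^a+p^r$ for $a>r$ ($p$ prime, $a\ge 1$). $H_r(s)$ denotes the Dirichlet series determined by the identity $$\sum_{n=1}^\infty \frac{\sigma^{(r)}(n)}{n^s} = \frac{\zeta(s-1)\,\zeta\bigl((r+1)s-r\bigr)}{\zeta\bigl((r+2)s-r-1\bigr)}\,H_r(s), \qquad \Re s>2;$$ it converges absolutely for $\Re s>(2r+2)/(2r+3)$, so $H_r(2)$ is well defined as the value of this series at $s=2$. Here $\zeta$ is the Riemann zeta-function. *)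

theory Defs
  imports "HOL-Analysis.Analysis" "HOL-Computational_Algebra.Primes"
begin

text \<open>The value at \<open>0\<close> is a dummy; only positive arguments are used.\<close>

definition sigma_ord :: "nat \<Rightarrow> nat \<Rightarrow> nat" where
  "sigma_ord r n =
     (if n = 0 then 0
      else \<Prod>p\<in>prime_factors n.
             (if multiplicity p n \<le> r then p ^ multiplicity p n
              else p ^ multiplicity p n + p ^ r))"

text \<open>Summation starts at \<open>n = 1\<close>, whence the shift by \<open>Suc\<close>.\<close>

definition dirichlet_term :: "(nat \<Rightarrow> complex) \<Rightarrow> complex \<Rightarrow> nat \<Rightarrow> complex" where
  "dirichlet_term f s n = f (Suc n) / of_nat (Suc n) powr s"

definition dirichlet_series :: "(nat \<Rightarrow> complex) \<Rightarrow> complex \<Rightarrow> complex" where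
  "dirichlet_series f s = (\<Sum>n. dirichlet_term f s n)"

text \<open>This is the Riemann zeta-function only on the half-plane \<open>Re s > 1\<close>. No analytic
  continuation is needed: every argument at which it is used below lies in that half-plane.\<close>

definition zeta :: "complex \<Rightarrow> complex" where
  "zeta s = dirichlet_series (\<lambda>_. 1) s"

text \<open>The Dirichlet series \<open>H\<^sub>r\<close> is determined by an identity on \<open>Re s > 2\<close>. By the uniqueness
  theorem for Dirichlet series its coefficients at positive arguments are unique; the
  (unused) coefficient at \<open>0\<close> is normalised to \<open>0\<close> so that the definite description is proper.\<close>

definition is_H_coeff :: "nat \<Rightarrow> (nat \<Rightarrow> complex) \<Rightarrow> bool" where
  "is_H_coeff r h \<longleftrightarrow>
     h 0 = 0 \<and>
     (\<forall>s. Re s > 2 \<longrightarrow>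
        summable (dirichlet_term h s) \<and>
        dirichlet_series (\<lambda>n. of_nat (sigma_ord r n)) s =
          zeta (s - 1) * zeta (of_nat (r + 1) * s - of_nat r)
            / zeta (of_nat (r + 2) * s - of_nat (r + 1))
          * dirichlet_series h s)"

definition H_coeff :: "nat \<Rightarrow> nat \<Rightarrow> complex" where
  "H_coeff r = (THE h. is_H_coeff r h)"

definition H :: "nat \<Rightarrow> complex \<Rightarrow> complex" where
  "H r s = dirichlet_series (H_coeff r) s"

text \<open>The coefficients of \<open>H\<^sub>r\<close> are real (by uniqueness, since their conjugates satisfy the
  same identity), so \<open>Re\<close> is merely the coercion of a real number from complex to real.\<close>

definition mean_const :: "nat \<Rightarrow> real" where
  "mean_const r = Re (zeta (of_nat (r + 2)) * H r 2 / (2 * zeta (of_nat (r + 3))))"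

end

theory Submission
  imports Defs "HOL-Real_Asymp.Real_Asymp"
begin

text \<open>
  Write \<open>\<sigma>\<^sup>(\<^sup>r\<^sup>) = id * g\<close> as a Dirichlet convolution with \<open>g\<close> multiplicative, and let
  \<open>G(s) = \<Sum> g(n) n\<^sup>-\<^sup>s\<close>, which converges absolutely for \<open>s > 1\<close>. Then \<open>D = G(2)/2\<close>, and the error
  \<open>E(x)\<close> is \<open>\<Sum> g(d) e(x/d)\<close> with \<open>e(y) = \<Sum>\<^sub>m\<^sub>\<le>\<^sub>y m - y^2/2\<close>. Hence the integral of \<open>E(x) x\<^sup>-\<^sup>s\<^sup>-\<^sup>1\<close> over the
  positive reals is \<open>G(s) \<kappa>(s)\<close> with \<open>\<kappa>\<close> bounded near \<open>1\<close>; since the Euler factors of \<open>G\<close> lie between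
  \<open>0\<close> and \<open>1 + p\<^sup>-\<^sup>s\<close>, this integral is \<open>O(1/\<delta>)\<close> at \<open>s = 1 + \<delta>\<close>.

  Suppose that \<open>E\<close> (or \<open>-E\<close>) were bounded below by \<open>-\<epsilon> x log log x\<close>. Let \<open>Q\<close> be the product of \<open>p\<^sup>r\<^sup>+\<^sup>1\<close> over
  the primes \<open>p \<le> y\<close>. At multiples of \<open>Q\<close> the function \<open>\<sigma>\<^sup>(\<^sup>r\<^sup>)\<close> is of order \<open>Qm log y\<close> on average, so \<open>E\<close>
  has a large jump there, and as one side of the jump is not very negative, the other is very positive.
  On average over \<open>m\<close>, the values at \<open>Qm + i\<close> and \<open>Qm - i\<close> agree, so the average of \<open>E\<close> over a whole
  period around \<open>Qm\<close> equals the average of its values on the two sides of the jump. With \<open>y\<close> about the square root of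
  \<open>log x\<close> this makes the sum of \<open>E\<close> over the block from \<open>8\<^sup>k\<close> to \<open>8\<^sup>k\<^sup>+\<^sup>1\<close> at least a constant times \<open>64\<^sup>k log k\<close>,
  so the Mellin integral exceeds any constant multiple of \<open>1/\<delta>\<close>, a contradiction.
\<close>

text \<open>A jump of E at Qm has a known size, but it may be shared by the two sides with any
  signs. The one-sided hypothesis makes the sum of the two sides large, and the symmetry around Qm
  carries this to a whole period; only then does it contradict a bound for the mean of E. This bound
  is available in Mellin form, where it rests on G(s) <= zeta(s) for s > 1. The symmetry is a
  counting fact: in an interval, Qm = i and Qm = -i modulo d have almost equally many solutions m.
  An error of 1 for each d <= X, weighted by |g(d)| / d, amounts to O(sqrt X) where X is of order
  QM. Summed over the period it is harmless if Q^4 <= X, and this limits y. The crude bound Q <=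
  2^((r+1) y^2) then leads to y of order sqrt(log x), and log y is still of order log log x. Base 8
  leaves room: QM lies in (8^k, 2 8^k], and the periods around Qm with M < m <= 2M end at 2QM + Q/2,
  below 8^(k+1).\<close>

section \<open>Multiplicative functions\<close>

text \<open>Encoding by the local values \<open>f p a\<close> at p^a: convolutions, products and
  norms of such functions are again of this form, so each identity reduces to one at a single
  prime.\<close>

definition mult_fun :: "(nat \<Rightarrow> nat \<Rightarrow> 'a::comm_semiring_1) \<Rightarrow> nat \<Rightarrow> 'a" where
  "mult_fun f n = (if n = 0 then 0 else \<Prod>p\<in>prime_factors n. f p (multiplicity p n))"

lemma mult_fun_0 [simp]: "mult_fun f 0 = 0"
  by (simp add: mult_fun_def)

lemma mult_fun_1 [simp]: "mult_fun f (Suc 0) = 1"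
  by (simp add: mult_fun_def)

lemma mult_fun_prime_power_times:
  assumes "prime p" "\<not> p dvd m" "f p 0 = 1"
  shows "mult_fun f (p ^ a * m) = f p a * mult_fun f m"
proof (cases "m = 0 \<or> a = 0")
  case True
  then show ?thesis using assms by auto
next
  case False
  have pos: "p ^ a * m \<noteq> 0" using False assms by (auto dest: prime_gt_0_nat)
  have pf: "prime_factors (p ^ a * m) = insert p (prime_factors m)"
    using False assms by (auto simp: prime_factors_product prime_factorization_prime_power)
  have notin: "p \<notin> prime_factors m" using assms by auto
  have mq: "multiplicity q (p ^ a * m) = multiplicity q m" if "q \<in> prime_factors m" for q
  proof -
    have "prime q" "q \<noteq> p" using that notin by auto
    then show ?thesis using assms False
      by (subst prime_elem_multiplicity_mult_distrib)
         (auto simp: multiplicity_distinct_prime_power)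
  qed
  have mp: "multiplicity p (p ^ a * m) = a"
    using assms False by (subst prime_elem_multiplicity_mult_distrib)
       (auto simp: not_dvd_imp_multiplicity_0)
  show ?thesis unfolding mult_fun_def using pos False
    by (simp add: pf notin mp mq)
qed

text \<open>By coprimality the exponent \<open>i\<close> and the divisor \<open>d\<close> of
  \<open>m\<close> vary independently; \<open>multiplicity p\<close> recovers \<open>i\<close>,
  which gives injectivity.\<close>

lemma sum_divisors_prime_power_times:
  fixes F :: "nat \<Rightarrow> 'a::comm_monoid_add"
  assumes p: "prime p" "\<not> p dvd m"
  shows "(\<Sum>d | d dvd p ^ a * m. F d) = (\<Sum>i\<le>a. \<Sum>d | d dvd m. F (p ^ i * d))"
proof -
  have "(\<Sum>i\<le>a. \<Sum>d | d dvd m. F (p ^ i * d)) = (\<Sum>(i,d)\<in>{..a} \<times> {d. d dvd m}. F (p ^ i * d))"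
    by (simp add: sum.cartesian_product)
  also have "\<dots> = (\<Sum>x\<in>{..a} \<times> {d. d dvd m}. F (p ^ fst x * snd x))"
    by (simp add: case_prod_unfold)
  also have "\<dots> = (\<Sum>d | d dvd p ^ a * m. F d)"
  proof (rule sum.reindex_bij_betw, unfold bij_betw_def, intro conjI)
    have m0: "m \<noteq> 0" using p by (metis dvd_0_right)
    have nd: "\<not> p dvd d" if "d dvd m" for d using that p dvd_trans by blast
    have p0: "p > 0" using p by (simp add: prime_gt_0_nat)
    show "inj_on (\<lambda>x. p ^ fst x * snd x) ({..a} \<times> {d. d dvd m})"
    proof (rule inj_onI, clarsimp)
      fix i d j e assume *: "d dvd m" "e dvd m" "p ^ i * d = p ^ j * e"
      have "multiplicity p (p ^ i * d) = i" "multiplicity p (p ^ j * e) = j"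
        using nd[OF *(1)] nd[OF *(2)] p m0 *(1,2)
        by (auto intro!: multiplicity_decomposeI[OF refl] simp: prime_nat_iff intro: gr0I)
      then have "i = j" using * by simp
      then show "i = j \<and> d = e" using * p0 by simp
    qed
    show "(\<lambda>x. p ^ fst x * snd x) ` ({..a} \<times> {d. d dvd m}) = {d. d dvd p ^ a * m}"
    proof (intro equalityI subsetI)
      fix x assume "x \<in> {d. d dvd p ^ a * m}"
      then have x: "x dvd p ^ a * m" by simp
      obtain u v where uv: "x = u * v" "u dvd p ^ a" "v dvd m"
        using division_decomp[OF x] by blast
      then obtain i where "i \<le> a" "u = p ^ i" using p divides_primepow_nat by blast
      then show "x \<in> (\<lambda>x. p ^ fst x * snd x) ` ({..a} \<times> {d. d dvd m})"
        using uv by (intro image_eqI[of _ _ "(i,v)"]) auto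
    qed (auto intro!: mult_dvd_mono le_imp_power_dvd)
  qed
  finally show ?thesis by simp
qed

lemma prime_power_times_induct [consumes 1, case_names one step]:
  fixes P :: "nat \<Rightarrow> bool"
  assumes "n > 0" "P 1"
    and step: "\<And>p a m. prime p \<Longrightarrow> \<not> p dvd m \<Longrightarrow> a > 0 \<Longrightarrow> m > 0 \<Longrightarrow> P m \<Longrightarrow> P (p ^ a * m)"
  shows "P n"
  using \<open>n > 0\<close>
proof (induction n rule: less_induct)
  case (less n)
  show ?case
  proof (cases "n = 1")
    case False
    then obtain p where p: "prime p" "p dvd n" using prime_factor_nat by blast
    obtain m where m: "n = p ^ multiplicity p n * m" "\<not> p dvd m"
      using less.prems p multiplicity_decompose'[of n p] by (auto simp: prime_nat_iff)
    have a: "multiplicity p n > 0"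
      using p less.prems by (auto simp: prime_multiplicity_gt_zero_iff prime_imp_prime_elem)
    have m0: "m > 0" using m by (auto intro: gr0I)
    have "1 < p ^ multiplicity p n" using a p prime_gt_1_nat one_less_power by blast
    then have "1 * m < p ^ multiplicity p n * m" using m0 mult_less_mono1 by blast
    then have "m < n" using m(1) by simp
    from step[OF p(1) m(2) a m0 less.IH[OF this m0]] show ?thesis using m(1) by simp
  qed (use assms in auto)
qed

text \<open>Splitting off one prime power factors the divisor sum into the local sum at p and the
  divisor sum of the cofactor, to which the induction hypothesis applies.\<close>

lemma mult_fun_convolution:
  fixes f k :: "nat \<Rightarrow> nat \<Rightarrow> 'a::comm_semiring_1"
  assumes f0: "\<And>p. prime p \<Longrightarrow> f p 0 = 1" and k0: "\<And>p. prime p \<Longrightarrow> k p 0 = 1" and "n > 0"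
  shows "(\<Sum>d | d dvd n. mult_fun f d * mult_fun k (n div d))
       = mult_fun (\<lambda>p a. \<Sum>i\<le>a. f p i * k p (a - i)) n"
  using \<open>n > 0\<close>
proof (induction n rule: prime_power_times_induct)
  case one
  have "{d. d dvd Suc 0} = {Suc 0}" by auto
  then show ?case by simp
next
  case (step p a m)
  have p: "prime p" "\<not> p dvd m" "p > 0" using step by (auto dest: prime_gt_0_nat)
  have "mult_fun f (p ^ i * d) * mult_fun k (p ^ a * m div (p ^ i * d))
      = f p i * k p (a - i) * (mult_fun f d * mult_fun k (m div d))"
    if "i \<le> a" "d dvd m" for i d
  proof -
    have d: "\<not> p dvd d" using that p dvd_trans by blast
    obtain e where e: "m = d * e" using \<open>d dvd m\<close> by (elim dvdE)
    have ne: "\<not> p dvd e" "d > 0" using p e step(4) by auto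
    have "p ^ a = p ^ i * p ^ (a - i)" using that by (simp flip: power_add)
    then have "p ^ a * m = (p ^ i * d) * (p ^ (a - i) * e)" using e by (simp add: ac_simps)
    then have "p ^ a * m div (p ^ i * d) = p ^ (a - i) * e" using ne p by simp
    moreover have "m div d = e" using e ne by simp
    ultimately show ?thesis
      using mult_fun_prime_power_times[of p d f i] mult_fun_prime_power_times[of p e k "a - i"]
        p d ne f0 k0 by (simp add: ac_simps)
  qed
  then have "(\<Sum>d | d dvd p ^ a * m. mult_fun f d * mult_fun k (p ^ a * m div d))
     = (\<Sum>i\<le>a. \<Sum>d | d dvd m. f p i * k p (a - i) * (mult_fun f d * mult_fun k (m div d)))"
    using p by (subst sum_divisors_prime_power_times) auto
  also have "\<dots> = (\<Sum>i\<le>a. f p i * k p (a - i)) * (\<Sum>d | d dvd m. mult_fun f d * mult_fun k (m div d))"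
    by (simp add: sum_product)
  also have "\<dots> = mult_fun (\<lambda>p a. \<Sum>i\<le>a. f p i * k p (a - i)) (p ^ a * m)"
    using step p f0 k0 by (subst mult_fun_prime_power_times) auto
  finally show ?case .
qed

lemma mult_fun_one: "mult_fun (\<lambda>_ _. 1) n = (if n = 0 then 0 else 1)"
  by (simp add: mult_fun_def)

lemma sum_divisors_mult_fun:
  fixes f :: "nat \<Rightarrow> nat \<Rightarrow> 'a::comm_semiring_1"
  assumes "\<And>p. prime p \<Longrightarrow> f p 0 = 1" "n > 0"
  shows "(\<Sum>d | d dvd n. mult_fun f d) = mult_fun (\<lambda>p a. \<Sum>i\<le>a. f p i) n"
proof -
  have "(\<Sum>d | d dvd n. mult_fun f d) = (\<Sum>d | d dvd n. mult_fun f d * mult_fun (\<lambda>_ _. 1) (n div d))"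
    using assms(2) by (intro sum.cong) (auto simp: mult_fun_one dvd_div_eq_0_iff)
  then show ?thesis using mult_fun_convolution[of f "\<lambda>_ _. 1" n] assms by simp
qed

lemma mult_fun_times: "mult_fun f n * mult_fun k n = mult_fun (\<lambda>p a. f p a * k p a) n"
  by (simp add: mult_fun_def prod.distrib)

lemma mult_fun_powr: "real n powr s = mult_fun (\<lambda>p a. real (p ^ a) powr s) n"
proof (cases "n = 0")
  case False
  have "real n = (\<Prod>p\<in>prime_factors n. real (p ^ multiplicity p n))"
    using prod_prime_factors[of n] False by (metis of_nat_prod normalize_nat_def id_apply)
  then have "real n powr s = (\<Prod>p\<in>prime_factors n. real (p ^ multiplicity p n) powr s)"
    by (simp add: prod_powr_distrib)
  then show ?thesis using False by (simp add: mult_fun_def)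
qed simp

lemma mult_fun_norm:
  fixes f :: "nat \<Rightarrow> nat \<Rightarrow> 'a::{real_normed_field}"
  shows "norm (mult_fun f n) = mult_fun (\<lambda>p a. norm (f p a)) n"
  by (simp add: mult_fun_def prod_norm)

text \<open>The local values solve \<open>\<sigma>\<^sup>(\<^sup>r\<^sup>) = id * g\<close> at prime powers.\<close>

definition g_coeff :: "nat \<Rightarrow> nat \<Rightarrow> real" where
  "g_coeff r = mult_fun (\<lambda>p a. if a = 0 then 1 else if a \<le> r then 0
      else if a = r + 1 then real p ^ r else real p ^ r - real p ^ (r + 1))"

lemma sigma_ord_mult_fun:
  "real (sigma_ord r n) = mult_fun (\<lambda>p a. if a \<le> r then real p ^ a else real p ^ a + real p ^ r) n"
  by (auto simp: sigma_ord_def mult_fun_def intro!: prod.cong)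

lemma real_mult_fun: "real n = mult_fun (\<lambda>p a. real p ^ a) n"
proof (cases "n = 0")
  case False
  have "real n = (\<Prod>p\<in>prime_factors n. real (p ^ multiplicity p n))"
    using prod_prime_factors[of n] False by (metis of_nat_prod normalize_nat_def id_apply)
  then show ?thesis using False by (simp add: mult_fun_def)
qed simp

text \<open>Raising \<open>a\<close> by one multiplies the old sum by x and adds the new local
  value. Hence the values of g are forced: with s(a) the local value of \<sigma>, they are s(a+1) -
  p s(a), that is 0 up to r, then p^r, then p^r - p^(r+1).\<close>

lemma g_local_convolution:
  fixes x :: real
  assumes "r \<ge> 1"
  shows "(\<Sum>i\<le>a. (if i = 0 then 1 else if i \<le> r then 0
      else if i = r + 1 then x ^ r else x ^ r - x ^ (r + 1)) * x ^ (a - i))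
     = (if a \<le> r then x ^ a else x ^ a + x ^ r)"
proof (induction a)
  case (Suc a)
  let ?f = "\<lambda>i. if i = 0 then 1 else if i \<le> r then 0
      else if i = r + 1 then x ^ r else x ^ r - x ^ (r + 1)"
  have "(\<Sum>i\<le>Suc a. ?f i * x ^ (Suc a - i)) = (\<Sum>i\<le>a. ?f i * x ^ (Suc a - i)) + ?f (Suc a)"
    by simp
  also have "(\<Sum>i\<le>a. ?f i * x ^ (Suc a - i)) = x * (\<Sum>i\<le>a. ?f i * x ^ (a - i))"
    unfolding sum_distrib_left by (intro sum.cong) (auto simp: Suc_diff_le)
  also have "\<dots> + ?f (Suc a) = (if Suc a \<le> r then x ^ Suc a else x ^ Suc a + x ^ r)"
    unfolding Suc.IH using assms by (auto simp: algebra_simps)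
  finally show ?case .
qed (use assms in auto)

lemma sigma_ord_divisor_sum:
  assumes "r \<ge> 1" "n > 0"
  shows "real (sigma_ord r n) = (\<Sum>d | d dvd n. g_coeff r d * real (n div d))"
proof -
  have "(\<Sum>d | d dvd n. g_coeff r d * real (n div d))
     = (\<Sum>d | d dvd n. g_coeff r d * mult_fun (\<lambda>p a. real p ^ a) (n div d))"
    by (intro sum.cong refl) (subst real_mult_fun, rule refl)
  also have "\<dots> = mult_fun (\<lambda>p a. if a \<le> r then real p ^ a else real p ^ a + real p ^ r) n"
    unfolding g_coeff_def using assms by (subst mult_fun_convolution) (simp_all add: g_local_convolution del: power_Suc)
  finally show ?thesis by (simp add: sigma_ord_mult_fun)
qed

section \<open>The Dirichlet series of g\<close>

lemma powr_diff_ge: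
  fixes s x :: real
  assumes "s > 1" "x > 0"
  shows "(s - 1) * (x + 1) powr (-s) \<le> x powr (1 - s) - (x + 1) powr (1 - s)"
proof -
  have "\<exists>z>x. z < x + 1 \<and> (x + 1) powr (1 - s) - x powr (1 - s) = (x + 1 - x) * ((1 - s) * z powr (1 - s - 1))"
    using assms by (intro MVT2 has_real_derivative_powr) auto
  then obtain z where z: "z > x" "z < x + 1"
    "(x + 1) powr (1 - s) - x powr (1 - s) = (1 - s) * z powr (- s)" by auto
  have "(x + 1) powr (-s) \<le> z powr (-s)"
    using z assms by (intro powr_mono2') auto
  then have "(s - 1) * (x + 1) powr (-s) \<le> (s - 1) * z powr (-s)"
    using assms by (intro mult_left_mono) auto
  then show ?thesis using z(3) by (simp add: algebra_simps)
qed

text \<open>The bound zeta(s) <= 1 + 1/(s-1), by telescoping \<open>powr_diff_ge\<close> in place of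
  a comparison with an integral.\<close>

lemma sum_powr_le:
  assumes "s > 1"
  shows "(\<Sum>n\<le>N. real n powr (-s)) \<le> 1 + 1 / (s - 1)"
proof -
  have "(\<Sum>n\<le>Suc N. real n powr (-s)) \<le> 1 + (1 - real (Suc N) powr (1 - s)) / (s - 1)" for N
  proof (induction N)
    case (Suc N)
    have "real (Suc (Suc N)) powr (-s) \<le> (real (Suc N) powr (1 - s) - real (Suc (Suc N)) powr (1 - s)) / (s - 1)"
      using powr_diff_ge[of s "real (Suc N)"] assms by (simp add: field_simps)
    with Suc show ?case by (simp add: diff_divide_distrib)
  qed simp
  moreover have "1 + (1 - real (Suc N) powr (1 - s)) / (s - 1) \<le> 1 + 1 / (s - 1)"
    using assms by (intro add_left_mono divide_right_mono) auto
  moreover have "(\<Sum>n\<le>N. real n powr (-s)) \<le> (\<Sum>n\<le>Suc N. real n powr (-s))" by simp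
  ultimately show ?thesis using order_trans by meson
qed

text \<open>The base is a real variable because the local estimates, with x standing for p^-s, use
  only p >= 2 and p x <= 1.\<close>

definition g_local :: "nat \<Rightarrow> real \<Rightarrow> nat \<Rightarrow> real" where
  "g_local r p a = (if a = 0 then 1 else if a \<le> r then 0
      else if a = r + 1 then p ^ r else p ^ r - p ^ (r + 1))"

lemma g_coeff_local: "g_coeff r = mult_fun (\<lambda>p a. g_local r (real p) a)"
  by (simp add: g_coeff_def g_local_def)

lemma g_local_cases:
  fixes a r :: nat
  obtains (small) "a \<le> r" | (large) j where "a = r + 1 + j"
proof (cases "a \<le> r")
  case False
  then have "a = r + 1 + (a - r - 1)" by simp
  then show ?thesis by (rule large)
qed (rule small)

lemma g_local_sum_small:
  assumes "a \<le> r"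
  shows "(\<Sum>i\<le>a. g_local r p i * x ^ i) = 1" "(\<Sum>i\<le>a. \<bar>g_local r p i\<bar> * x ^ i) = 1"
proof -
  have "(\<Sum>i\<le>a. g_local r p i * x ^ i) = (\<Sum>i\<le>a. if i = 0 then 1 else 0)"
       "(\<Sum>i\<le>a. \<bar>g_local r p i\<bar> * x ^ i) = (\<Sum>i\<le>a. if i = 0 then 1 else 0)"
    using assms by (intro sum.cong; auto simp: g_local_def)+
  then show "(\<Sum>i\<le>a. g_local r p i * x ^ i) = 1" "(\<Sum>i\<le>a. \<bar>g_local r p i\<bar> * x ^ i) = 1"
    by (simp_all add: sum.delta)
qed

text \<open>The term at r + 1 is p^r x^(r+1) <= x. The later ones are at most x, x^2, x^3, and so
  on, because (p x)^(r+1) <= 1; as x <= 1/2, they add at most 2 x.\<close>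

lemma g_local_abs_sum_le:
  fixes x p :: real
  assumes p: "p \<ge> 2" and x: "0 \<le> x" "p * x \<le> 1"
  shows "(\<Sum>i\<le>a. \<bar>g_local r p i\<bar> * x ^ i) \<le> 1 + 3 * x"
proof (cases a r rule: g_local_cases)
  case (large j)
  have x2: "x \<le> 1 / 2" using mult_right_mono[OF p x(1)] x by simp
  have pr: "p ^ k * x ^ k \<le> 1" for k
    using p x by (simp flip: power_mult_distrib add: power_le_one)
  have "(\<Sum>i\<le>r + 1 + j. \<bar>g_local r p i\<bar> * x ^ i) \<le> 1 + x + 2 * x * (1 - x ^ j)"
  proof (induction j)
    case 0
    have "p ^ r * x ^ r * x \<le> 1 * x" using x pr by (intro mult_right_mono) auto
    then have "p ^ r * (x * x ^ r) \<le> x" by (simp add: ac_simps)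
    moreover have "g_local r p (Suc r) = p ^ r" by (simp add: g_local_def)
    ultimately show ?case using p g_local_sum_small[of r r p x] by (simp add: mult.commute)
  next
    case (Suc j)
    have "\<bar>g_local r p (r + 2 + j)\<bar> = p ^ (r + 1) - p ^ r"
      using p by (simp add: g_local_def abs_if)
    also have "\<dots> \<le> p ^ (r + 1)" using p by simp
    finally have "\<bar>g_local r p (r + 2 + j)\<bar> * x ^ (r + 2 + j) \<le> p ^ (r + 1) * x ^ (r + 2 + j)"
      using x by (intro mult_right_mono) auto
    also have "\<dots> = (p ^ (r + 1) * x ^ (r + 1)) * x ^ (1 + j)" by (simp flip: power_add)
    also have "\<dots> \<le> 1 * x ^ (1 + j)" using pr[of "r + 1"] x by (intro mult_right_mono) auto
    also have "\<dots> \<le> (2 * (1 - x)) * x ^ (1 + j)" using x x2 by (intro mult_right_mono) auto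
    also have "\<dots> = 2 * x * (1 - x ^ Suc j) - 2 * x * (1 - x ^ j)" by (simp add: algebra_simps)
    finally show ?case using Suc by simp
  qed
  also have "\<dots> \<le> 1 + x + 2 * x * 1" using x by (intro add_left_mono mult_left_mono) auto
  finally show ?thesis using large by simp
qed (use x in \<open>simp add: g_local_sum_small\<close>)

text \<open>Keeping the signs, the truncated Euler factors at \<open>x = p\<^sup>-\<^sup>s\<close> are nonnegative and at most \<open>1 + x\<close>.
  With absolute values the bound would be \<open>1 + 3 x\<close>, and \<open>G(1 + \<delta>)\<close> would only be \<open>O(\<delta>\<^sup>-\<^sup>3)\<close>.\<close>

lemma g_local_sum_bounds:
  fixes x p :: real
  assumes p: "p \<ge> 2" and x: "0 \<le> x" "p * x \<le> 1"
  shows "(\<Sum>i\<le>a. g_local r p i * x ^ i) \<in> {0..1 + x}"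
proof (cases a r rule: g_local_cases)
  case (large j)
  have pr: "p ^ k * x ^ k \<le> 1" for k
    using p x by (simp flip: power_mult_distrib add: power_le_one)
  \<comment> \<open>The remainder p^r x^(r+1+j) in the lower bound makes the induction close: the
    next term is negative, and its size is at most the decrease of this remainder, since (p - 1) x
    <= 1 - x.\<close>
  have "(\<Sum>i\<le>r + 1 + j. g_local r p i * x ^ i) \<in> {1 + p ^ r * x ^ (r + 1 + j)..1 + x}"
  proof (induction j)
    case 0
    have "p ^ r * x ^ r * x \<le> 1 * x" using x pr by (intro mult_right_mono) auto
    then have "p ^ r * (x * x ^ r) \<le> x" by (simp add: ac_simps)
    moreover have "g_local r p (Suc r) = p ^ r" by (simp add: g_local_def)
    ultimately show ?case using p g_local_sum_small[of r r p x] by (simp add: mult.commute)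
  next
    case (Suc j)
    define A where "A = p ^ r * x ^ (r + 1 + j)"
    have "g_local r p (r + 2 + j) = p ^ r * (1 - p)"
      by (simp add: g_local_def algebra_simps)
    then have "g_local r p (r + 2 + j) * x ^ (r + 2 + j) = - (A * ((p - 1) * x))"
      by (simp add: A_def) (simp add: algebra_simps)
    then have eq: "(\<Sum>i\<le>r + 1 + Suc j. g_local r p i * x ^ i)
        = (\<Sum>i\<le>r + 1 + j. g_local r p i * x ^ i) - A * ((p - 1) * x)" by simp
    have "A \<ge> 0" using p x by (simp add: A_def)
    then have "A * ((p - 1) * x) \<le> A * (1 - x)"
      using p x by (intro mult_left_mono) (auto simp: left_diff_distrib)
    also have "\<dots> = A - p ^ r * x ^ (r + 1 + Suc j)" by (simp add: A_def right_diff_distrib)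
    finally have "A * ((p - 1) * x) \<le> A - p ^ r * x ^ (r + 1 + Suc j)" .
    moreover have "A * ((p - 1) * x) \<ge> 0" using p x \<open>A \<ge> 0\<close> by simp
    ultimately show ?case using Suc unfolding eq A_def[symmetric] by simp
  qed
  moreover have "0 \<le> p ^ r * x ^ (r + 1 + j)" using p x by simp
  ultimately show ?thesis using large by auto
qed (use x in \<open>simp add: g_local_sum_small\<close>)

section \<open>Finite Euler products\<close>

lemma power_powr_eq: "(real p ^ i) powr s = (real p powr s) ^ i"
  by (induction i) (simp_all add: powr_mult)

text \<open>An Euler product with finitely many truncated factors. Taken at n = N! with N growing,
  it replaces infinite products throughout.\<close>

lemma sum_divisors_mult_fun_powr:
  assumes f0: "\<And>p. prime p \<Longrightarrow> f p 0 = (1::real)" and n: "n > 0"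
  shows "(\<Sum>d | d dvd n. mult_fun f d * real d powr (-s))
       = (\<Prod>p\<in>prime_factors n. \<Sum>i\<le>multiplicity p n. f p i * (real p powr (-s)) ^ i)"
proof -
  have "(\<Sum>d | d dvd n. mult_fun f d * real d powr (-s))
      = (\<Sum>d | d dvd n. mult_fun (\<lambda>p i. f p i * real (p ^ i) powr (-s)) d)"
    by (simp add: mult_fun_powr mult_fun_times)
  also have "\<dots> = mult_fun (\<lambda>p a. \<Sum>i\<le>a. f p i * real (p ^ i) powr (-s)) n"
    using f0 n by (subst sum_divisors_mult_fun) auto
  also have "\<dots> = (\<Prod>p\<in>prime_factors n. \<Sum>i\<le>multiplicity p n. f p i * (real p powr (-s)) ^ i)"
    using n unfolding mult_fun_def
    by (simp add: power_powr_eq)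
  finally show ?thesis .
qed

lemma prime_powr_bounds:
  assumes "prime p" "s > 1"
  shows "real p \<ge> 2" "0 \<le> real p powr (-s)" "real p * real p powr (-s) \<le> 1"
proof -
  show "real p \<ge> 2" using assms prime_ge_2_nat by fastforce
  then have "real p * real p powr (-s) = real p powr (1 - s)" by (simp add: powr_diff powr_minus field_simps)
  also have "\<dots> \<le> real p powr 0" using \<open>real p \<ge> 2\<close> assms by (intro powr_mono) auto
  finally show "real p * real p powr (-s) \<le> 1" using \<open>real p \<ge> 2\<close> by simp
qed auto

lemma dvd_fact_subset: "{..N} - {0} \<subseteq> {d. d dvd (fact N :: nat)}"
  by (auto intro: dvd_fact)

text \<open>Each Euler factor is at most 1 + 3 p^-s <= exp(3 p^-s), so the sums over the divisors of
  N! stay below exp(3 (1 + 1/(s-1))). This is poor near s = 1, but only finiteness is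
  wanted.\<close>

lemma g_coeff_abs_summable:
  assumes s: "s > 1"
  shows "(\<lambda>n. \<bar>g_coeff r n\<bar> * real n powr (-s)) summable_on UNIV"
proof -
  define Z where "Z = 1 + 1 / (s - 1)"
  have bound: "(\<Sum>n<N. \<bar>g_coeff r n\<bar> * real n powr (-s)) \<le> exp (3 * Z)" for N
  proof -
    let ?M = "fact N :: nat"
    let ?P = "prime_factors ?M"
    have fin: "finite {d. d dvd ?M}" by simp
    have "(\<Sum>n<N. \<bar>g_coeff r n\<bar> * real n powr (-s)) = (\<Sum>n\<in>{..<N} - {0}. \<bar>g_coeff r n\<bar> * real n powr (-s))"
      by (intro sum.mono_neutral_right) auto
    also have "\<dots> \<le> (\<Sum>n | n dvd ?M. \<bar>g_coeff r n\<bar> * real n powr (-s))"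
    proof (intro sum_mono2 fin)
      show "{..<N} - {0} \<subseteq> {n. n dvd ?M}" using dvd_fact_subset[of N] by (auto simp: subset_iff)
    qed auto
    also have "\<dots> = (\<Sum>n | n dvd ?M. mult_fun (\<lambda>p a. \<bar>g_local r (real p) a\<bar>) n * real n powr (-s))"
      using mult_fun_norm[of "\<lambda>p a. g_local r (real p) a"] by (simp add: g_coeff_local)
    also have "\<dots> = (\<Prod>p\<in>?P. \<Sum>i\<le>multiplicity p ?M. \<bar>g_local r (real p) i\<bar> * (real p powr (-s)) ^ i)"
      by (intro sum_divisors_mult_fun_powr) (auto simp: g_local_def)
    also have "\<dots> \<le> (\<Prod>p\<in>?P. 1 + 3 * real p powr (-s))"
      using prime_powr_bounds[OF in_prime_factors_imp_prime s]
      by (intro prod_mono conjI g_local_abs_sum_le sum_nonneg) auto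
    also have "\<dots> \<le> (\<Prod>p\<in>?P. exp (3 * real p powr (-s)))"
      by (intro prod_mono conjI exp_ge_add_one_self) auto
    also have "\<dots> = exp (3 * (\<Sum>p\<in>?P. real p powr (-s)))"
      by (simp add: exp_sum sum_distrib_left)
    also have "(\<Sum>p\<in>?P. real p powr (-s)) \<le> (\<Sum>n\<le>N. real n powr (-s))"
      by (intro sum_mono2) (auto simp: in_prime_factors_iff prime_dvd_fact_iff)
    also have "\<dots> \<le> Z" unfolding Z_def by (rule sum_powr_le[OF s])
    finally show ?thesis by simp
  qed
  have "summable (\<lambda>n. \<bar>g_coeff r n\<bar> * real n powr (-s))"
    using bound by (intro summableI_nonneg_bounded) auto
  then show ?thesis by (subst summable_on_UNIV_nonneg_real_iff) auto
qed

lemma g_coeff_summable: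
  assumes "s > 1"
  shows "(\<lambda>n. g_coeff r n * real n powr (-s)) summable_on UNIV"
  using g_coeff_abs_summable[OF assms, of r]
  by - (rule abs_summable_summable, simp add: abs_mult)

definition G_series :: "nat \<Rightarrow> real \<Rightarrow> real" where
  "G_series r s = (\<Sum>\<^sub>\<infinity>n. g_coeff r n * real n powr (-s))"

text \<open>The divisors of N! exhaust the positive integers, so an unordered sum is the limit of
  its finite Euler products.\<close>

lemma filterlim_divisors_fact:
  "filterlim (\<lambda>N. {d. d dvd (fact N :: nat)}) (finite_subsets_at_top {0<..}) sequentially"
proof (subst filterlim_finite_subsets_at_top, intro allI impI)
  fix X :: "nat set" assume X: "finite X \<and> X \<subseteq> {0<..}"
  show "eventually (\<lambda>N. finite {d. d dvd (fact N :: nat)} \<and> X \<subseteq> {d. d dvd (fact N :: nat)} \<and>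
            {d. d dvd (fact N :: nat)} \<subseteq> {0<..}) sequentially"
    using eventually_ge_at_top[of "Max (insert 0 X)"]
  proof eventually_elim
    case (elim N)
    have "x dvd fact N" if "x \<in> X" for x
    proof (intro dvd_fact)
      have "0 < x" using that X by blast
      then show "1 \<le> x" by simp
      have "x \<le> Max (insert 0 X)" using that X by (intro Max_ge) auto
      then show "x \<le> N" using elim by linarith
    qed
    moreover have "d > 0" if "d dvd fact N" for d :: nat
      using that dvd_pos_nat[of "fact N" d] by simp
    moreover have "finite {d. d dvd (fact N :: nat)}" by simp
    ultimately show ?case by blast
  qed
qed

text \<open>Over the divisors of N! the factor at p lies between 0 and 1 + p^-s. The latter is at
  most the factor of zeta over the same divisors, because every prime involved divides N!; so G is
  dominated by zeta, with a simple pole only.\<close>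

lemma G_series_bounds:
  assumes s: "s > 1"
  shows "0 \<le> G_series r s" "G_series r s \<le> 1 + 1 / (s - 1)"
proof -
  have hs: "((\<lambda>n. g_coeff r n * real n powr (-s)) has_sum G_series r s) {0<..}"
    using has_sum_infsum[OF g_coeff_summable[OF s, of r]] unfolding G_series_def
    by (subst has_sum_cong_neutral[of UNIV _ _ "\<lambda>n. g_coeff r n * real n powr (-s)"]) (auto simp: g_coeff_def)
  have lim: "(\<lambda>N. \<Sum>d | d dvd (fact N :: nat). g_coeff r d * real d powr (-s)) \<longlonglongrightarrow> G_series r s"
    by (rule filterlim_compose[OF hs[unfolded has_sum_def] filterlim_divisors_fact])
  have "(\<Sum>d | d dvd (fact N :: nat). g_coeff r d * real d powr (-s)) \<in> {0..1 + 1 / (s - 1)}" for N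
  proof -
    let ?M = "fact N :: nat"
    let ?P = "prime_factors ?M"
    have fin: "finite {d. d dvd ?M}" by simp
    have eq: "(\<Sum>d | d dvd ?M. g_coeff r d * real d powr (-s))
        = (\<Prod>p\<in>?P. \<Sum>i\<le>multiplicity p ?M. g_local r (real p) i * (real p powr (-s)) ^ i)"
      unfolding g_coeff_local by (intro sum_divisors_mult_fun_powr) (auto simp: g_local_def)
    have loc: "(\<Sum>i\<le>multiplicity p ?M. g_local r (real p) i * (real p powr (-s)) ^ i) \<in> {0..1 + real p powr (-s)}"
      if "p \<in> ?P" for p
      using prime_powr_bounds[OF in_prime_factors_imp_prime[OF that] s] by (intro g_local_sum_bounds)
    have "(\<Sum>d | d dvd ?M. g_coeff r d * real d powr (-s)) \<le> (\<Prod>p\<in>?P. 1 + real p powr (-s))"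
      unfolding eq using loc by (intro prod_mono) auto
    also have "\<dots> \<le> (\<Prod>p\<in>?P. \<Sum>i\<le>multiplicity p ?M. 1 * (real p powr (-s)) ^ i)"
    proof (intro prod_mono conjI)
      fix p assume p: "p \<in> ?P"
      then have "multiplicity p ?M > 0" by (auto simp: prime_factors_multiplicity)
      then have "(\<Sum>i\<in>{0,1}. 1 * (real p powr (-s)) ^ i) \<le> (\<Sum>i\<le>multiplicity p ?M. 1 * (real p powr (-s)) ^ i)"
        by (intro sum_mono2) auto
      then show "1 + real p powr (-s) \<le> (\<Sum>i\<le>multiplicity p ?M. 1 * (real p powr (-s)) ^ i)" by simp
    qed auto
    also have "\<dots> = (\<Sum>d | d dvd ?M. mult_fun (\<lambda>_ _. 1) d * real d powr (-s))"
      by (subst sum_divisors_mult_fun_powr) auto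
    also have "\<dots> = (\<Sum>d | d dvd ?M. real d powr (-s))"
      by (intro sum.cong) (auto simp: mult_fun_one)
    also have "\<dots> \<le> (\<Sum>d\<le>?M. real d powr (-s))"
      by (intro sum_mono2) (auto intro: dvd_imp_le)
    also have "\<dots> \<le> 1 + 1 / (s - 1)" by (rule sum_powr_le[OF s])
    finally have "(\<Sum>d | d dvd ?M. g_coeff r d * real d powr (-s)) \<le> 1 + 1 / (s - 1)" .
    moreover have "0 \<le> (\<Sum>d | d dvd ?M. g_coeff r d * real d powr (-s))"
      unfolding eq using loc by (intro prod_nonneg) auto
    ultimately show ?thesis by simp
  qed
  then have *: "0 \<le> (\<Sum>d | d dvd (fact N :: nat). g_coeff r d * real d powr (-s))"
    "(\<Sum>d | d dvd (fact N :: nat). g_coeff r d * real d powr (-s)) \<le> 1 + 1 / (s - 1)" for N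
    by auto
  show "0 \<le> G_series r s" by (rule LIMSEQ_le_const[OF lim]) (use * in auto)
  show "G_series r s \<le> 1 + 1 / (s - 1)" by (rule LIMSEQ_le_const2[OF lim]) (use * in auto)
qed

section \<open>The coefficients of H and the constant D\<close>

text \<open>The index \<open>0\<close> contributes nothing, because \<open>0 powr s = 0\<close> and division by \<open>0\<close> gives \<open>0\<close>.\<close>

definition has_dirichlet_sum :: "(nat \<Rightarrow> complex) \<Rightarrow> complex \<Rightarrow> complex \<Rightarrow> bool" where
  "has_dirichlet_sum f s a \<longleftrightarrow> ((\<lambda>n. f n / of_nat n powr s) has_sum a) UNIV"

definition dirichlet_conv :: "(nat \<Rightarrow> complex) \<Rightarrow> (nat \<Rightarrow> complex) \<Rightarrow> nat \<Rightarrow> complex" where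
  "dirichlet_conv f k n = (if n = 0 then 0 else \<Sum>d | d dvd n. f d * k (n div d))"

lemma has_dirichlet_sum_imp_series:
  assumes "has_dirichlet_sum f s a"
  shows "summable (dirichlet_term f s)" "dirichlet_series f s = a"
proof -
  have "(\<lambda>n. f n / of_nat n powr s) sums a"
    using assms has_sum_imp_sums unfolding has_dirichlet_sum_def by blast
  then have "dirichlet_term f s sums a"
    unfolding dirichlet_term_def by (subst sums_Suc_iff) simp
  then show "summable (dirichlet_term f s)" "dirichlet_series f s = a"
    by (auto simp: dirichlet_series_def sums_iff)
qed

lemma norm_nat_powr: "norm (of_nat n powr s :: complex) = real n powr (Re s)"
  using norm_powr_real_powr[of "of_nat n" s] by simp

lemma has_dirichlet_sum_if_abs_summable:
  assumes "(\<lambda>n. norm (f n) * real n powr (- Re s)) summable_on UNIV"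
  shows "\<exists>a. has_dirichlet_sum f s a"
proof -
  have "(\<lambda>n. norm (f n / of_nat n powr s)) = (\<lambda>n. norm (f n) * real n powr (- Re s))"
    by (auto simp: norm_divide norm_nat_powr powr_minus field_simps)
  then have "(\<lambda>n. f n / of_nat n powr s) summable_on UNIV"
    using assms abs_summable_summable by metis
  then show ?thesis unfolding has_dirichlet_sum_def by (auto simp: summable_on_def)
qed

text \<open>An unordered complex sum converges absolutely, so the double series may be regrouped by
  the product of its two indices.\<close>

lemma has_dirichlet_sum_conv:
  assumes f: "has_dirichlet_sum f s a" and k: "has_dirichlet_sum k s b"
  shows "has_dirichlet_sum (dirichlet_conv f k) s (a * b)"
proof -
  define F K where "F = (\<lambda>n. f n / of_nat n powr s)" and "K = (\<lambda>n. k n / of_nat n powr s)"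
  have F: "(F has_sum a) UNIV" and K: "(K has_sum b) UNIV"
    using f k by (simp_all add: has_dirichlet_sum_def F_def K_def)
  have Fa: "(\<lambda>n. norm (F n)) summable_on UNIV" and Ka: "(\<lambda>n. norm (K n)) summable_on UNIV"
    using F K has_sum_imp_summable by (auto simp flip: summable_on_iff_abs_summable_on_complex)
  have "(\<lambda>x. norm (case x of (m,n) \<Rightarrow> F m * K n)) summable_on UNIV \<times> UNIV"
  proof (subst Infinite_Sum.abs_summable_on_Sigma_iff, intro conjI ballI)
    fix m show "(\<lambda>n. norm (case (m, n) of (m, n) \<Rightarrow> F m * K n)) summable_on UNIV"
      using summable_on_cmult_right[OF Ka, of "norm (F m)"] by (simp add: norm_mult)
    show "(\<lambda>m. norm (\<Sum>\<^sub>\<infinity>n. norm (case (m, n) of (m, n) \<Rightarrow> F m * K n))) summable_on UNIV"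
      using summable_on_cmult_left[OF Fa, of "infsum (\<lambda>n. norm (K n)) UNIV"]
      by (simp add: norm_mult infsum_cmult_right' abs_mult infsum_nonneg)
  qed
  then have summ: "(\<lambda>(m,n). F m * K n) summable_on UNIV \<times> UNIV" by (rule abs_summable_summable)
  have "((\<lambda>(m,n). F m * K n) has_sum (a * b)) (UNIV \<times> UNIV)"
  proof (rule has_sum_SigmaI[where g = "\<lambda>m. F m * b", OF _ _ summ])
    fix m show "((\<lambda>n. case (m, n) of (m, n) \<Rightarrow> F m * K n) has_sum F m * b) UNIV"
      using has_sum_cmult_right[OF K] by simp
    show "((\<lambda>m. F m * b) has_sum a * b) UNIV" by (rule has_sum_cmult_left[OF F])
  qed
  \<comment> \<open>Index 0 is discarded first: (m, n) corresponds bijectively to the product with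
    its divisor m only among positive integers.\<close>
  then have "((\<lambda>(m,n). F m * K n) has_sum (a * b)) ({0<..} \<times> {0<..})"
    by (subst has_sum_cong_neutral[of "UNIV \<times> UNIV" _ _ "\<lambda>(m,n). F m * K n"]) (auto simp: F_def K_def)
  also have "?this \<longleftrightarrow> ((\<lambda>(n,d). F d * K (n div d)) has_sum (a * b)) (SIGMA n:{0<..}. {d. d dvd n})"
    by (rule has_sum_reindex_bij_witness[where i = "\<lambda>(n,d). (d, n div d)" and j = "\<lambda>(m,n). (m * n, m)"])
       (auto intro: dvd_pos_nat simp: dvd_div_eq_0_iff)
  finally have *: "((\<lambda>(n,d). F d * K (n div d)) has_sum (a * b)) (SIGMA n:{0<..}. {d. d dvd n})" .
  have "((\<lambda>n. \<Sum>d | d dvd n. F d * K (n div d)) has_sum (a * b)) {0<..}"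
    by (rule has_sum_Sigma'[OF *]) (auto intro!: has_sum_finite)
  also have "?this \<longleftrightarrow> ((\<lambda>n. dirichlet_conv f k n / of_nat n powr s) has_sum (a * b)) UNIV"
  proof (rule has_sum_cong_neutral)
    fix n :: nat assume "n \<in> {0<..} \<inter> UNIV"
    then have n: "n > 0" by simp
    have "F d * K (n div d) = f d * k (n div d) / of_nat n powr s" if "d dvd n" for d
    proof -
      obtain e where e: "n = d * e" using \<open>d dvd n\<close> by (elim dvdE)
      have "of_nat n powr s = of_nat d powr s * of_nat e powr s"
        unfolding e of_nat_mult by (intro powr_times_real) auto
      moreover have "n div d = e" using e n by simp
      ultimately show ?thesis by (simp add: F_def K_def)
    qed
    then show "(\<Sum>d | d dvd n. F d * K (n div d)) = dirichlet_conv f k n / of_nat n powr s"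
      using n by (simp add: dirichlet_conv_def sum_divide_distrib)
  qed auto
  finally show ?thesis by (simp add: has_dirichlet_sum_def)
qed

lemma has_dirichlet_sum_if_bounded:
  assumes "\<And>n. norm (f n) \<le> 1" "Re s > 1"
  shows "\<exists>a. has_dirichlet_sum f s a"
proof (rule has_dirichlet_sum_if_abs_summable)
  have "summable (\<lambda>n. real n powr (- Re s))" using assms by (simp add: summable_real_powr_iff)
  then have "(\<lambda>n. real n powr (- Re s)) summable_on UNIV"
    by (subst summable_on_UNIV_nonneg_real_iff) auto
  then show "(\<lambda>n. norm (f n) * real n powr (- Re s)) summable_on UNIV"
    by (rule summable_on_comparison_test) (use assms in \<open>auto intro!: mult_left_le_one_le\<close>)
qed

lemma has_dirichlet_sum_zeta:
  assumes "Re s > 1"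
  shows "has_dirichlet_sum (\<lambda>_. 1) s (zeta s)"
  using has_dirichlet_sum_if_bounded[of "\<lambda>_. 1" s] assms
  by (auto simp: zeta_def dest: has_dirichlet_sum_imp_series)

lemma has_dirichlet_sum_unique:
  "has_dirichlet_sum f s a \<Longrightarrow> has_dirichlet_sum f s b \<Longrightarrow> a = b"
  unfolding has_dirichlet_sum_def by (rule has_sum_unique)

section \<open>The Moebius function, and the nonvanishing of zeta for Re s > 1\<close>

definition moebius :: "nat \<Rightarrow> complex" where
  "moebius = mult_fun (\<lambda>_ a. if a = 0 then 1 else if a = 1 then -1 else 0)"

lemma moebius_conv_one: "dirichlet_conv (\<lambda>_. 1) moebius n = (if n = 1 then 1 else 0)"
proof (cases "n = 0")
  case False
  have "dirichlet_conv (\<lambda>_. 1) moebius n = (\<Sum>d | d dvd n. mult_fun (\<lambda>_ _. 1) d * moebius (n div d))"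
    using False by (auto simp: dirichlet_conv_def mult_fun_one intro!: sum.cong)
  also have "\<dots> = mult_fun (\<lambda>p a. \<Sum>i\<le>a. 1 * (if a - i = 0 then 1 else if a - i = 1 then -1 else 0)) n"
    unfolding moebius_def using False by (intro mult_fun_convolution) auto
  also have "(\<lambda>p a. \<Sum>i\<le>a. 1 * (if a - i = 0 then 1 else if a - i = 1 then -1 else 0))
      = (\<lambda>(p::nat) (a::nat). if a = 0 then 1 else 0 :: complex)"
  proof (intro ext)
    fix p a :: nat
    have "(\<Sum>i\<le>a. 1 * (if a - i = 0 then 1 else if a - i = 1 then -1 else 0))
        = (\<Sum>i\<le>a. if i = 0 then 1 else if i = 1 then -1 else 0 :: complex)"
      by (rule sum.reindex_bij_witness[where i = "\<lambda>i. a - i" and j = "\<lambda>i. a - i"]) auto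
    also have "\<dots> = (if a = 0 then 1 else 0)"
      by (induction a) auto
    finally show "(\<Sum>i\<le>a. 1 * (if a - i = 0 then 1 else if a - i = 1 then -1 else 0)) = (if a = 0 then 1 else 0 :: complex)" .
  qed
  also have "mult_fun (\<lambda>(p::nat) a. if a = 0 then 1 else 0 :: complex) n = (if n = 1 then 1 else 0)"
  proof (cases "n = 1")
    case n1: False
    then obtain p where p: "prime p" "p dvd n" using prime_factor_nat by blast
    then have "p \<in> prime_factors n" "multiplicity p n \<noteq> 0"
      using False by (auto simp: in_prime_factors_iff prime_multiplicity_gt_zero_iff prime_imp_prime_elem)
    then show ?thesis using False n1 by (auto simp: mult_fun_def)
  qed simp
  finally show ?thesis .
qed (simp add: dirichlet_conv_def)

text \<open>The convolution of 1 with \<open>moebius\<close> has the series 1, so zeta times the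
  Moebius series is 1. This gives both the reciprocal series and the cancellation of zeta factors in
  the identity for H.\<close>

lemma has_dirichlet_sum_moebius:
  assumes s: "Re s > 1"
  shows "zeta s \<noteq> 0" "has_dirichlet_sum moebius s (1 / zeta s)"
proof -
  have "norm (moebius n) \<le> 1" for n
    unfolding moebius_def mult_fun_norm by (auto simp: mult_fun_def intro!: prod_le_1)
  then obtain a where a: "has_dirichlet_sum moebius s a" using has_dirichlet_sum_if_bounded s by blast
  have "has_dirichlet_sum (dirichlet_conv (\<lambda>_. 1) moebius) s (zeta s * a)"
    by (intro has_dirichlet_sum_conv has_dirichlet_sum_zeta a s)
  moreover have "has_dirichlet_sum (dirichlet_conv (\<lambda>_. 1) moebius) s 1"
    unfolding has_dirichlet_sum_def moebius_conv_one
    by (rule has_sum_finite_neutralI[of "{1}"]) auto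
  ultimately have "zeta s * a = 1" by (rule has_dirichlet_sum_unique)
  then show "zeta s \<noteq> 0" by auto
  then have "a = 1 / zeta s" using \<open>zeta s * a = 1\<close> by (simp add: field_simps)
  then show "has_dirichlet_sum moebius s (1 / zeta s)" using a by simp
qed

text \<open>The sum has at most one term: if \<open>f\<close> has Dirichlet series \<open>F(s)\<close>, then \<open>power_coeff k c f\<close> has
  \<open>F(k s - c)\<close>.\<close>

definition power_coeff :: "nat \<Rightarrow> nat \<Rightarrow> (nat \<Rightarrow> complex) \<Rightarrow> nat \<Rightarrow> complex" where
  "power_coeff k c f n = (\<Sum>m | m ^ k = n. of_nat m ^ c * f m)"

lemma nat_power_powr: "of_nat (m ^ k) powr s = (of_nat m powr (of_nat k * s) :: complex)" if "m > 0"
proof (induction k)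
  case (Suc k)
  have "of_nat (m ^ Suc k) powr s = of_nat m powr s * of_nat (m ^ k) powr s"
    unfolding power_Suc of_nat_mult by (intro powr_times_real) auto
  then show ?case using Suc by (simp add: ring_distribs powr_add)
qed (use that in simp)

text \<open>Reindexing along the injective map m to m^k: the term m^c f(m) / m^(k s) equals f(m) /
  m^(k s - c).\<close>

lemma has_dirichlet_sum_power_coeff:
  assumes k: "k \<ge> 1" and f: "has_dirichlet_sum f (of_nat k * s - of_nat c) a"
  shows "has_dirichlet_sum (power_coeff k c f) s a"
proof -
  let ?t = "of_nat k * s - of_nat c"
  have inj: "inj_on (\<lambda>m. m ^ k) (UNIV :: nat set)" using k by (intro inj_onI) (simp add: power_eq_iff_eq_base)
  have val: "power_coeff k c f (m ^ k) / of_nat (m ^ k) powr s = f m / of_nat m powr ?t" for m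
  proof (cases "m = 0")
    case False
    have "{x. x ^ k = m ^ k} = {m}" using k by (auto simp: power_eq_iff_eq_base)
    then have "power_coeff k c f (m ^ k) = of_nat m ^ c * f m" by (simp add: power_coeff_def)
    moreover have "of_nat m powr ?t = of_nat (m ^ k) powr s / of_nat m ^ c"
      using False nat_power_powr[of m k s] by (simp add: powr_diff powr_nat')
    ultimately show ?thesis using False by simp
  qed (use k in simp)
  have "((\<lambda>n. power_coeff k c f n / of_nat n powr s) has_sum a) (range (\<lambda>m. m ^ k))"
    using f unfolding has_dirichlet_sum_def by (subst has_sum_reindex[OF inj]) (simp only: o_def val)
  then have "((\<lambda>n. power_coeff k c f n / of_nat n powr s) has_sum a) UNIV"
    by (subst has_sum_cong_neutral[of "range (\<lambda>m. m ^ k)" _ _ "\<lambda>n. power_coeff k c f n / of_nat n powr s"])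
       (auto simp: power_coeff_def intro!: sum.neutral)
  then show ?thesis by (simp add: has_dirichlet_sum_def)
qed

text \<open>The least N with \<open>d N\<close> nonzero would dominate: after multiplication by N^k,
  the terms beyond N of the series at k tend to 0 in total as k grows, while the whole series
  vanishes.\<close>

lemma dirichlet_coeffs_unique:
  assumes d0: "d 0 = 0"
    and sums: "\<And>j::nat. dirichlet_term d (of_nat (3 + j)) sums 0"
  shows "d n = 0"
proof (rule ccontr)
  assume "d n \<noteq> 0"
  define N where "N = (LEAST n. d n \<noteq> 0)"
  have dN: "d N \<noteq> 0" unfolding N_def by (rule LeastI[of "\<lambda>n. d n \<noteq> 0", OF \<open>d n \<noteq> 0\<close>])
  have small: "d m = 0" if "m < N" for m using that not_less_Least unfolding N_def by blast
  obtain M where M: "N = Suc M" using dN d0 by (cases N) auto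
  have tm: "dirichlet_term d (of_nat k) m = d (Suc m) / of_nat (Suc m) ^ k" if "k > 0" for k m
    using that unfolding dirichlet_term_def by (subst powr_nat') auto
  \<comment> \<open>Convergence is given without absolute convergence. What is used of it is that
    the terms at s = 3 are bounded, so d(n) = O(n^3).\<close>
  obtain K where K: "\<And>m. norm (d (Suc m) / of_nat (Suc m) ^ 3) \<le> K"
  proof -
    have "dirichlet_term d (of_nat (3 + 0)) = (\<lambda>m. d (Suc m) / of_nat (Suc m) ^ 3)"
      using tm[of 3] by (intro ext) (simp del: of_nat_Suc)
    then have "(\<lambda>m. d (Suc m) / of_nat (Suc m) ^ 3) sums 0" using sums[of 0] by metis
    then have "Bseq (\<lambda>m. d (Suc m) / of_nat (Suc m) ^ 3)"
      using sums_summable summable_imp_Bseq by blast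
    then show ?thesis using that by (auto simp: Bseq_def)
  qed
  have K0: "K \<ge> 0" using K[of 0] norm_ge_zero order_trans by blast
  have sq: "summable (\<lambda>m. 1 / real (Suc m) ^ 2)" using inverse_squares_sums
    by (auto dest: sums_summable)
  define C where "C = (\<Sum>m. 1 / real (Suc m) ^ 2)"
  have main: "norm (d N) \<le> K * C * real N ^ 5 * (real N / real (Suc N)) ^ j" for j
  proof -
    \<comment> \<open>In the exponent 5 + j, the part 3 absorbs the growth of d, the part 2 makes
      the tail summable, and j produces the power of N / (N + 1).\<close>
    let ?t = "dirichlet_term d (of_nat (5 + j))"
    have "?t sums 0" using sums[of "2 + j"] by (simp add: eval_nat_numeral)
    moreover have "(\<Sum>m<M. ?t m) = 0"
      using small M by (intro sum.neutral) (auto simp: dirichlet_term_def)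
    ultimately have "(\<lambda>m. ?t (m + M)) sums 0" using sums_split_initial_segment[of ?t 0 M] by simp
    then have "(\<lambda>m. ?t (m + N)) sums (- ?t M)"
      using sums_split_initial_segment[of "\<lambda>m. ?t (m + M)" 0 1] M by simp
    then have eq: "norm (?t M) = norm (\<Sum>m. ?t (m + N))" by (simp add: sums_iff)
    have b: "norm (?t (m + N)) \<le> K * (1 / real (Suc m) ^ 2) * (1 / real (Suc N) ^ j)" for m
    proof -
      have "norm (?t (m + N)) = norm (d (Suc (m + N)) / of_nat (Suc (m + N)) ^ 3) * ((1 / real (Suc (m + N)) ^ 2) * (1 / real (Suc (m + N)) ^ j))"
      proof -
        have p5: "x ^ (5 + j) = x ^ 3 * x ^ 2 * x ^ j" for x :: real by (simp flip: power_add)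
        have "norm (?t (m + N)) = norm (d (Suc (m + N))) / real (Suc (m + N)) ^ (5 + j)"
          using tm[of "5 + j" "m + N"] by (simp only: norm_divide norm_power norm_of_nat)
        then show ?thesis unfolding p5 by (simp add: norm_divide norm_power del: of_nat_Suc)
      qed
      also have "\<dots> \<le> K * ((1 / real (Suc m) ^ 2) * (1 / real (Suc N) ^ j))"
        using K[of "m + N"] K0 by (intro mult_mono divide_left_mono power_mono mult_pos_pos zero_less_power) auto
      finally show ?thesis by simp
    qed
    have s2: "summable (\<lambda>m. K * (1 / real (Suc m) ^ 2) * (1 / real (Suc N) ^ j))"
      by (intro summable_mult summable_mult2 sq)
    have "norm (\<Sum>m. ?t (m + N)) \<le> (\<Sum>m. K * (1 / real (Suc m) ^ 2) * (1 / real (Suc N) ^ j))"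
      by (rule norm_suminf_le[OF b s2])
    also have "\<dots> = K * C * (1 / real (Suc N) ^ j)"
      unfolding C_def by (simp only: suminf_mult suminf_mult2[symmetric] sq summable_mult)
    finally have "norm (?t M) \<le> K * C * (1 / real (Suc N) ^ j)" using eq by simp
    moreover have "norm (?t M) = norm (d N) / real N ^ (5 + j)"
      using tm[of "5 + j" M] M by (simp add: norm_divide norm_power del: of_nat_Suc of_nat_add)
    ultimately have "norm (d N) / real N ^ (5 + j) \<le> K * C * (1 / real (Suc N) ^ j)" by simp
    then have "norm (d N) \<le> K * C * (1 / real (Suc N) ^ j) * real N ^ (5 + j)"
      using M by (simp add: pos_divide_le_eq del: of_nat_Suc)
    also have "\<dots> = K * C * real N ^ 5 * (real N / real (Suc N)) ^ j"
      by (simp add: power_add power_divide del: of_nat_Suc)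
    finally show ?thesis .
  qed
  have "(\<lambda>j. K * C * real N ^ 5 * (real N / real (Suc N)) ^ j) \<longlonglongrightarrow> K * C * real N ^ 5 * 0"
    by (intro tendsto_mult_left LIMSEQ_power_zero) auto
  then have "norm (d N) \<le> 0" using main by (intro LIMSEQ_le_const) auto
  then show False using dN by simp
qed

text \<open>The identity for H solved for H, with zeta(s - 1) cancelled: the three factors have the
  series G(s), 1 / zeta((r+1) s - r) and zeta((r+2) s - r - 1).\<close>

definition H_explicit :: "nat \<Rightarrow> nat \<Rightarrow> complex" where
  "H_explicit r = dirichlet_conv (\<lambda>n. of_real (g_coeff r n))
     (dirichlet_conv (power_coeff (r + 1) r moebius) (power_coeff (r + 2) (r + 1) (\<lambda>_. 1)))"

lemma zeta_arguments:
  assumes "Re s > 1"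
  shows "Re (of_nat (r + 1) * s - of_nat r) > 1" "Re (of_nat (r + 2) * s - of_nat (r + 1)) > 1"
proof -
  have "real (r + 1) * Re s > real (r + 1) * 1" "real (r + 2) * Re s > real (r + 2) * 1"
    using assms by (intro mult_strict_left_mono; simp)+
  then show "Re (of_nat (r + 1) * s - of_nat r) > 1" "Re (of_nat (r + 2) * s - of_nat (r + 1)) > 1"
    by (simp_all add: algebra_simps)
qed

lemma has_dirichlet_sum_g:
  assumes "Re s > 1"
  obtains G where "has_dirichlet_sum (\<lambda>n. of_real (g_coeff r n)) s G"
  using has_dirichlet_sum_if_abs_summable[of "\<lambda>n. of_real (g_coeff r n)" s] g_coeff_abs_summable[OF assms]
  by auto

lemma has_dirichlet_sum_H_explicit:
  assumes s: "Re s > 1" and G: "has_dirichlet_sum (\<lambda>n. of_real (g_coeff r n)) s G"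
  shows "has_dirichlet_sum (H_explicit r) s
     (G * (1 / zeta (of_nat (r + 1) * s - of_nat r) * zeta (of_nat (r + 2) * s - of_nat (r + 1))))"
  unfolding H_explicit_def using zeta_arguments[OF s, of r]
  by (intro has_dirichlet_sum_conv G has_dirichlet_sum_power_coeff has_dirichlet_sum_moebius
        has_dirichlet_sum_zeta) simp_all

lemma has_dirichlet_sum_sigma_ord:
  assumes r: "r \<ge> 1" and s: "Re s > 2" and G: "has_dirichlet_sum (\<lambda>n. of_real (g_coeff r n)) s G"
  shows "has_dirichlet_sum (\<lambda>n. of_nat (sigma_ord r n)) s (G * zeta (s - 1))"
proof -
  have "has_dirichlet_sum (power_coeff 1 1 (\<lambda>_. 1)) s (zeta (s - 1))"
    using s by (intro has_dirichlet_sum_power_coeff) (auto intro: has_dirichlet_sum_zeta)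
  moreover have "power_coeff 1 1 (\<lambda>_. 1) = of_nat" by (simp add: power_coeff_def fun_eq_iff)
  ultimately have "has_dirichlet_sum (dirichlet_conv (\<lambda>n. of_real (g_coeff r n)) of_nat) s (G * zeta (s - 1))"
    using has_dirichlet_sum_conv[OF G] by simp
  moreover have "dirichlet_conv (\<lambda>n. of_real (g_coeff r n)) of_nat = (\<lambda>n. of_nat (sigma_ord r n))"
  proof
    fix n :: nat
    show "dirichlet_conv (\<lambda>n. of_real (g_coeff r n)) of_nat n = of_nat (sigma_ord r n)"
    proof (cases "n = 0")
      case False
      then have "complex_of_real (real (sigma_ord r n)) = complex_of_real (\<Sum>d | d dvd n. g_coeff r d * real (n div d))"
        using sigma_ord_divisor_sum[OF r, of n] by (simp only: neq0_conv)
      then show ?thesis using False by (simp add: dirichlet_conv_def)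
    qed (simp add: dirichlet_conv_def sigma_ord_def)
  qed
  ultimately show ?thesis by simp
qed

lemma is_H_coeff_H_explicit:
  assumes r: "r \<ge> 1"
  shows "is_H_coeff r (H_explicit r)"
  unfolding is_H_coeff_def
proof (intro conjI allI impI)
  show "H_explicit r 0 = 0" by (simp add: H_explicit_def dirichlet_conv_def)
  fix s :: complex assume s: "2 < Re s"
  then have s1: "Re s > 1" by simp
  obtain G where G: "has_dirichlet_sum (\<lambda>n. of_real (g_coeff r n)) s G"
    using has_dirichlet_sum_g[OF s1] by blast
  note h = has_dirichlet_sum_imp_series[OF has_dirichlet_sum_H_explicit[OF s1 G]]
  show "summable (dirichlet_term (H_explicit r) s)" by (rule h)
  show "dirichlet_series (\<lambda>n. of_nat (sigma_ord r n)) s =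
          zeta (s - 1) * zeta (of_nat (r + 1) * s - of_nat r)
            / zeta (of_nat (r + 2) * s - of_nat (r + 1)) * dirichlet_series (H_explicit r) s"
    unfolding h(2) has_dirichlet_sum_imp_series(2)[OF has_dirichlet_sum_sigma_ord[OF r s G]]
    using has_dirichlet_sum_moebius(1)[OF zeta_arguments(1)[OF s1, of r]]
      has_dirichlet_sum_moebius(1)[OF zeta_arguments(2)[OF s1, of r]]
    by (simp add: field_simps del: of_nat_add of_nat_Suc)
qed

text \<open>The quotient of zeta values is nonzero and cancels, so the two series agree at all
  integers s >= 3. With the existence of \<open>H_explicit\<close> this makes the definite
  description in \<open>H_coeff\<close> proper.\<close>

lemma is_H_coeff_unique:
  assumes h: "is_H_coeff r h" and k: "is_H_coeff r k"
  shows "h = k"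
proof
  fix n
  have "(\<lambda>n. h n - k n) n = 0"
  proof (rule dirichlet_coeffs_unique)
    show "h 0 - k 0 = 0" using h k by (simp add: is_H_coeff_def)
    fix j :: nat
    define s :: complex where "s = of_nat (3 + j)"
    have s: "Re s > 2" by (simp add: s_def)
    then have s1: "Re s > 1" "Re (s - 1) > 1" by simp_all
    have nz: "zeta (s - 1) * zeta (of_nat (r + 1) * s - of_nat r) / zeta (of_nat (r + 2) * s - of_nat (r + 1)) \<noteq> 0"
      using has_dirichlet_sum_moebius(1)[OF s1(2)] has_dirichlet_sum_moebius(1)[OF zeta_arguments(1)[OF s1(1), of r]]
        has_dirichlet_sum_moebius(1)[OF zeta_arguments(2)[OF s1(1), of r]] by (simp del: of_nat_add)
    have "dirichlet_series h s = dirichlet_series k s"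
      using h k s nz unfolding is_H_coeff_def by (metis mult_left_cancel)
    moreover have "dirichlet_term h s sums dirichlet_series h s" "dirichlet_term k s sums dirichlet_series k s"
      using h k s unfolding is_H_coeff_def dirichlet_series_def by (auto intro: summable_sums)
    ultimately have "(\<lambda>m. dirichlet_term h s m - dirichlet_term k s m) sums 0"
      using sums_diff by fastforce
    moreover have "dirichlet_term (\<lambda>n. h n - k n) s = (\<lambda>m. dirichlet_term h s m - dirichlet_term k s m)"
      by (simp add: dirichlet_term_def diff_divide_distrib fun_eq_iff)
    ultimately show "dirichlet_term (\<lambda>n. h n - k n) (of_nat (3 + j)) sums 0"
      by (simp add: s_def)
  qed
  then show "h n = k n" by simp
qed

text \<open>At s = 2 the two zeta arguments become r + 2 and r + 3, and the zeta values in
  \<open>mean_const\<close> cancel those in H(2).\<close>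

lemma mean_const_eq_G_series:
  assumes r: "r \<ge> 1"
  shows "mean_const r = G_series r 2 / 2"
proof -
  have H: "H_coeff r = H_explicit r" unfolding H_coeff_def
    using is_H_coeff_H_explicit[OF r] is_H_coeff_unique by blast
  have "((\<lambda>n. g_coeff r n * real n powr (-2)) has_sum G_series r 2) UNIV"
    unfolding G_series_def by (intro has_sum_infsum g_coeff_summable) simp
  then have "((\<lambda>n. complex_of_real (g_coeff r n * real n powr (-2))) has_sum of_real (G_series r 2)) UNIV"
    by (rule has_sum_of_real)
  also have "(\<lambda>n. complex_of_real (g_coeff r n * real n powr (-2))) = (\<lambda>n. of_real (g_coeff r n) / of_nat n powr 2)"
  proof
    fix n
    have "complex_of_real (real n powr 2) = of_nat n powr 2"
      using powr_of_real[of "real n" 2] by simp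
    moreover have "g_coeff r n * real n powr (-2) = g_coeff r n / real n powr 2"
      by (simp add: powr_minus divide_inverse)
    ultimately show "complex_of_real (g_coeff r n * real n powr (-2)) = of_real (g_coeff r n) / of_nat n powr 2"
      by (simp del: powr_numeral)
  qed
  finally have G: "has_dirichlet_sum (\<lambda>n. of_real (g_coeff r n)) 2 (of_real (G_series r 2))"
    by (simp add: has_dirichlet_sum_def)
  have s1: "Re 2 > 1" by simp
  have args: "of_nat (r + 1) * 2 - of_nat r = (of_nat (r + 2) :: complex)"
    "of_nat (r + 2) * 2 - of_nat (r + 1) = (of_nat (r + 3) :: complex)"
    by (simp_all add: algebra_simps)
  have "H r 2 = of_real (G_series r 2) * (1 / zeta (of_nat (r + 2)) * zeta (of_nat (r + 3)))"
    unfolding H_def H using has_dirichlet_sum_imp_series(2)[OF has_dirichlet_sum_H_explicit[OF s1 G]]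
    unfolding args .
  moreover have "zeta (of_nat (r + 2)) \<noteq> 0" "zeta (of_nat (r + 3)) \<noteq> 0"
    by (intro has_dirichlet_sum_moebius; simp)+
  ultimately have "zeta (of_nat (r + 2)) * H r 2 / (2 * zeta (of_nat (r + 3))) = of_real (G_series r 2 / 2)"
    by (simp add: field_simps del: of_nat_add)
  then show ?thesis unfolding mean_const_def by (simp only: Re_complex_of_real)
qed

section \<open>The Mellin transform of the error term\<close>

definition tri_err :: "real \<Rightarrow> real" where
  "tri_err y = (\<Sum>m = 1..nat \<lfloor>y\<rfloor>. real m) - y ^ 2 / 2"

definition sigma_err :: "nat \<Rightarrow> real \<Rightarrow> real" where
  "sigma_err r x = (\<Sum>n = 1..nat \<lfloor>x\<rfloor>. real (sigma_ord r n)) - mean_const r * x ^ 2"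

lemma sum_divisors_swap:
  fixes F :: "nat \<Rightarrow> nat \<Rightarrow> 'a::comm_monoid_add"
  shows "(\<Sum>n = 1..N. \<Sum>d | d dvd n. F d (n div d)) = (\<Sum>d = 1..N. \<Sum>m = 1..N div d. F d m)"
proof -
  have "(\<Sum>n = 1..N. \<Sum>d | d dvd n. F d (n div d))
      = (\<Sum>(n,d)\<in>(SIGMA n:{1..N}. {d. d dvd n}). F d (n div d))"
    by (rule sum.Sigma) auto
  also have "\<dots> = (\<Sum>(d,m)\<in>(SIGMA d:{1..N}. {1..N div d}). F d m)"
  proof -
    have A: "0 < d" "d \<le> N" "0 < n div d" "n div d \<le> N div d" "d * (n div d) = n"
      if "n \<in> {1..N}" "d dvd n" for n d
    proof -
      show "0 < d" using that dvd_pos_nat[of n d] by simp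
      show "d \<le> N" "n div d \<le> N div d" using that dvd_imp_le[of d n] by (auto intro: div_le_mono)
      show eq: "d * (n div d) = n" using that by simp
      show "0 < n div d" using eq that by (cases "n div d = 0") auto
    qed
    have B: "0 < d * m" "d * m \<le> N" if "d \<in> {1..N}" "m \<in> {1..N div d}" for d m
    proof -
      show "0 < d * m" using that by simp
      have "d * m \<le> d * (N div d)" using that by simp
      also have "\<dots> \<le> N" by simp
      finally show "d * m \<le> N" .
    qed
    show ?thesis
    proof (rule sum.reindex_bij_witness[where i = "\<lambda>(d,m). (d * m, d)" and j = "\<lambda>(n,d). (d, n div d)"], goal_cases)
      case (1 x)
      then show ?case using A(5) by (cases x) auto
    next
      case (2 x)
      then show ?case using A(1-4)[of "fst x" "snd x"] by (cases x) (auto simp: Suc_le_eq)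
    next
      case (3 x)
      then show ?case by (cases x) auto
    next
      case (4 x)
      then show ?case using B[of "fst x" "snd x"] by (cases x) (auto simp: Suc_le_eq)
    next
      case (5 x)
      then show ?case by (cases x) simp
    qed
  qed
  also have "\<dots> = (\<Sum>d = 1..N. \<Sum>m = 1..N div d. F d m)"
    by (rule sum.Sigma[symmetric]) auto
  finally show ?thesis .
qed

lemma nat_floor_divide: "nat \<lfloor>x / real d\<rfloor> = nat \<lfloor>x\<rfloor> div d" if "x \<ge> 0"
proof -
  have "\<lfloor>x / real d\<rfloor> = \<lfloor>x\<rfloor> div int d" using floor_divide_real_eq_div[of "int d" x] by simp
  then show ?thesis using that by (simp add: nat_div_distrib)
qed

text \<open>The series runs over all d. For d > x the sum in \<open>tri_err\<close> is empty and
  only -(x/d)^2 / 2 remains; with these terms the quadratic parts add up to exactly D x^2, without a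
  truncation error.\<close>

lemma sigma_err_has_sum:
  assumes r: "r \<ge> 1" and x: "x \<ge> 0"
  shows "((\<lambda>d. g_coeff r d * tri_err (x / real d)) has_sum sigma_err r x) UNIV"
proof -
  let ?N = "nat \<lfloor>x\<rfloor>"
  have "(\<Sum>n = 1..?N. real (sigma_ord r n)) = (\<Sum>n = 1..?N. \<Sum>d | d dvd n. g_coeff r d * real (n div d))"
    by (intro sum.cong sigma_ord_divisor_sum r) auto
  also have "\<dots> = (\<Sum>d = 1..?N. g_coeff r d * (\<Sum>m = 1..nat \<lfloor>x / real d\<rfloor>. real m))"
    by (subst sum_divisors_swap) (simp add: sum_distrib_left nat_floor_divide[OF x])
  finally have S: "((\<lambda>d. g_coeff r d * (\<Sum>m = 1..nat \<lfloor>x / real d\<rfloor>. real m)) has_sum (\<Sum>n = 1..?N. real (sigma_ord r n))) UNIV"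
  proof (intro has_sum_finite_neutralI)
    fix d assume "d \<in> UNIV - {1..?N}"
    then have "d = 0 \<or> ?N < d" by auto
    then have "?N div d = 0" by auto
    then show "g_coeff r d * (\<Sum>m = 1..nat \<lfloor>x / real d\<rfloor>. real m) = 0" by (simp add: nat_floor_divide[OF x])
  qed auto
  have "((\<lambda>d. g_coeff r d * real d powr (-2) * (x ^ 2 / 2)) has_sum G_series r 2 * (x ^ 2 / 2)) UNIV"
    unfolding G_series_def by (intro has_sum_cmult_left has_sum_infsum g_coeff_summable) simp
  also have "(\<lambda>d. g_coeff r d * real d powr (-2) * (x ^ 2 / 2)) = (\<lambda>d. g_coeff r d * ((x / real d) ^ 2 / 2))"
    by (auto simp: powr_minus power_divide field_simps)
  finally have "((\<lambda>d. g_coeff r d * ((x / real d) ^ 2 / 2)) has_sum mean_const r * x ^ 2) UNIV"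
    by (simp add: mean_const_eq_G_series[OF r])
  from has_sum_add[OF S has_sum_cmult_right[OF this, of "-1"]] show ?thesis
    by (simp add: tri_err_def sigma_err_def right_diff_distrib)
qed

lemma sum_real_nats: "(\<Sum>m = 1..n. real m) = real n * (real n + 1) / 2"
  by (induction n) (auto simp: field_simps)

text \<open>The bound y serves at infinity and y^2 at 0; together they make the Mellin integral
  converge for 1 < s < 2. The exact value below 1 evaluates the part over [0, 1).\<close>

lemma tri_err_bounds:
  assumes "y \<ge> 0"
  shows "\<bar>tri_err y\<bar> \<le> y" "\<bar>tri_err y\<bar> \<le> y ^ 2" "y < 1 \<Longrightarrow> \<bar>tri_err y\<bar> = y ^ 2 / 2"
proof -
  define N where "N = real (nat \<lfloor>y\<rfloor>)"
  have N: "0 \<le> N" "N \<le> y" "y < N + 1" using assms by (auto simp: N_def)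
  have t: "tri_err y = N * (N + 1) / 2 - y ^ 2 / 2"
    by (simp only: tri_err_def N_def sum_real_nats)
  have "N ^ 2 \<le> y ^ 2" "y ^ 2 \<le> (N + 1) ^ 2" using N by (intro power_mono; simp)+
  then have b: "tri_err y \<le> N / 2" "tri_err y \<ge> - (N / 2) - 1 / 2"
    unfolding t by (simp_all add: power2_eq_square field_simps)
  show small: "y < 1 \<Longrightarrow> \<bar>tri_err y\<bar> = y ^ 2 / 2"
  proof -
    assume "y < 1"
    then have "N = 0" using assms by (simp add: N_def nat_eq_iff floor_eq_iff)
    then show ?thesis using t by simp
  qed
  show le: "\<bar>tri_err y\<bar> \<le> y"
  proof (cases "y < 1")
    case True
    then have "y ^ 2 \<le> y" using assms by (simp add: power2_eq_square mult_left_le)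
    moreover have "y ^ 2 \<ge> 0" by simp
    ultimately show ?thesis using small[OF True] by linarith
  next
    case False
    then have "N \<ge> 1" using assms by (simp add: N_def le_nat_iff le_floor_iff)
    then show ?thesis using b N by linarith
  qed
  show "\<bar>tri_err y\<bar> \<le> y ^ 2"
  proof (cases "y < 1")
    case False
    then have "y \<le> y ^ 2" by (simp add: power2_eq_square)
    then show ?thesis using le by simp
  qed (use small in simp)
qed

lemma tri_err_measurable [measurable]: "tri_err \<in> borel_measurable borel"
proof -
  have "tri_err = (\<lambda>y. real (nat \<lfloor>y\<rfloor>) * (real (nat \<lfloor>y\<rfloor>) + 1) / 2 - y ^ 2 / 2)"
    by (intro ext) (simp only: tri_err_def sum_real_nats)
  also have "\<dots> \<in> borel_measurable borel" by measurable
  finally show ?thesis .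
qed

text \<open>The integrand of \<kappa>(s), extended by 0 to the whole line so that the dilations x /
  d act on it.\<close>

definition mellin_kernel :: "real \<Rightarrow> real \<Rightarrow> real" where
  "mellin_kernel s y = indicator {0<..} y * (tri_err y * y powr (- s - 1))"

lemma set_integrable_powr_from_0:
  assumes "a > -1"
  shows "set_integrable lborel {0..1} (\<lambda>x::real. x powr a)" "(LINT x:{0..1}|lborel. x powr a) = 1 / (a + 1)"
proof -
  have hi: "((\<lambda>x::real. x powr a) has_integral 1 / (a + 1)) {0..1}"
    using has_integral_powr_from_0[OF assms, of 1] by simp
  have "(\<lambda>x::real. x powr a) absolutely_integrable_on {0..1}"
    using hi by (intro nonnegative_absolutely_integrable_1) (auto intro: has_integral_integrable)
  then show si: "set_integrable lborel {0..1} (\<lambda>x::real. x powr a)"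
    unfolding set_integrable_def by (subst (asm) integrable_completion) auto
  show "(LINT x:{0..1}|lborel. x powr a) = 1 / (a + 1)"
    using set_borel_integral_eq_integral(2)[OF si] hi by (simp add: integral_unique)
qed

lemma set_integrable_powr_to_inf:
  assumes "a < -1"
  shows "set_integrable lborel {1..} (\<lambda>x::real. x powr a)"
proof -
  have "(\<lambda>x::real. x powr a) absolutely_integrable_on {1..}"
    using has_integral_powr_to_inf[OF assms, of 1]
    by (intro nonnegative_absolutely_integrable_1) (auto intro: has_integral_integrable)
  then show ?thesis
    unfolding set_integrable_def by (subst (asm) integrable_completion) auto
qed

lemma mellin_kernel_integrable:
  assumes "1 < s" "s < 2"
  shows "integrable lborel (mellin_kernel s)"
proof (rule Bochner_Integration.integrable_bound)
  let ?b = "\<lambda>y::real. indicator {0..1} y *\<^sub>R y powr (1 - s) + indicator {1..} y *\<^sub>R y powr (- s)"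
  show "integrable lborel ?b"
    using set_integrable_powr_from_0(1)[of "1 - s"] set_integrable_powr_to_inf[of "- s"] assms
    unfolding set_integrable_def by (intro Bochner_Integration.integrable_add) auto
  show "mellin_kernel s \<in> borel_measurable lborel" unfolding mellin_kernel_def by measurable
  show "AE y in lborel. norm (mellin_kernel s y) \<le> norm (?b y)"
  proof (rule AE_I2)
    fix y :: real
    show "norm (mellin_kernel s y) \<le> norm (?b y)"
    proof (cases "y > 0")
      case True
      have "y powr (1 - s) = y ^ 2 * y powr (- s - 1)" "y powr (- s) = y * y powr (- s - 1)"
        using True by (simp_all add: powr_diff powr_minus field_simps power2_eq_square)
      moreover have "norm (mellin_kernel s y) = \<bar>tri_err y\<bar> * y powr (- s - 1)"
        using True by (simp add: mellin_kernel_def abs_mult)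
      moreover have "\<bar>tri_err y\<bar> * y powr (- s - 1) \<le> y * y powr (- s - 1)"
        "\<bar>tri_err y\<bar> * y powr (- s - 1) \<le> y ^ 2 * y powr (- s - 1)"
        using tri_err_bounds[of y] True by (intro mult_right_mono; simp)+
      ultimately show ?thesis using True by (auto simp: indicator_def)
    qed (simp add: mellin_kernel_def)
  qed
qed

lemma set_integrable_mellin_kernel:
  assumes "1 < s" "s < 2" "A \<in> sets borel"
  shows "set_integrable lborel A (mellin_kernel s)"
  unfolding set_integrable_def
  by (rule integrable_mult_indicator) (use assms mellin_kernel_integrable in auto)

lemma set_lborel_integral_const:
  assumes "a \<le> b"
  shows "(LINT y:{a..<b}|lborel. c) = (b - a) * (c::real)"
  using assms by (simp add: set_lebesgue_integral_def)

lemma integral_tri_err: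
  fixes n :: nat
  shows "set_integrable lborel {real n..<real n + 1} tri_err"
    "(LINT y:{real n..<real n + 1}|lborel. tri_err y) = - 1 / 6"
proof -
  define c where "c = real n * (real n + 1) / 2"
  have eq: "indicator {real n..<real n + 1} y *\<^sub>R tri_err y
      = indicator {real n..<real n + 1} y *\<^sub>R (c - y ^ 2 / 2)" for y
  proof (cases "y \<in> {real n..<real n + 1}")
    case True
    then have "nat \<lfloor>y\<rfloor> = n" by (simp add: floor_eq_iff nat_eq_iff)
    then have "tri_err y = c - y ^ 2 / 2" by (simp only: tri_err_def sum_real_nats c_def)
    then show ?thesis by simp
  qed simp
  have hb: "has_bochner_integral lborel (\<lambda>y. indicator {real n..real n + 1} y *\<^sub>R (c - y ^ 2 / 2))
      ((c * (real n + 1) - (real n + 1) ^ 3 / 6) - (c * real n - real n ^ 3 / 6))"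
    by (rule has_bochner_integral_FTC_Icc)
       (auto intro!: derivative_eq_intros continuous_intros simp: has_real_derivative_iff_has_vector_derivative[symmetric] power2_eq_square)
  have ae: "AE y in lborel. indicator {real n..real n + 1} y *\<^sub>R (c - y ^ 2 / 2)
      = indicator {real n..<real n + 1} y *\<^sub>R tri_err y"
    using AE_lborel_singleton[of "real n + 1"] unfolding eq
    by eventually_elim (auto simp: indicator_def)
  have "has_bochner_integral lborel (\<lambda>y. indicator {real n..<real n + 1} y *\<^sub>R tri_err y)
      ((c * (real n + 1) - (real n + 1) ^ 3 / 6) - (c * real n - real n ^ 3 / 6))"
    by (rule has_bochner_integralI_AE[OF hb _ ae]) measurable
  moreover have "(c * (real n + 1) - (real n + 1) ^ 3 / 6) - (c * real n - real n ^ 3 / 6) = - 1 / 6"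
    by (simp add: c_def field_simps eval_nat_numeral)
  ultimately show "set_integrable lborel {real n..<real n + 1} tri_err"
    "(LINT y:{real n..<real n + 1}|lborel. tri_err y) = - 1 / 6"
    unfolding set_integrable_def set_lebesgue_integral_def has_bochner_integral_iff by auto
qed

lemma powr_decrement_le:
  fixes n :: real
  assumes "n \<ge> 1" "0 < s"
  shows "n powr (- s) - (n + 1) powr (- s) \<le> s * n powr (- s - 1)"
proof -
  have "\<exists>z>n. z < n + 1 \<and> (n + 1) powr (- s) - n powr (- s) = (n + 1 - n) * (- s * z powr (- s - 1))"
    using assms by (intro MVT2 has_real_derivative_powr) auto
  then obtain z where z: "z > n" "(n + 1) powr (- s) - n powr (- s) = - s * z powr (- s - 1)" by auto
  have "z powr (- s - 1) \<le> n powr (- s - 1)" using z assms by (intro powr_mono2') auto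
  then have "s * z powr (- s - 1) \<le> s * n powr (- s - 1)" using assms by (intro mult_left_mono) auto
  then show ?thesis using z by simp
qed

text \<open>The mean of \<open>tri_err\<close> over a unit interval is \<open>-1/6\<close>, although its size there is of order \<open>n\<close>. So the
  integral of \<open>tri_err y * y\<^sup>-\<^sup>s\<^sup>-\<^sup>1\<close> is bounded as \<open>s\<close> tends to \<open>1\<close>.\<close>

lemma mellin_kernel_interval_bound:
  fixes n :: nat
  assumes s: "1 < s" "s < 2" and n: "n \<ge> 1"
  shows "\<bar>LINT y:{real n..<real n + 1}|lborel. mellin_kernel s y\<bar> \<le> 7 * real n powr (-2)"
proof -
  let ?I = "{real n..<real n + 1}"
  let ?w = "\<lambda>y::real. y powr (- s - 1)"
  note ti = integral_tri_err[of n]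
  have ki: "set_integrable lborel ?I (mellin_kernel s)"
    by (intro set_integrable_mellin_kernel s) auto
  have "(LINT y:?I|lborel. mellin_kernel s y - ?w (real n) * tri_err y)
      = (LINT y:?I|lborel. mellin_kernel s y) - ?w (real n) * (- 1 / 6)"
    using ki ti by (subst set_integral_diff) auto
  then have eq: "(LINT y:?I|lborel. mellin_kernel s y)
      = (LINT y:?I|lborel. mellin_kernel s y - ?w (real n) * tri_err y) - ?w (real n) / 6" by simp
  define B where "B = 2 * real n * (?w (real n) - ?w (real n + 1))"
  have ptw: "\<bar>mellin_kernel s y - ?w (real n) * tri_err y\<bar> \<le> B" if y: "y \<in> ?I" for y
  proof -
    have w: "?w y \<le> ?w (real n)" "?w (real n + 1) \<le> ?w y"
      using y n s by (intro powr_mono2'; simp)+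
    have "mellin_kernel s y - ?w (real n) * tri_err y = - (tri_err y * (?w (real n) - ?w y))"
      using y n by (simp add: mellin_kernel_def algebra_simps)
    then have "\<bar>mellin_kernel s y - ?w (real n) * tri_err y\<bar> = \<bar>tri_err y\<bar> * (?w (real n) - ?w y)"
      using w by (simp add: abs_mult)
    also have "\<dots> \<le> (2 * real n) * (?w (real n) - ?w (real n + 1))"
      using w tri_err_bounds(1)[of y] y n by (intro mult_mono) auto
    finally show ?thesis by (simp add: B_def)
  qed
  have si: "set_integrable lborel ?I (\<lambda>y. mellin_kernel s y - ?w (real n) * tri_err y)"
    using ki ti by (intro set_integral_diff) auto
  have sc: "set_integrable lborel ?I (\<lambda>_. c)" for c :: real
    unfolding set_integrable_def by (rule integrable_scaleR_left) (simp add: integrable_indicator_iff)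
  have "(LINT y:?I|lborel. mellin_kernel s y - ?w (real n) * tri_err y) \<le> (LINT y:?I|lborel. B)"
    using ptw by (intro set_integral_mono si sc) (auto simp: abs_le_iff)
  moreover have "(LINT y:?I|lborel. - B) \<le> (LINT y:?I|lborel. mellin_kernel s y - ?w (real n) * tri_err y)"
    using ptw by (intro set_integral_mono si sc) (auto simp: abs_le_iff intro: minus_le_iff[THEN iffD1])
  ultimately have "\<bar>LINT y:?I|lborel. mellin_kernel s y - ?w (real n) * tri_err y\<bar> \<le> B"
    using set_lborel_integral_const[of "real n" "real n + 1"] by (auto simp: abs_le_iff)
  moreover have "0 \<le> ?w (real n) / 6" by simp
  ultimately have "\<bar>LINT y:?I|lborel. mellin_kernel s y\<bar> \<le> B + ?w (real n) / 6"
    unfolding eq by linarith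
  also have "\<dots> \<le> 7 * real n powr (-2)"
  proof -
    have "?w (real n) - ?w (real n + 1) \<le> (s + 1) * real n powr (- s - 2)"
    proof -
      have e: "- (s + 1) = - s - 1" "- s - 1 - 1 = - s - 2" by simp_all
      show ?thesis using powr_decrement_le[of "real n" "s + 1"] s n unfolding e by simp
    qed
    also have "\<dots> \<le> 3 * real n powr (-3)"
      using s n by (intro mult_mono powr_mono) auto
    finally have "B \<le> 2 * real n * (3 * real n powr (-3))"
      unfolding B_def using n by (intro mult_left_mono) auto
    also have "\<dots> = 6 * (real n powr 1 * real n powr (-3))" using n by simp
    also have "\<dots> = 6 * real n powr (-2)" by (subst powr_add[symmetric]) simp
    finally have "B \<le> 6 * real n powr (-2)" .
    moreover have "?w (real n) \<le> real n powr (-2)" using s n by (intro powr_mono) auto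
    moreover have "real n powr (-2) \<ge> 0" by simp
    ultimately show ?thesis by linarith
  qed
  finally show ?thesis .
qed

definition mellin_kernel_bound :: real where
  "mellin_kernel_bound = 1 + (\<Sum>n. 7 * real (Suc n) powr (-2))"

text \<open>Absolute integrability for each s > 1 permits cutting at the integers, but uniformity as
  s tends to 1 comes from adding the absolute values of the signed integrals over the pieces. On [0,
  1) the integral is 1 / (2 (2 - s)) in size, at most 1 for s <= 3/2.\<close>

lemma mellin_kernel_integral_bound:
  assumes s: "1 < s" "s \<le> 3 / 2"
  shows "\<bar>integral\<^sup>L lborel (mellin_kernel s)\<bar> \<le> mellin_kernel_bound"
proof -
  have s2: "s < 2" using s by simp
  let ?A = "\<lambda>n::nat. {real n..<real n + 1}"
  let ?J = "\<lambda>n. LINT y:?A n|lborel. mellin_kernel s y"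
  have un: "(\<Union>n. ?A n) = {0..}"
  proof (intro equalityI subsetI)
    fix y :: real assume "y \<in> {0..}"
    then have "y \<in> ?A (nat \<lfloor>y\<rfloor>)" by (simp add: of_nat_nat)
    then show "y \<in> (\<Union>n. ?A n)" by blast
  qed auto
  have disj: "?A i \<inter> ?A j = {}" if "i \<noteq> j" for i j using that by auto
  have "integral\<^sup>L lborel (mellin_kernel s) = (LINT y:{0..}|lborel. mellin_kernel s y)"
    unfolding set_lebesgue_integral_def
    by (intro Bochner_Integration.integral_cong) (auto simp: mellin_kernel_def indicator_def)
  also have "\<dots> = (\<Sum>n. ?J n)"
    unfolding un[symmetric]
    by (intro lebesgue_integral_countable_add disj set_integrable_mellin_kernel s s2) auto
  finally have eq: "integral\<^sup>L lborel (mellin_kernel s) = (\<Sum>n. ?J n)" .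
  have sm: "summable (\<lambda>n. 7 * real (Suc n) powr (-2))"
    by (intro summable_mult) (subst summable_Suc_iff, simp add: summable_real_powr_iff)
  have b: "norm (?J (Suc n)) \<le> 7 * real (Suc n) powr (-2)" for n
    using mellin_kernel_interval_bound[OF s(1) s2, of "Suc n"] by simp
  have sJ: "summable (\<lambda>n. ?J (Suc n))" by (rule summable_comparison_test'[OF sm, of 0]) (rule b)
  then have sJ': "summable ?J" using summable_Suc_iff[of ?J] by blast
  have "\<bar>?J 0\<bar> \<le> (LINT y:{0..1}|lborel. (1 / 2) * y powr (1 - s))"
  proof -
    have ki: "set_integrable lborel (?A 0) (mellin_kernel s)"
      by (intro set_integrable_mellin_kernel s s2) auto
    have "\<bar>?J 0\<bar> \<le> (LINT y|lborel. norm (indicator (?A 0) y *\<^sub>R mellin_kernel s y))"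
      unfolding set_lebesgue_integral_def using integral_norm_bound by fastforce
    also have "\<dots> \<le> (LINT y|lborel. indicator {0..1} y *\<^sub>R ((1 / 2) * y powr (1 - s)))"
    proof (rule integral_mono)
      show "integrable lborel (\<lambda>y. norm (indicator (?A 0) y *\<^sub>R mellin_kernel s y))"
        using ki unfolding set_integrable_def by simp
      show "integrable lborel (\<lambda>y::real. indicator {0..1} y *\<^sub>R ((1 / 2) * y powr (1 - s)))"
        using set_integrable_mult_right[of "1/2" lborel "{0..1::real}" "\<lambda>y. y powr (1 - s)"]
          set_integrable_powr_from_0(1)[of "1 - s"] s
        by (simp add: set_integrable_def)
      fix y :: real
      have "y powr 2 * y powr (- s - 1) = y powr (1 - s)" by (subst powr_add[symmetric]) simp
      then have *: "\<bar>tri_err y\<bar> * y powr (- s - 1) = (1 / 2) * y powr (1 - s)" if "0 < y" "y < 1"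
      proof -
        have "\<bar>tri_err y\<bar> = y ^ 2 / 2" using tri_err_bounds(3)[of y] that by simp
        moreover have "y ^ 2 * y powr (- s - 1) = y powr (1 - s)"
          using \<open>y powr 2 * y powr (- s - 1) = y powr (1 - s)\<close> that by simp
        ultimately show ?thesis by (simp only: times_divide_eq_left mult_1_left)
      qed
      then show "norm (indicator (?A 0) y *\<^sub>R mellin_kernel s y) \<le> indicator {0..1} y *\<^sub>R ((1 / 2) * y powr (1 - s))"
        by (auto simp: mellin_kernel_def indicator_def abs_mult)
    qed
    finally show ?thesis unfolding set_lebesgue_integral_def .
  qed
  also have "\<dots> = (1 / 2) * (1 / (2 - s))"
    using set_integrable_powr_from_0(2)[of "1 - s"] s by (subst set_integral_mult_right) simp
  also have "\<dots> \<le> 1" using s by (simp add: field_simps)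
  finally have J0: "\<bar>?J 0\<bar> \<le> 1" .
  have "(\<Sum>n. ?J n) = ?J 0 + (\<Sum>n. ?J (Suc n))" using suminf_split_head[OF sJ'] by simp
  moreover have "norm (\<Sum>n. ?J (Suc n)) \<le> (\<Sum>n. 7 * real (Suc n) powr (-2))"
    by (rule norm_suminf_le[OF b sm])
  ultimately show ?thesis unfolding eq mellin_kernel_bound_def using J0 by (simp add: abs_le_iff)
qed

text \<open>Termwise integration of the series for E: the substitution x = d y turns the d-th term
  into g(d) d^-s times \<kappa>(s), and absolute convergence of G(s) justifies the
  interchange.\<close>

lemma sigma_err_mellin:
  assumes r: "r \<ge> 1" and s: "1 < s" "s < 2"
  shows "integrable lborel (\<lambda>x. indicator {0<..} x * (sigma_err r x * x powr (- s - 1)))"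
    "(LINT x|lborel. indicator {0<..} x * (sigma_err r x * x powr (- s - 1)))
       = G_series r s * integral\<^sup>L lborel (mellin_kernel s)"
proof -
  let ?k = "mellin_kernel s"
  \<comment> \<open>The factor d^(-s-1) compensates the one hidden in the kernel at x / d. For d = 0
    everything is 0, since 0 powr anything is 0.\<close>
  define F where "F = (\<lambda>d x. g_coeff r d * real d powr (- s - 1) * ?k (x / real d))"
  have ki: "integrable lborel ?k" by (rule mellin_kernel_integrable[OF s])
  have sc: "integrable lborel (\<lambda>x. f (x / real d))" "(LINT x|lborel. f (x / real d)) = real d * integral\<^sup>L lborel f"
    if "d > 0" "integrable lborel f" for d :: nat and f :: "real \<Rightarrow> real"
  proof -
    show "integrable lborel (\<lambda>x. f (x / real d))"
      using lborel_integrable_real_affine[OF that(2), of "1 / real d" 0] that(1) by simp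
    show "(LINT x|lborel. f (x / real d)) = real d * integral\<^sup>L lborel f"
      using lborel_integral_real_affine[of "real d" "\<lambda>x. f (x / real d)" 0] that(1) by simp
  qed
  have F0: "F 0 = (\<lambda>_. 0)" by (simp add: F_def)
  have Fi: "integrable lborel (F d)" for d
    using sc(1)[OF _ ki, of d] by (cases "d = 0") (simp_all add: F0 F_def)
  have pw: "real d powr (- s - 1) * real d = real d powr (- s)" if "d > 0" for d :: nat
    using that by (simp add: powr_diff)
  have Fint: "integral\<^sup>L lborel (F d) = g_coeff r d * real d powr (- s) * integral\<^sup>L lborel ?k" for d
  proof (cases "d = 0")
    case False
    have "integral\<^sup>L lborel (F d) = g_coeff r d * real d powr (- s - 1) * (real d * integral\<^sup>L lborel ?k)"
      using False sc(2)[OF _ ki, of d] by (simp add: F_def)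
    then show ?thesis using pw[of d] False by simp
  qed (simp add: F0)
  have Fnorm: "(LINT x|lborel. norm (F d x)) = \<bar>g_coeff r d\<bar> * real d powr (- s) * (LINT x|lborel. \<bar>?k x\<bar>)" for d
  proof (cases "d = 0")
    case False
    have "(LINT x|lborel. norm (F d x)) = \<bar>g_coeff r d\<bar> * real d powr (- s - 1) * (LINT x|lborel. \<bar>?k (x / real d)\<bar>)"
      by (simp add: F_def abs_mult)
    also have "\<dots> = \<bar>g_coeff r d\<bar> * real d powr (- s - 1) * (real d * (LINT x|lborel. \<bar>?k x\<bar>))"
      using False ki by (subst sc(2)) auto
    finally show ?thesis using pw[of d] False by simp
  qed (simp add: F0)
  have summ: "summable (\<lambda>d. \<bar>g_coeff r d\<bar> * real d powr (- s))"
    using g_coeff_abs_summable[OF s(1), of r] by (rule summable_on_imp_summable)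
  have Fnsum: "summable (\<lambda>d. LINT x|lborel. norm (F d x))"
    unfolding Fnorm by (intro summable_mult2 summ)
  have val: "F d x = (indicator {0<..} x * x powr (- s - 1)) * (g_coeff r d * tri_err (x / real d))" for d x
  proof (cases "d = 0 \<or> x \<le> 0")
    case True
    then show ?thesis by (auto simp: F_def mellin_kernel_def tri_err_def indicator_def zero_less_divide_iff)
  next
    case False
    then have "real d powr (- s - 1) * (x / real d) powr (- s - 1) = x powr (- s - 1)"
      by (subst powr_mult[symmetric]) simp
    then show ?thesis using False by (simp add: F_def mellin_kernel_def)
  qed
  have hs: "(\<lambda>d. F d x) sums (indicator {0<..} x * (sigma_err r x * x powr (- s - 1)))" for x
  proof (cases "x > 0")
    case True
    have "((\<lambda>d. F d x) has_sum (indicator {0<..} x * x powr (- s - 1)) * sigma_err r x) UNIV"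
      unfolding val using True by (intro has_sum_cmult_right sigma_err_has_sum r) simp
    from has_sum_imp_sums[OF this] show ?thesis by (simp add: ac_simps)
  qed (simp add: val)
  have Fas: "summable (\<lambda>d. norm (F d x))" for x
  proof (cases "x > 0")
    case True
    have "((\<lambda>d. F d x) has_sum (indicator {0<..} x * x powr (- s - 1)) * sigma_err r x) UNIV"
      unfolding val using True by (intro has_sum_cmult_right sigma_err_has_sum r) simp
    then have "(\<lambda>d. norm (F d x)) summable_on UNIV"
      by (subst summable_on_iff_abs_summable_on_real[symmetric]) (rule has_sum_imp_summable)
    then show ?thesis by (rule summable_on_imp_summable)
  qed (simp add: val)
  have sumF: "(\<lambda>x. \<Sum>d. F d x) = (\<lambda>x. indicator {0<..} x * (sigma_err r x * x powr (- s - 1)))"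
    using hs by (simp add: sums_iff fun_eq_iff)
  show "integrable lborel (\<lambda>x. indicator {0<..} x * (sigma_err r x * x powr (- s - 1)))"
    unfolding sumF[symmetric] by (intro integrable_suminf Fi Fnsum AE_I2 Fas)
  have "(LINT x|lborel. (\<Sum>d. F d x)) = (\<Sum>d. integral\<^sup>L lborel (F d))"
    by (intro integral_suminf Fi Fnsum AE_I2 Fas)
  also have "\<dots> = (\<Sum>d. g_coeff r d * real d powr (- s)) * integral\<^sup>L lborel ?k"
    unfolding Fint using summ
    by - (rule suminf_mult2[symmetric], rule summable_norm_cancel, simp add: abs_mult)
  also have "(\<Sum>d. g_coeff r d * real d powr (- s)) = G_series r s"
    unfolding G_series_def using has_sum_imp_sums[OF has_sum_infsum[OF g_coeff_summable[OF s(1), of r]]]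
    by (simp add: sums_iff)
  finally show "(LINT x|lborel. indicator {0<..} x * (sigma_err r x * x powr (- s - 1)))
       = G_series r s * integral\<^sup>L lborel (mellin_kernel s)" unfolding sumF .
qed

lemma sigma_err_mellin_bound:
  assumes r: "r \<ge> 1" and s: "1 < s" "s \<le> 3 / 2"
  shows "\<bar>LINT x|lborel. indicator {0<..} x * (sigma_err r x * x powr (- s - 1))\<bar>
      \<le> 2 * mellin_kernel_bound / (s - 1)"
proof -
  have s2: "s < 2" using s by simp
  have "\<bar>LINT x|lborel. indicator {0<..} x * (sigma_err r x * x powr (- s - 1))\<bar>
      = G_series r s * \<bar>integral\<^sup>L lborel (mellin_kernel s)\<bar>"
    using sigma_err_mellin(2)[OF r s(1) s2] G_series_bounds(1)[OF s(1)] by (simp add: abs_mult)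
  also have "\<dots> \<le> (1 + 1 / (s - 1)) * mellin_kernel_bound"
    using G_series_bounds[OF s(1), of r] mellin_kernel_integral_bound[OF s]
    by (intro mult_mono) auto
  also have "\<dots> \<le> (2 / (s - 1)) * mellin_kernel_bound"
  proof (intro mult_right_mono)
    have "1 \<le> 1 / (s - 1)" using s by (simp add: field_simps)
    moreover have "2 / (s - 1) = 1 / (s - 1) + 1 / (s - 1)" by simp
    ultimately show "1 + 1 / (s - 1) \<le> 2 / (s - 1)" by linarith
  qed (use mellin_kernel_integral_bound[OF s] in linarith)
  finally show ?thesis by simp
qed

section \<open>Symmetry of the divisor sums around multiples of Q\<close>

text \<open>Hence the divisibility of Q m + i by d depends on m only modulo d / gcd(d, Q).\<close>

lemma dvd_gcd_cancel:
  fixes d q z :: int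
  assumes "d > 0"
  shows "d dvd q * z \<longleftrightarrow> d div gcd d q dvd z"
proof -
  define h where "h = gcd d q"
  have h: "h > 0" using assms by (simp add: h_def)
  obtain d' q' where dq: "d = h * d'" "q = h * q'" unfolding h_def by (meson dvdE gcd_dvd1 gcd_dvd2)
  have "coprime d' q'" using dq h assms unfolding h_def
    by (metis div_gcd_coprime mult_zero_left nonzero_mult_div_cancel_left order_less_irrefl)
  then have "d' dvd q' * z \<longleftrightarrow> d' dvd z" by (simp add: coprime_dvd_mult_right_iff)
  then show ?thesis unfolding h_def[symmetric] using dq h by (simp add: mult.assoc)
qed

text \<open>If nonempty, both sets are residue classes modulo \<open>d' = d / gcd(d, Q)\<close> in an interval. A translation by less than
  \<open>d'\<close> sends every element of the first, except the largest, to an element of the second.\<close>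

lemma card_progression_reflect_le:
  fixes d Q :: nat and i :: int
  assumes d: "d > 0"
  shows "card {m\<in>{L..<U}. int d dvd int Q * int m + i} \<le> card {m\<in>{L..<U}. int d dvd int Q * int m - i} + 1"
    (is "card ?S \<le> card ?T + 1")
proof (cases "?S = {}")
  case False
  define d' where "d' = int d div gcd (int d) (int Q)"
  have dvd_iff: "int d dvd int Q * z \<longleftrightarrow> d' dvd z" for z
    unfolding d'_def using d by (intro dvd_gcd_cancel) simp
  have d'0: "d' > 0"
    using d unfolding d'_def by (simp add: pos_imp_zdiv_pos_iff zdvd_imp_le)
  have fin: "finite ?S" by simp
  define c where "c = Max ?S"
  have c: "c \<in> ?S" "\<And>m. m \<in> ?S \<Longrightarrow> m \<le> c"
    using Max_in[OF fin False] Max_ge[OF fin] by (auto simp: c_def)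
  \<comment> \<open>All m in the first set are congruent to c modulo d', so \<open>m + u\<close> is
    congruent to -c; as Q c is congruent to -i modulo d, Q (m + u) is congruent to i. Moreover m <=
    c - d' and u < d' keep \<open>m + u\<close> inside the interval.\<close>
  define u where "u = nat ((- 2 * int c) mod d')"
  have u: "int u = (- 2 * int c) mod d'" using d'0 by (simp add: u_def)
  have ult: "int u < d'" unfolding u using d'0 by simp
  have "(\<lambda>m. m + u) ` (?S - {c}) \<subseteq> ?T"
  proof (rule image_subsetI)
    fix m assume "m \<in> ?S - {c}"
    then have m: "m \<in> {L..<U}" "int d dvd int Q * int m + i" "m \<notin> {c}" by auto
    then have mS: "m \<in> ?S" by simp
    then have mc: "m < c" using c(2)[OF mS] m(3) by simp
    have "int d dvd (int Q * int c + i) - (int Q * int m + i)" using c(1) m(2) by (intro dvd_diff) auto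
    then have dm: "d' dvd int c - int m" by (simp add: dvd_iff[symmetric] right_diff_distrib)
    then have "d' \<le> int c - int m" using mc by (intro zdvd_imp_le) auto
    then have "m + u < c" using ult by linarith
    then have range: "m + u \<in> {L..<U}" using m(1) c(1) by auto
    have "d' dvd int u + 2 * int c" unfolding u by (simp add: dvd_eq_mod_eq_0 mod_simps)
    then have "d' dvd (int u + 2 * int c) - (int c - int m)" using dm by (rule dvd_diff)
    then have "d' dvd int (m + u) + int c" by (simp add: algebra_simps)
    then have "int d dvd int Q * (int (m + u) + int c)" by (simp only: dvd_iff)
    then have "int d dvd int Q * (int (m + u) + int c) - (int Q * int c + i)" using c(1) by (intro dvd_diff) auto
    then have "int d dvd int Q * int (m + u) - i" by (simp add: algebra_simps)
    then show "m + u \<in> ?T" using range by simp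
  qed
  then have "card ((\<lambda>m. m + u) ` (?S - {c})) \<le> card ?T" by (intro card_mono) auto
  then have "card (?S - {c}) \<le> card ?T" by (subst (asm) card_image) auto
  then show ?thesis using c(1) fin by simp
next
  case True
  then show ?thesis by (simp only: card.empty)
qed

text \<open>The one-sided comparison for i and for -i. The hypothesis \<open>i \<le> Q * m\<close>
  keeps the subtraction of natural numbers from truncating.\<close>

lemma card_progression_reflect:
  fixes d Q i :: nat
  assumes d: "d > 0" and i: "\<And>m. m \<in> {L..<U} \<Longrightarrow> i \<le> Q * m"
  shows "\<bar>real (card {m\<in>{L..<U}. d dvd Q * m + i}) - real (card {m\<in>{L..<U}. d dvd Q * m - i})\<bar> \<le> 1"
proof -
  have "{m\<in>{L..<U}. d dvd Q * m + i} = {m\<in>{L..<U}. int d dvd int Q * int m + int i}"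
  proof -
    have "d dvd Q * m + i \<longleftrightarrow> int d dvd int Q * int m + int i" for m
      using of_nat_dvd_iff[of d "Q * m + i", where ?'a = int] by (simp only: of_nat_add of_nat_mult)
    then show ?thesis by blast
  qed
  moreover have "{m\<in>{L..<U}. d dvd Q * m - i} = {m\<in>{L..<U}. int d dvd int Q * int m - int i}"
  proof -
    have "d dvd Q * m - i \<longleftrightarrow> int d dvd int Q * int m - int i" if "m \<in> {L..<U}" for m
      using of_nat_dvd_iff[of d "Q * m - i", where ?'a = int] i[OF that] by (simp add: of_nat_diff)
    then show ?thesis by blast
  qed
  ultimately show ?thesis
    using card_progression_reflect_le[OF d, of L U Q "int i"] card_progression_reflect_le[OF d, of L U Q "- int i"]
    by simp
qed

section \<open>Averages of \<sigma> over pairs Qm + i, Qm - i\<close>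

definition g_weight :: "nat \<Rightarrow> nat \<Rightarrow> real" where
  "g_weight r X = (\<Sum>d = 1..X. \<bar>g_coeff r d\<bar> / real d)"

lemma g_weight_nonneg: "g_weight r X \<ge> 0"
  unfolding g_weight_def by (intro sum_nonneg) auto

definition g_weight_const :: "nat \<Rightarrow> real" where
  "g_weight_const r = (\<Sum>\<^sub>\<infinity>d. \<bar>g_coeff r d\<bar> * real d powr (- (3 / 2)))"

lemma g_weight_const_nonneg: "g_weight_const r \<ge> 0"
  unfolding g_weight_const_def by (intro infsum_nonneg) auto

text \<open>Rankin's trick: 1/d <= d^(-3/2) sqrt X for d <= X, and the series of |g| converges at
  3/2.\<close>

lemma g_weight_le: "g_weight r X \<le> g_weight_const r * sqrt (real X)"
proof -
  have "g_weight r X \<le> (\<Sum>d = 1..X. \<bar>g_coeff r d\<bar> * real d powr (- (3 / 2)) * sqrt (real X))"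
    unfolding g_weight_def
  proof (intro sum_mono)
    fix d assume d: "d \<in> {1..X}"
    have "real d powr (- (3 / 2)) * real d powr (1 / 2) = real d powr (- (3 / 2) + 1 / 2)"
      by (rule powr_add[symmetric])
    then have "1 / real d = real d powr (- (3 / 2)) * real d powr (1 / 2)"
      using d powr_neg_one[of "real d"] by simp
    also have "\<dots> \<le> real d powr (- (3 / 2)) * sqrt (real X)"
      using d by (intro mult_left_mono) (auto simp: powr_half_sqrt)
    finally have "\<bar>g_coeff r d\<bar> * (1 / real d) \<le> \<bar>g_coeff r d\<bar> * (real d powr (- (3 / 2)) * sqrt (real X))"
      by (rule mult_left_mono) simp
    then show "\<bar>g_coeff r d\<bar> / real d \<le> \<bar>g_coeff r d\<bar> * real d powr (- (3 / 2)) * sqrt (real X)" by simp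
  qed
  also have "\<dots> = (\<Sum>d = 1..X. \<bar>g_coeff r d\<bar> * real d powr (- (3 / 2))) * sqrt (real X)"
    by (simp add: sum_distrib_right)
  also have "\<dots> \<le> g_weight_const r * sqrt (real X)"
    unfolding g_weight_const_def using g_coeff_abs_summable[of "3 / 2" r]
    by (intro mult_right_mono finite_sum_le_infsum) auto
  finally show ?thesis .
qed

text \<open>For n > 0 this is \<sigma>(n) / n. Its divisor sum has weights independent of n, so that
  averages over n become counts of multiples.\<close>

definition sigma_ratio :: "nat \<Rightarrow> nat \<Rightarrow> real" where
  "sigma_ratio r n = (\<Sum>d | d dvd n. g_coeff r d / real d)"

lemma sigma_ord_ratio:
  assumes "r \<ge> 1" "n > 0"
  shows "real (sigma_ord r n) = real n * sigma_ratio r n"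
  unfolding sigma_ord_divisor_sum[OF assms] sigma_ratio_def sum_distrib_left
  by (intro sum.cong) (auto simp: real_of_nat_div)

lemma sigma_ratio_abs_le:
  assumes "n > 0" "n \<le> X"
  shows "\<bar>sigma_ratio r n\<bar> \<le> g_weight r X"
proof -
  have "\<bar>sigma_ratio r n\<bar> \<le> (\<Sum>d | d dvd n. \<bar>g_coeff r d\<bar> / real d)"
    unfolding sigma_ratio_def by (rule order_trans[OF sum_abs]) simp
  also have "\<dots> \<le> g_weight r X"
    unfolding g_weight_def
  proof (rule sum_mono2)
    show "{d. d dvd n} \<subseteq> {1..X}"
    proof
      fix d assume "d \<in> {d. d dvd n}"
      then have "d \<le> n" "0 < d" using assms by (auto intro: dvd_imp_le dvd_pos_nat)
      then show "d \<in> {1..X}" using assms by simp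
    qed
  qed auto
  finally show ?thesis .
qed

lemma sigma_ratio_sum:
  assumes "\<And>m. m \<in> I \<Longrightarrow> 0 < f m \<and> f m \<le> X" "finite I"
  shows "(\<Sum>m\<in>I. sigma_ratio r (f m)) = (\<Sum>d = 1..X. g_coeff r d / real d * real (card {m\<in>I. d dvd f m}))"
proof -
  have "sigma_ratio r (f m) = (\<Sum>d = 1..X. if d dvd f m then g_coeff r d / real d else 0)" if "m \<in> I" for m
  proof -
    have "{d. d dvd f m} \<subseteq> {1..X}"
    proof
      fix d assume "d \<in> {d. d dvd f m}"
      then have "d \<le> f m" "0 < d" using assms(1)[OF that] by (auto intro: dvd_imp_le dvd_pos_nat)
      then show "d \<in> {1..X}" using assms(1)[OF that] by simp
    qed
    then have "{d. d dvd f m} = {d\<in>{1..X}. d dvd f m}" by blast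
    then show ?thesis unfolding sigma_ratio_def by (simp only: sum.inter_filter finite_atLeastAtMost)
  qed
  then have "(\<Sum>m\<in>I. sigma_ratio r (f m)) = (\<Sum>m\<in>I. \<Sum>d = 1..X. if d dvd f m then g_coeff r d / real d else 0)"
    by simp
  also have "\<dots> = (\<Sum>d = 1..X. \<Sum>m\<in>I. if d dvd f m then g_coeff r d / real d else 0)"
    by (rule sum.swap)
  also have "\<dots> = (\<Sum>d = 1..X. g_coeff r d / real d * real (card {m\<in>I. d dvd f m}))"
    using assms(2) by (intro sum.cong refl) (simp add: sum.inter_filter[symmetric])
  finally show ?thesis .
qed

text \<open>For each d, the numbers of m with d dividing Qm + i and with d dividing Qm - i differ by
  at most 1, so d contributes at most |g(d)| / d.\<close>

lemma sigma_ratio_pairing: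
  assumes i: "i < Q" and L: "L \<ge> 1"
  shows "\<bar>\<Sum>m\<in>{L..<U}. sigma_ratio r (Q * m + i) - sigma_ratio r (Q * m - i)\<bar> \<le> g_weight r (Q * U)"
proof -
  let ?P = "\<lambda>d. {m\<in>{L..<U}. d dvd Q * m + i}"
  let ?N = "\<lambda>d. {m\<in>{L..<U}. d dvd Q * m - i}"
  have b: "i < Q * m" "Q * m + i \<le> Q * U" if "m \<in> {L..<U}" for m
  proof -
    have "Q * 1 \<le> Q * m" using that L by (intro mult_left_mono) auto
    then show "i < Q * m" using i by linarith
    have "Q * (m + 1) \<le> Q * U" using that by (intro mult_left_mono) auto
    then show "Q * m + i \<le> Q * U" using i by simp
  qed
  have cp: "\<bar>real (card (?P d)) - real (card (?N d))\<bar> \<le> 1" if "d > 0" for d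
  proof (rule card_progression_reflect)
    show "d > 0" by fact
    fix m assume "m \<in> {L..<U}"
    from b(1)[OF this] show "i \<le> Q * m" by (rule less_imp_le)
  qed
  have "(\<Sum>m\<in>{L..<U}. sigma_ratio r (Q * m + i) - sigma_ratio r (Q * m - i))
      = (\<Sum>d = 1..Q * U. g_coeff r d / real d * real (card (?P d))) - (\<Sum>d = 1..Q * U. g_coeff r d / real d * real (card (?N d)))"
  proof -
    have p: "0 < Q * m + i \<and> Q * m + i \<le> Q * U" "0 < Q * m - i \<and> Q * m - i \<le> Q * U" if "m \<in> {L..<U}" for m
      using b[OF that] by auto
    show ?thesis
      unfolding sum_subtractf
    proof (rule arg_cong2[of _ _ _ _ "(-)"])
      show "(\<Sum>m\<in>{L..<U}. sigma_ratio r (Q * m + i)) = (\<Sum>d = 1..Q * U. g_coeff r d / real d * real (card (?P d)))"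
        by (rule sigma_ratio_sum[where f = "\<lambda>m. Q * m + i"], rule p(1)) simp_all
      show "(\<Sum>m\<in>{L..<U}. sigma_ratio r (Q * m - i)) = (\<Sum>d = 1..Q * U. g_coeff r d / real d * real (card (?N d)))"
        by (rule sigma_ratio_sum[where f = "\<lambda>m. Q * m - i"], rule p(2)) simp_all
    qed
  qed
  also have "\<dots> = (\<Sum>d = 1..Q * U. g_coeff r d / real d * (real (card (?P d)) - real (card (?N d))))"
    by (simp only: sum_subtractf right_diff_distrib)
  finally have eq: "(\<Sum>m\<in>{L..<U}. sigma_ratio r (Q * m + i) - sigma_ratio r (Q * m - i))
      = (\<Sum>d = 1..Q * U. g_coeff r d / real d * (real (card (?P d)) - real (card (?N d))))" .
  have "\<bar>\<Sum>m\<in>{L..<U}. sigma_ratio r (Q * m + i) - sigma_ratio r (Q * m - i)\<bar>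
      \<le> (\<Sum>d = 1..Q * U. \<bar>g_coeff r d / real d * (real (card (?P d)) - real (card (?N d)))\<bar>)"
    unfolding eq by (rule sum_abs)
  also have "\<dots> \<le> g_weight r (Q * U)"
    unfolding g_weight_def
  proof (intro sum_mono)
    fix d assume "d \<in> {1..Q * U}"
    then have "d > 0" by simp
    then have "\<bar>real (card (?P d)) - real (card (?N d))\<bar> \<le> 1"
      by (rule cp)
    then have "\<bar>g_coeff r d / real d\<bar> * \<bar>real (card (?P d)) - real (card (?N d))\<bar> \<le> \<bar>g_coeff r d / real d\<bar> * 1"
      by (intro mult_left_mono) auto
    then show "\<bar>g_coeff r d / real d * (real (card (?P d)) - real (card (?N d)))\<bar> \<le> \<bar>g_coeff r d\<bar> / real d"
      by (simp only: abs_mult abs_divide abs_of_nat mult_1_right)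
  qed
  finally show ?thesis .
qed

text \<open>Partial summation: the weight m counts the t < m, and each t contributes a sum over an
  upper part of the interval. This is why the pairing bound is wanted for every lower end L.\<close>

lemma weighted_sum_tail_bound:
  fixes \<Delta> :: "nat \<Rightarrow> real"
  assumes "\<And>L. L \<ge> 1 \<Longrightarrow> \<bar>\<Sum>m\<in>{L..<U}. \<Delta> m\<bar> \<le> W" "W \<ge> 0" "A \<ge> 1"
  shows "\<bar>\<Sum>m\<in>{A..<U}. real m * \<Delta> m\<bar> \<le> real U * W"
proof -
  have "(\<Sum>m\<in>{A..<U}. real m * \<Delta> m) = (\<Sum>m\<in>{A..<U}. \<Sum>t<U. if t < m then \<Delta> m else 0)"
  proof (intro sum.cong refl)
    fix m assume "m \<in> {A..<U}"
    then have "{t\<in>{..<U}. t < m} = {..<m}" by auto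
    then show "real m * \<Delta> m = (\<Sum>t<U. if t < m then \<Delta> m else 0)"
      by (simp add: sum.inter_filter[symmetric])
  qed
  also have "\<dots> = (\<Sum>t<U. \<Sum>m\<in>{A..<U}. if t < m then \<Delta> m else 0)" by (rule sum.swap)
  finally have eq: "(\<Sum>m\<in>{A..<U}. real m * \<Delta> m) = (\<Sum>t<U. \<Sum>m\<in>{A..<U}. if t < m then \<Delta> m else 0)" .
  have "\<bar>\<Sum>m\<in>{A..<U}. real m * \<Delta> m\<bar> \<le> (\<Sum>t<U. \<bar>\<Sum>m\<in>{A..<U}. if t < m then \<Delta> m else 0\<bar>)"
    unfolding eq by (rule sum_abs)
  also have "\<dots> \<le> (\<Sum>t<U. W)"
  proof (intro sum_mono)
    fix t
    have "{m\<in>{A..<U}. t < m} = {max A (t + 1)..<U}" by auto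
    then have "(\<Sum>m\<in>{A..<U}. if t < m then \<Delta> m else 0) = (\<Sum>m\<in>{max A (t + 1)..<U}. \<Delta> m)"
      by (simp add: sum.inter_filter[symmetric])
    then show "\<bar>\<Sum>m\<in>{A..<U}. if t < m then \<Delta> m else 0\<bar> \<le> W" using assms(1)[of "max A (t + 1)"] assms(3) by simp
  qed
  finally show ?thesis by simp
qed

text \<open>In \<sigma>(Qm + i) and \<sigma>(Qm - i) the factor Qm is removed by partial summation,
  while the factors i and -i, below Q in size, are estimated trivially. The 10 is 5 from 4M + 1 <=
  5M, times 2 from sqrt(4QM).\<close>

lemma sigma_ord_pairing:
  assumes r: "r \<ge> 1" and i: "i < Q" and M: "M \<ge> 1"
  shows "\<bar>\<Sum>m\<in>{M<..2 * M}. real (sigma_ord r (Q * m + i)) - real (sigma_ord r (Q * m - i))\<bar>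
      \<le> 10 * g_weight_const r * (real Q * real M) powr (3 / 2)"
proof -
  define W where "W = g_weight r (Q * (2 * M + 1))"
  have W0: "W \<ge> 0" by (simp add: W_def g_weight_nonneg)
  have I: "{M<..2 * M} = {M + 1..<2 * M + 1}" by auto
  define A where "A = sigma_ratio r"
  have b: "i < Q * m" "Q * m + i \<le> Q * (2 * M + 1)" if "m \<in> {M<..2 * M}" for m
  proof -
    have "Q * 1 \<le> Q * m" using that by (intro mult_left_mono) auto
    then show "i < Q * m" using i by linarith
    have "Q * (m + 1) \<le> Q * (2 * M + 1)" using that by (intro mult_left_mono) auto
    moreover have "Q * (m + 1) = Q * m + Q" by simp
    ultimately show "Q * m + i \<le> Q * (2 * M + 1)" using i by linarith
  qed
  have "real (sigma_ord r (Q * m + i)) - real (sigma_ord r (Q * m - i))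
      = real Q * (real m * (A (Q * m + i) - A (Q * m - i))) + real i * (A (Q * m + i) + A (Q * m - i))"
    if "m \<in> {M<..2 * M}" for m
  proof -
    have "real (sigma_ord r (Q * m + i)) = (real Q * real m + real i) * A (Q * m + i)"
    proof -
      have "Q * m + i > 0" using b(1)[OF that] by linarith
      from sigma_ord_ratio[OF r this] show ?thesis by (simp add: A_def)
    qed
    moreover have "real (sigma_ord r (Q * m - i)) = (real Q * real m - real i) * A (Q * m - i)"
    proof -
      have "Q * m - i > 0" using b(1)[OF that] by linarith
      from sigma_ord_ratio[OF r this] show ?thesis using b(1)[OF that] by (simp add: A_def of_nat_diff)
    qed
    ultimately show ?thesis by (simp only:) (simp add: algebra_simps)
  qed
  then have "(\<Sum>m\<in>{M<..2 * M}. real (sigma_ord r (Q * m + i)) - real (sigma_ord r (Q * m - i)))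
      = (\<Sum>m\<in>{M<..2 * M}. real Q * (real m * (A (Q * m + i) - A (Q * m - i))) + real i * (A (Q * m + i) + A (Q * m - i)))"
    by (intro sum.cong refl)
  also have "\<dots> = real Q * (\<Sum>m\<in>{M<..2 * M}. real m * (A (Q * m + i) - A (Q * m - i)))
        + real i * (\<Sum>m\<in>{M<..2 * M}. A (Q * m + i) + A (Q * m - i))"
    unfolding sum_distrib_left by (rule sum.distrib)
  finally have eq: "(\<Sum>m\<in>{M<..2 * M}. real (sigma_ord r (Q * m + i)) - real (sigma_ord r (Q * m - i)))
      = real Q * (\<Sum>m\<in>{M<..2 * M}. real m * (A (Q * m + i) - A (Q * m - i)))
        + real i * (\<Sum>m\<in>{M<..2 * M}. A (Q * m + i) + A (Q * m - i))" .
  have "\<bar>\<Sum>m\<in>{M<..2 * M}. real (sigma_ord r (Q * m + i)) - real (sigma_ord r (Q * m - i))\<bar>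
      \<le> real Q * (real (2 * M + 1) * W) + real Q * (2 * real M * W)"
    unfolding eq
  proof (intro order_trans[OF abs_triangle_ineq] add_mono)
    have "\<bar>\<Sum>m\<in>{M + 1..<2 * M + 1}. real m * (A (Q * m + i) - A (Q * m - i))\<bar> \<le> real (2 * M + 1) * W"
      unfolding A_def W_def by (intro weighted_sum_tail_bound sigma_ratio_pairing i g_weight_nonneg) auto
    then show "\<bar>real Q * (\<Sum>m\<in>{M<..2 * M}. real m * (A (Q * m + i) - A (Q * m - i)))\<bar> \<le> real Q * (real (2 * M + 1) * W)"
      unfolding I by (simp only: abs_mult abs_of_nat) (intro mult_left_mono; simp)
    have "\<bar>\<Sum>m\<in>{M<..2 * M}. A (Q * m + i) + A (Q * m - i)\<bar> \<le> (\<Sum>m\<in>{M<..2 * M}. \<bar>A (Q * m + i) + A (Q * m - i)\<bar>)"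
      by (rule sum_abs)
    also have "\<dots> \<le> (\<Sum>m\<in>{M<..2 * M}. 2 * W)"
    proof (intro sum_mono)
      fix m assume m: "m \<in> {M<..2 * M}"
      have "\<bar>A (Q * m + i)\<bar> \<le> W" "\<bar>A (Q * m - i)\<bar> \<le> W"
        unfolding A_def W_def using b[OF m] by (intro sigma_ratio_abs_le; linarith)+
      then show "\<bar>A (Q * m + i) + A (Q * m - i)\<bar> \<le> 2 * W" by linarith
    qed
    also have "\<dots> = 2 * real M * W" by simp
    finally have "\<bar>\<Sum>m\<in>{M<..2 * M}. A (Q * m + i) + A (Q * m - i)\<bar> \<le> 2 * real M * W" .
    then show "\<bar>real i * (\<Sum>m\<in>{M<..2 * M}. A (Q * m + i) + A (Q * m - i))\<bar> \<le> real Q * (2 * real M * W)"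
      using i unfolding abs_mult by (intro mult_mono) auto
  qed
  also have "\<dots> = real Q * (4 * real M + 1) * W" by (simp add: algebra_simps)
  also have "\<dots> \<le> real Q * (5 * real M) * (2 * g_weight_const r * sqrt (real Q * real M))"
  proof (intro mult_mono)
    have "W \<le> g_weight_const r * sqrt (real (Q * (2 * M + 1)))" unfolding W_def by (rule g_weight_le)
    also have "\<dots> \<le> g_weight_const r * sqrt (4 * (real Q * real M))"
    proof (intro mult_left_mono g_weight_const_nonneg real_sqrt_le_mono)
      have "Q * (2 * M + 1) \<le> Q * (4 * M)" using M by (intro mult_left_mono) auto
      then have "real (Q * (2 * M + 1)) \<le> real (Q * (4 * M))" by (simp only: of_nat_le_iff)
      then show "real (Q * (2 * M + 1)) \<le> 4 * (real Q * real M)" by simp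
    qed
    also have "\<dots> = 2 * g_weight_const r * sqrt (real Q * real M)" by (simp add: real_sqrt_mult)
    finally show "W \<le> 2 * g_weight_const r * sqrt (real Q * real M)" .
  qed (use M W0 in auto)
  also have "\<dots> = 10 * g_weight_const r * ((real Q * real M) * sqrt (real Q * real M))" by simp
  also have "(real Q * real M) * sqrt (real Q * real M) = (real Q * real M) powr 1 * (real Q * real M) powr (1 / 2)"
    by (simp add: powr_half_sqrt)
  also have "\<dots> = (real Q * real M) powr (3 / 2)" by (subst powr_add[symmetric]) simp
  finally show ?thesis .
qed

section \<open>Large values at multiples of Q\<close>

definition primes_upto :: "nat \<Rightarrow> nat set" where
  "primes_upto y = {p. prime p \<and> p \<le> y}"

lemma finite_primes_upto [simp]: "finite (primes_upto y)"
  unfolding primes_upto_def by (rule finite_subset[of _ "{..y}"]) auto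

lemma primes_uptoD: "p \<in> primes_upto y \<Longrightarrow> prime p \<and> 2 \<le> p \<and> p \<le> y"
  by (auto simp: primes_upto_def prime_ge_2_nat)

lemma card_primes_upto_le: "card (primes_upto y) \<le> y"
proof -
  have "card (primes_upto y) \<le> card {1..y}"
    by (intro card_mono) (auto dest!: primes_uptoD)
  then show ?thesis by simp
qed

lemma prime_factors_fact_eq: "prime_factors (fact y :: nat) = primes_upto y"
  by (auto simp: primes_upto_def in_prime_factors_iff prime_dvd_fact_iff)

lemma prod_one_minus_inverse_square_ge:
  "y \<ge> 1 \<Longrightarrow> (\<Prod>n = 2..y. 1 - 1 / real n ^ 2) = (real y + 1) / (2 * real y)"
proof (induction y rule: nat_induct_at_least)
  case (Suc y)
  then have "{2..Suc y} = insert (Suc y) {2..y}" by auto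
  then have "(\<Prod>n = 2..Suc y. 1 - 1 / real n ^ 2) = (1 - 1 / real (Suc y) ^ 2) * ((real y + 1) / (2 * real y))"
    using Suc by simp
  also have "\<dots> = (real (Suc y) + 1) / (2 * real (Suc y))"
  proof -
    define x where "x = real (Suc y)"
    have x: "x > 1" "real y = x - 1" using Suc.hyps by (auto simp: x_def)
    have e1: "1 - 1 / x ^ 2 = (x - 1) * (x + 1) / (x * x)"
      using x(1) by (simp add: field_simps power2_eq_square)
    have "(1 - 1 / x ^ 2) * ((x - 1 + 1) / (2 * (x - 1))) = (x + 1) / (2 * x)"
      unfolding e1 using x(1) by (simp add: divide_simps) (simp add: algebra_simps)
    then show ?thesis unfolding x_def[symmetric] x(2) .
  qed
  finally show ?case .
qed simp

text \<open>The harmonic sum up to y is at most the product of 1 / (1 - 1/p) = (1 + 1/p) / (1 -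
  1/p^2) over p <= y. The denominators have product at least 1/2, by the telescoping product over
  all n >= 2.\<close>

lemma prod_primes_ge_ln:
  assumes y: "y \<ge> 1"
  shows "(\<Prod>p\<in>primes_upto y. 1 + 1 / real p) \<ge> ln (real y) / 2"
proof -
  let ?M = "fact y :: nat"
  let ?P = "primes_upto y"
  have pos: "real p \<ge> 2" if "p \<in> ?P" for p using primes_uptoD[OF that] by simp
  have "ln (real y) \<le> harm y"
    using ln_le_harm[of y] y by (intro order_trans[OF _ ln_le_harm]) auto
  also have "\<dots> = (\<Sum>n = 1..y. mult_fun (\<lambda>_ _. 1) n * real n powr (-1))"
    unfolding harm_def by (intro sum.cong) (auto simp: mult_fun_one powr_minus)
  also have "\<dots> \<le> (\<Sum>n | n dvd ?M. mult_fun (\<lambda>_ _. 1) n * real n powr (-1))"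
  proof (rule sum_mono2)
    show "{1..y} \<subseteq> {n. n dvd ?M}" using dvd_fact_subset[of y] by (auto simp: subset_iff)
  qed (auto simp: mult_fun_one)
  also have "\<dots> = (\<Prod>p\<in>?P. \<Sum>i\<le>multiplicity p ?M. 1 * (real p powr (-1)) ^ i)"
    by (subst sum_divisors_mult_fun_powr) (auto simp: prime_factors_fact_eq)
  also have "\<dots> \<le> (\<Prod>p\<in>?P. (1 + 1 / real p) / (1 - 1 / real p ^ 2))"
  proof (intro prod_mono conjI)
    fix p assume p: "p \<in> ?P"
    define x where "x = 1 / real p"
    have x: "0 < x" "x < 1" using pos[OF p] by (auto simp: x_def)
    have "(\<Sum>i\<le>k. x ^ i) * (1 - x) \<le> 1" for k
      using sum_gp_basic[of x k] x by (simp add: mult.commute)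
    then have "(\<Sum>i\<le>k. x ^ i) \<le> 1 / (1 - x)" for k using x by (simp add: pos_le_divide_eq)
    also have "1 / (1 - x) = (1 + x) / (1 - x ^ 2)"
    proof -
      have "1 - x ^ 2 = (1 - x) * (1 + x)" by (simp add: algebra_simps power2_eq_square)
      then show ?thesis using x by simp
    qed
    finally show "(\<Sum>i\<le>multiplicity p ?M. 1 * (real p powr (-1)) ^ i) \<le> (1 + 1 / real p) / (1 - 1 / real p ^ 2)"
      using pos[OF p] by (simp add: x_def powr_minus divide_inverse power_inverse)
  qed (auto intro: sum_nonneg)
  also have "\<dots> = (\<Prod>p\<in>?P. 1 + 1 / real p) / (\<Prod>p\<in>?P. 1 - 1 / real p ^ 2)"
    by (rule prod_dividef)
  also have "\<dots> \<le> (\<Prod>p\<in>?P. 1 + 1 / real p) / (1 / 2)"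
  proof (rule divide_left_mono)
    have "1 / 2 \<le> (\<Prod>n = 2..y. 1 - 1 / real n ^ 2)"
      unfolding prod_one_minus_inverse_square_ge[OF y] using y by (simp add: field_simps)
    also have "\<dots> \<le> (\<Prod>p\<in>?P. 1 - 1 / real p ^ 2)"
    proof -
      have "?P \<subseteq> {2..y}" by (auto dest!: primes_uptoD)
      then have "(\<Prod>n = 2..y. 1 - 1 / real n ^ 2)
          = (\<Prod>n\<in>{2..y} - ?P. 1 - 1 / real n ^ 2) * (\<Prod>p\<in>?P. 1 - 1 / real p ^ 2)"
        by (intro prod.subset_diff) auto
      also have "\<dots> \<le> 1 * (\<Prod>p\<in>?P. 1 - 1 / real p ^ 2)"
      proof (intro mult_right_mono prod_le_1 prod_nonneg ballI conjI)
        have sq: "1 / real n ^ 2 \<le> 1" if "n \<ge> 2" for n :: nat using that by (simp add: field_simps)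
        fix n assume "n \<in> {2..y} - ?P"
        then show "0 \<le> 1 - 1 / real n ^ 2" using sq[of n] by simp
      next
        have sq: "1 / real n ^ 2 \<le> 1" if "n \<ge> 2" for n :: nat using that by (simp add: field_simps)
        fix p assume "p \<in> ?P"
        then have "p \<ge> 2" by (auto dest: primes_uptoD)
        then show "0 \<le> 1 - 1 / real p ^ 2" using sq[of p] by simp
      qed auto
      finally show ?thesis by simp
    qed
    finally show "1 / 2 \<le> (\<Prod>p\<in>?P. 1 - 1 / real p ^ 2)" .
    then show "0 < (\<Prod>p\<in>?P. 1 - 1 / real p ^ 2) * (1 / 2)" by simp
  qed (auto intro: prod_nonneg)
  finally show ?thesis by simp
qed

text \<open>The exponent r + 1 is the most profitable one: \<sigma> has the ratio 1 + 1/p at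
  p^(r+1), but 1 at lower and 1 + p^(r-a) at higher powers p^a.\<close>

definition smooth_modulus :: "nat \<Rightarrow> nat \<Rightarrow> nat" where
  "smooth_modulus r y = (\<Prod>p\<in>primes_upto y. p ^ (r + 1))"

lemma smooth_modulus_pos: "smooth_modulus r y > 0"
  unfolding smooth_modulus_def by (intro prod_pos) (auto dest!: primes_uptoD)

lemma multiplicity_smooth_modulus:
  assumes "p \<in> primes_upto y"
  shows "multiplicity p (smooth_modulus r y) = r + 1"
proof -
  have p: "prime p" using primes_uptoD[OF assms] by simp
  have "multiplicity p (smooth_modulus r y) = (\<Sum>q\<in>primes_upto y. multiplicity p (q ^ (r + 1)))"
    unfolding smooth_modulus_def
    using p by (intro prime_elem_multiplicity_prod_distrib) (auto dest!: primes_uptoD)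
  also have "\<dots> = (\<Sum>q\<in>primes_upto y. if q = p then r + 1 else 0)"
    using p by (intro sum.cong refl)
      (auto dest!: primes_uptoD simp: multiplicity_distinct_prime_power prime_imp_prime_elem simp del: power_Suc)
  finally show ?thesis using assms by simp
qed

text \<open>Primes p <= y not dividing m keep the exponent r + 1 and give 1 + 1/p. All other local
  ratios are estimated below by 1.\<close>

lemma sigma_ord_multiple_ge:
  fixes r y m :: nat
  assumes m: "m > 0"
  defines "n \<equiv> smooth_modulus r y * m"
  shows "real (sigma_ord r n) \<ge> real n * (\<Prod>p | p \<in> primes_upto y \<and> \<not> p dvd m. 1 + 1 / real p)"
proof -
  let ?P = "{p. p \<in> primes_upto y \<and> \<not> p dvd m}"
  have n: "n > 0" using m smooth_modulus_pos by (simp add: n_def)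
  have mult: "multiplicity p n = r + 1" if "p \<in> ?P" for p
  proof -
    have "prime p" using that by (auto dest: primes_uptoD)
    then have "multiplicity p n = multiplicity p (smooth_modulus r y) + multiplicity p m"
      unfolding n_def using m smooth_modulus_pos[of r y]
      by (intro prime_elem_multiplicity_mult_distrib) auto
    then show ?thesis using that multiplicity_smooth_modulus[of p y r] by (simp add: not_dvd_imp_multiplicity_0)
  qed
  have sub: "?P \<subseteq> prime_factors n"
  proof
    fix p assume p: "p \<in> ?P"
    then have "prime p" by (auto dest: primes_uptoD)
    then show "p \<in> prime_factors n" using mult[OF p] by (simp add: prime_factors_multiplicity)
  qed
  have "real n * (\<Prod>p\<in>?P. 1 + 1 / real p)
      = (\<Prod>p\<in>prime_factors n. real p ^ multiplicity p n) * (\<Prod>p\<in>prime_factors n. if p \<in> ?P then 1 + 1 / real p else 1)"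
    using n real_mult_fun[of n] sub by (simp add: mult_fun_def prod.If_cases Int_absorb1)
  also have "\<dots> = (\<Prod>p\<in>prime_factors n. real p ^ multiplicity p n * (if p \<in> ?P then 1 + 1 / real p else 1))"
    by (rule prod.distrib[symmetric])
  also have "\<dots> \<le> (\<Prod>p\<in>prime_factors n. if multiplicity p n \<le> r then real p ^ multiplicity p n
      else real p ^ multiplicity p n + real p ^ r)"
  proof (intro prod_mono conjI)
    fix p assume p: "p \<in> prime_factors n"
    then have p0: "real p > 0" by (simp add: prime_factors_gt_0_nat)
    show "real p ^ multiplicity p n * (if p \<in> ?P then 1 + 1 / real p else 1)
        \<le> (if multiplicity p n \<le> r then real p ^ multiplicity p n else real p ^ multiplicity p n + real p ^ r)"
    proof (cases "p \<in> ?P")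
      case True
      then show ?thesis using mult[OF True] p0 by (simp add: field_simps)
    next
      case False
      show ?thesis unfolding if_not_P[OF False] using p0 by simp
    qed
  qed auto
  also have "\<dots> = real (sigma_ord r n)" using n by (simp add: sigma_ord_mult_fun mult_fun_def)
  finally show ?thesis .
qed

text \<open>Removing the primes that divide m costs the factors 1 - 1/(p+1); the Weierstrass
  inequality replaces their product by a sum, which can be averaged over m.\<close>

lemma prod_primes_not_dvd_ge:
  "(\<Prod>p | p \<in> primes_upto y \<and> \<not> p dvd m. 1 + 1 / real p)
     \<ge> (\<Prod>p\<in>primes_upto y. 1 + 1 / real p) * (1 - (\<Sum>p | p \<in> primes_upto y \<and> p dvd m. 1 / (real p + 1)))"
proof -
  let ?A = "{p. p \<in> primes_upto y \<and> \<not> p dvd m}" and ?B = "{p. p \<in> primes_upto y \<and> p dvd m}"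
  have fin: "finite ?A" "finite ?B" by simp_all
  have P: "primes_upto y = ?A \<union> ?B" by auto
  let ?f = "\<lambda>p. 1 + 1 / real p"
  have split: "prod ?f (primes_upto y) = prod ?f ?A * prod ?f ?B"
    by (rule trans[OF arg_cong[OF P, of "prod ?f"] prod.union_disjoint[OF fin]]) auto
  have cancel: "prod ?f ?B * (\<Prod>p\<in>?B. 1 - 1 / (real p + 1)) = 1"
    unfolding prod.distrib[symmetric]
    by (intro prod.neutral ballI) (auto dest!: primes_uptoD simp: field_simps)
  have "prod ?f (primes_upto y) * (1 - (\<Sum>p\<in>?B. 1 / (real p + 1)))
      \<le> prod ?f (primes_upto y) * (\<Prod>p\<in>?B. 1 - 1 / (real p + 1))"
    by (intro mult_left_mono Weierstrass_prod_ineq prod_nonneg) auto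
  also have "\<dots> = prod ?f ?A"
    unfolding split using cancel by (simp only: mult.assoc mult_1_right)
  finally show ?thesis .
qed

lemma card_multiples_le:
  fixes p :: nat
  assumes "p > 0"
  shows "real (card {m\<in>{M<..2 * M}. p dvd m}) \<le> real M / real p + 1"
proof -
  have "{m\<in>{M<..2 * M}. p dvd m} \<subseteq> (\<lambda>k. p * k) ` {M div p<..2 * M div p}"
  proof
    fix m assume "m \<in> {m\<in>{M<..2 * M}. p dvd m}"
    then have m: "M < m" "m \<le> 2 * M" "p dvd m" by auto
    obtain k where k: "m = p * k" using m(3) by (elim dvdE)
    have "k \<le> 2 * M div p" using m(2) k assms by (simp add: less_eq_div_iff_mult_less_eq mult.commute)
    moreover have "M div p < k" using m(1) k assms by (simp add: div_less_iff_less_mult mult.commute)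
    ultimately show "m \<in> (\<lambda>k. p * k) ` {M div p<..2 * M div p}" using k by auto
  qed
  then have "card {m\<in>{M<..2 * M}. p dvd m} \<le> card {M div p<..2 * M div p}"
    by (intro surj_card_le) auto
  then have "real (card {m\<in>{M<..2 * M}. p dvd m}) \<le> real (2 * M div p) - real (M div p)"
    using div_le_mono[of M "2 * M" p] by (simp only: card_greaterThanAtMost) linarith
  also have "\<dots> \<le> 2 * real M / real p - (real M / real p - 1)"
  proof (intro diff_mono)
    show "real (2 * M div p) \<le> 2 * real M / real p" using of_nat_div_le_of_nat[of "2 * M" p, where ?'a = real] by simp
    show "real M / real p - 1 \<le> real (M div p)"
    proof -
      have "M = p * (M div p) + M mod p" by simp
      then have "real M = real p * real (M div p) + real (M mod p)" by (metis of_nat_add of_nat_mult)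
      moreover have "real (M mod p) < real p" using assms by simp
      ultimately show ?thesis using assms by (simp add: field_simps)
    qed
  qed
  finally show ?thesis by simp
qed

lemma sum_inverse_consecutive_le: "(\<Sum>n = 2..y. 1 / (real n * (real n + 1))) \<le> 1 / 2"
proof -
  have "y \<ge> 1 \<Longrightarrow> (\<Sum>n = 2..y. 1 / (real n * (real n + 1))) = 1 / 2 - 1 / (real y + 1)" for y
  proof (induction y rule: nat_induct_at_least)
    case (Suc y)
    then have "{2..Suc y} = insert (Suc y) {2..y}" by auto
    then have "(\<Sum>n = 2..Suc y. 1 / (real n * (real n + 1))) = 1 / (real (Suc y) * (real (Suc y) + 1)) + (1 / 2 - 1 / (real y + 1))"
      using Suc by simp
    also have "\<dots> = 1 / 2 - 1 / (real (Suc y) + 1)"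
    proof -
      have "1 / (x * (x + 1)) = 1 / x - 1 / (x + 1)" if "x > 0" for x :: real
        using that by (simp add: divide_simps)
      from this[of "real (Suc y)"] show ?thesis by (simp add: add.commute)
    qed
    finally show ?case .
  qed simp
  from this[of y] show ?thesis by (cases "y \<ge> 1") auto
qed

text \<open>The mean loss over m is at most the sum of 1/(p (p+1)) plus y / M, hence at most 1/2 +
  1/4. So a quarter of the full product, itself at least ln y / 2, survives: this is the
  1/8.\<close>

lemma sum_sigma_ord_multiples_ge:
  fixes r y M :: nat
  assumes y: "y \<ge> 1" and M: "M \<ge> 4 * y"
  defines "Q \<equiv> smooth_modulus r y"
  shows "(\<Sum>m\<in>{M<..2 * M}. real (sigma_ord r (Q * m))) \<ge> real Q * real M ^ 2 * ln (real y) / 8"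
proof -
  let ?P = "primes_upto y"
  define B where "B = (\<Prod>p\<in>?P. 1 + 1 / real p)"
  have B: "B \<ge> ln (real y) / 2" unfolding B_def by (rule prod_primes_ge_ln[OF y])
  have B0: "B \<ge> 0" unfolding B_def by (intro prod_nonneg) auto
  define w where "w = (\<lambda>m. \<Sum>p | p \<in> ?P \<and> p dvd m. 1 / (real p + 1))"
  have "(\<Sum>m\<in>{M<..2 * M}. w m) = (\<Sum>m\<in>{M<..2 * M}. \<Sum>p\<in>?P. if p dvd m then 1 / (real p + 1) else 0)"
    unfolding w_def by (simp add: sum.inter_filter[symmetric])
  also have "\<dots> = (\<Sum>p\<in>?P. \<Sum>m\<in>{M<..2 * M}. if p dvd m then 1 / (real p + 1) else 0)" by (rule sum.swap)
  also have "\<dots> = (\<Sum>p\<in>?P. real (card {m\<in>{M<..2 * M}. p dvd m}) * (1 / (real p + 1)))"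
    by (simp add: sum.inter_filter[symmetric])
  also have "\<dots> \<le> (\<Sum>p\<in>?P. (real M / real p + 1) * (1 / (real p + 1)))"
    by (intro sum_mono mult_right_mono card_multiples_le) (auto dest!: primes_uptoD)
  also have "\<dots> \<le> (\<Sum>p\<in>?P. real M * (1 / (real p * (real p + 1))) + 1)"
  proof (intro sum_mono)
    fix p :: nat assume "p \<in> ?P"
    have "(real M / real p + 1) * (1 / (real p + 1)) = real M * (1 / (real p * (real p + 1))) + 1 / (real p + 1)"
      by (subst distrib_right) simp
    moreover have "1 / (real p + 1) \<le> 1" by simp
    ultimately show "(real M / real p + 1) * (1 / (real p + 1)) \<le> real M * (1 / (real p * (real p + 1))) + 1" by linarith
  qed
  also have "\<dots> = real M * (\<Sum>p\<in>?P. 1 / (real p * (real p + 1))) + real (card ?P)"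
    by (simp add: sum.distrib sum_distrib_left)
  also have "\<dots> \<le> real M * (1 / 2) + real y"
  proof (intro add_mono mult_left_mono)
    have "(\<Sum>p\<in>?P. 1 / (real p * (real p + 1))) \<le> (\<Sum>n = 2..y. 1 / (real n * (real n + 1)))"
      by (intro sum_mono2) (auto dest!: primes_uptoD)
    then show "(\<Sum>p\<in>?P. 1 / (real p * (real p + 1))) \<le> 1 / 2" using sum_inverse_consecutive_le[of y] by linarith
    show "real (card ?P) \<le> real y" using card_primes_upto_le by simp
  qed simp
  also have "\<dots> \<le> 3 / 4 * real M" using M by simp
  finally have W: "(\<Sum>m\<in>{M<..2 * M}. w m) \<le> 3 / 4 * real M" .
  have "real Q * real M ^ 2 * ln (real y) / 8 = (real Q * real M) * ((ln (real y) / 2) * (real M / 4))"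
    by (simp add: power2_eq_square)
  also have "\<dots> \<le> (real Q * real M) * (B * (real M / 4))"
    using B by (intro mult_left_mono mult_right_mono) auto
  also have "\<dots> \<le> (real Q * real M) * (B * (\<Sum>m\<in>{M<..2 * M}. 1 - w m))"
    using W B0 by (intro mult_left_mono) (auto simp: sum_subtractf)
  also have "\<dots> = (\<Sum>m\<in>{M<..2 * M}. (real Q * real M) * (B * (1 - w m)))"
    by (simp add: sum_distrib_left)
  also have "\<dots> \<le> (\<Sum>m\<in>{M<..2 * M}. real (sigma_ord r (Q * m)))"
  proof (intro sum_mono)
    fix m assume m: "m \<in> {M<..2 * M}"
    let ?R = "\<Prod>p | p \<in> ?P \<and> \<not> p dvd m. 1 + 1 / real p"
    have "B * (1 - w m) \<le> ?R" unfolding B_def w_def by (rule prod_primes_not_dvd_ge)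
    then have "(real Q * real M) * (B * (1 - w m)) \<le> (real Q * real M) * ?R" by (intro mult_left_mono) auto
    also have "\<dots> \<le> real (Q * m) * ?R" using m by (intro mult_right_mono prod_nonneg) (auto intro: mult_left_mono)
    also have "\<dots> \<le> real (sigma_ord r (Q * m))" unfolding Q_def using m by (intro sigma_ord_multiple_ge) auto
    finally show "(real Q * real M) * (B * (1 - w m)) \<le> real (sigma_ord r (Q * m))" .
  qed
  finally show ?thesis .
qed

section \<open>Block sums of the error term\<close>

text \<open>The reflection c + j to c - 1 - j is about c - 1/2, between the two sides of the jump; j
  = 0 gives these sides, and the windows of length 2 q around the centres tile the range.\<close>

lemma sum_symmetric_blocks:
  fixes f :: "nat \<Rightarrow> 'a::comm_monoid_add"
  assumes q: "q > 0" and T: "M \<le> T"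
  shows "(\<Sum>m\<in>{M<..T}. \<Sum>j<q. f (2 * q * m + j) + f (2 * q * m - 1 - j))
       = (\<Sum>n\<in>{q * (2 * M + 1)..<q * (2 * T + 1)}. f n)"
  using T
proof (induction T rule: dec_induct)
  case (step T)
  define c where "c = 2 * q * Suc T"
  have c: "c = q * (2 * T + 1) + q" "q * (2 * Suc T + 1) = c + q"
    by (simp_all add: c_def algebra_simps)
  have cq: "q \<le> c" by (simp add: c(1))
  have up: "(\<Sum>j<q. f (c + j)) = (\<Sum>n\<in>{c..<c + q}. f n)"
    by (rule sum.reindex_bij_witness[where i = "\<lambda>n. n - c" and j = "\<lambda>j. c + j"]) auto
  have down: "(\<Sum>j<q. f (c - 1 - j)) = (\<Sum>n\<in>{c - q..<c}. f n)"
    by (rule sum.reindex_bij_witness[where i = "\<lambda>n. c - 1 - n" and j = "\<lambda>j. c - 1 - j"]) (use cq q in auto)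
  have "(\<Sum>m\<in>{M<..Suc T}. \<Sum>j<q. f (2 * q * m + j) + f (2 * q * m - 1 - j))
      = (\<Sum>j<q. f (c + j) + f (c - 1 - j)) + (\<Sum>m\<in>{M<..T}. \<Sum>j<q. f (2 * q * m + j) + f (2 * q * m - 1 - j))"
  proof -
    have "{M<..Suc T} = insert (Suc T) {M<..T}" using step by auto
    then show ?thesis by (simp add: c_def)
  qed
  also have "\<dots> = (\<Sum>n\<in>{q * (2 * M + 1)..<c - q}. f n) + ((\<Sum>n\<in>{c - q..<c}. f n) + (\<Sum>n\<in>{c..<c + q}. f n))"
  proof -
    have 1: "(\<Sum>m\<in>{M<..T}. \<Sum>j<q. f (2 * q * m + j) + f (2 * q * m - 1 - j)) = (\<Sum>n\<in>{q * (2 * M + 1)..<c - q}. f n)"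
      using step.IH c(1) by simp
    have 2: "(\<Sum>j<q. f (c + j) + f (c - 1 - j)) = (\<Sum>n\<in>{c - q..<c}. f n) + (\<Sum>n\<in>{c..<c + q}. f n)"
      unfolding sum.distrib up down by (rule add.commute)
    show ?thesis unfolding 1 2 by (rule add.commute)
  qed
  also have "\<dots> = (\<Sum>n\<in>{q * (2 * M + 1)..<c + q}. f n)"
  proof -
    have "q * (2 * M + 1) \<le> q * (2 * T + 1)" using step by (intro mult_left_mono) auto
    then have "q * (2 * M + 1) \<le> c - q" using c(1) by simp
    then show ?thesis using cq by (simp add: sum.atLeastLessThan_concat)
  qed
  finally show ?case unfolding c(2) .
qed simp

lemma sigma_err_Suc:
  "sigma_err r (real (Suc n)) = sigma_err r (real n) + real (sigma_ord r (Suc n)) - mean_const r * (2 * real n + 1)"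
proof -
  have f: "nat \<lfloor>real k\<rfloor> = k" for k by simp
  show ?thesis unfolding sigma_err_def f by (simp add: power2_eq_square algebra_simps)
qed

lemma mean_const_nonneg: "r \<ge> 1 \<Longrightarrow> mean_const r \<ge> 0"
  using G_series_bounds(1)[of 2 r] by (simp add: mean_const_eq_G_series)

text \<open>One step outwards adds \<sigma>(a + j + 1) on the right and removes \<sigma>(a - j - 1)
  on the left. The drifts of size about 2 D a cancel up to 4 D (j + 1).\<close>

lemma sigma_err_pair_step:
  assumes "Suc j < a"
  shows "(sigma_err r (real (a + Suc j)) + sigma_err r (real (a - 1 - Suc j)))
       - (sigma_err r (real (a + j)) + sigma_err r (real (a - 1 - j)))
     = real (sigma_ord r (a + Suc j)) - real (sigma_ord r (a - Suc j)) - 4 * mean_const r * real (Suc j)"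
proof -
  define b where "b = a - Suc (Suc j)"
  have b: "a = b + Suc (Suc j)" using assms by (simp add: b_def)
  have e: "a - 1 - Suc j = b" "a - 1 - j = Suc b" "a - Suc j = Suc b" "a + Suc j = Suc (a + j)" using b by simp_all
  have ra: "real (a + j) = real b + 2 * real (Suc j)" using b by simp
  show ?thesis unfolding e sigma_err_Suc ra by (simp add: algebra_simps)
qed

text \<open>For a single m the pairs at distance j may differ much from the pair at the jump; the
  steps are therefore summed over m first, where \<open>sigma_ord_pairing\<close> applies. At most Q
  steps, for each of the q distances, give the factor q Q.\<close>

lemma sigma_err_block_pairing:
  fixes r q M :: nat
  assumes r: "r \<ge> 1" and q: "q > 0" and M: "M \<ge> 1"
  defines "Q \<equiv> 2 * q"
  defines "E \<equiv> (\<lambda>n. sigma_err r (real n))"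
  shows "\<bar>(\<Sum>n\<in>{q * (2 * M + 1)..<q * (4 * M + 1)}. E n)
      - real q * (\<Sum>m\<in>{M<..2 * M}. E (Q * m) + E (Q * m - 1))\<bar>
    \<le> real q * (real Q * (10 * g_weight_const r * (real Q * real M) powr (3 / 2) + 4 * mean_const r * real M * real Q))"
proof -
  define K where "K = 10 * g_weight_const r * (real Q * real M) powr (3 / 2)"
  define D where "D = mean_const r"
  have D0: "D \<ge> 0" using mean_const_nonneg[OF r] by (simp add: D_def)
  have K0: "K \<ge> 0" using g_weight_const_nonneg by (simp add: K_def)
  define T where "T = (\<lambda>j m. E (Q * m + j) + E (Q * m - 1 - j))"
  define I where "I = {M<..2 * M}"
  have cI: "real (card I) = real M" by (simp add: I_def)
  have Tj: "\<bar>(\<Sum>m\<in>I. T j m) - (\<Sum>m\<in>I. T 0 m)\<bar> \<le> real j * (K + 4 * D * real M * real Q)" if "j < q" for j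
    using that
  proof (induction j)
    case (Suc j)
    have jQ: "Suc j < Q" using Suc.prems by (simp add: Q_def)
    have "T (Suc j) m - T j m = real (sigma_ord r (Q * m + Suc j)) - real (sigma_ord r (Q * m - Suc j)) - 4 * D * real (Suc j)"
      if "m \<in> I" for m
    proof -
      have "Q * 1 \<le> Q * m" using that by (intro mult_left_mono) (auto simp: I_def)
      then have "Suc j < Q * m" using jQ by linarith
      from sigma_err_pair_step[OF this] show ?thesis by (simp only: T_def E_def D_def)
    qed
    then have "(\<Sum>m\<in>I. T (Suc j) m - T j m)
        = (\<Sum>m\<in>I. real (sigma_ord r (Q * m + Suc j)) - real (sigma_ord r (Q * m - Suc j)) - 4 * D * real (Suc j))"
      by (intro sum.cong refl)
    then have eq: "(\<Sum>m\<in>I. T (Suc j) m) = (\<Sum>m\<in>I. T j m)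
        + (\<Sum>m\<in>I. real (sigma_ord r (Q * m + Suc j)) - real (sigma_ord r (Q * m - Suc j))) - real M * (4 * D * real (Suc j))"
      using cI by (simp add: sum_subtractf del: of_nat_Suc)
    have p: "\<bar>\<Sum>m\<in>I. real (sigma_ord r (Q * m + Suc j)) - real (sigma_ord r (Q * m - Suc j))\<bar> \<le> K"
      unfolding I_def K_def by (rule sigma_ord_pairing[OF r jQ M])
    have "real M * (4 * D * real (Suc j)) \<le> real M * (4 * D * real Q)"
      using jQ D0 by (intro mult_left_mono) auto
    moreover have "0 \<le> real M * (4 * D * real (Suc j))" using D0 by simp
    moreover have "real (Suc j) * (K + 4 * D * real M * real Q) = real j * (K + 4 * D * real M * real Q) + (K + real M * (4 * D * real Q))"
      by (simp add: algebra_simps)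
    ultimately show ?case using Suc.IH Suc.prems p unfolding eq by linarith
  qed simp
  have Tj': "\<bar>(\<Sum>m\<in>I. T j m) - (\<Sum>m\<in>I. T 0 m)\<bar> \<le> real Q * (K + 4 * D * real M * real Q)" if "j < q" for j
  proof -
    have "real j * (K + 4 * D * real M * real Q) \<le> real Q * (K + 4 * D * real M * real Q)"
      using that K0 D0 by (intro mult_right_mono) (auto simp: Q_def)
    with Tj[OF that] show ?thesis by linarith
  qed
  have "(\<Sum>n\<in>{q * (2 * M + 1)..<q * (4 * M + 1)}. E n) = (\<Sum>m\<in>I. \<Sum>j<q. T j m)"
    using sum_symmetric_blocks[OF q, of M "2 * M" E] by (simp add: I_def T_def Q_def)
  also have "\<dots> = (\<Sum>j<q. \<Sum>m\<in>I. T j m)" by (rule sum.swap)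
  finally have e1: "(\<Sum>n\<in>{q * (2 * M + 1)..<q * (4 * M + 1)}. E n) = (\<Sum>j<q. \<Sum>m\<in>I. T j m)" .
  have e2: "(\<Sum>j<q. \<Sum>m\<in>I. T j m) - real q * (\<Sum>m\<in>I. T 0 m) = (\<Sum>j<q. (\<Sum>m\<in>I. T j m) - (\<Sum>m\<in>I. T 0 m))"
    by (simp add: sum_subtractf)
  have "\<bar>(\<Sum>j<q. \<Sum>m\<in>I. T j m) - real q * (\<Sum>m\<in>I. T 0 m)\<bar>
      \<le> (\<Sum>j<q. \<bar>(\<Sum>m\<in>I. T j m) - (\<Sum>m\<in>I. T 0 m)\<bar>)"
    unfolding e2 by (rule sum_abs)
  also have "\<dots> \<le> (\<Sum>j<q. real Q * (K + 4 * D * real M * real Q))"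
    by (intro sum_mono Tj') auto
  finally show ?thesis unfolding e1 by (simp add: K_def D_def T_def I_def)
qed

lemma smooth_modulus_even:
  assumes "y \<ge> 2"
  shows "even (smooth_modulus r y)"
proof -
  have "2 \<in> primes_upto y" using assms by (simp add: primes_upto_def)
  then have "2 ^ (r + 1) dvd smooth_modulus r y" unfolding smooth_modulus_def by (intro dvd_prodI) auto
  moreover have "(2::nat) dvd 2 ^ (r + 1)" by simp
  ultimately show ?thesis by (rule dvd_trans[rotated])
qed

text \<open>Both signs are treated alike: the bound \<open>lower\<close> is applied at \<open>Q m - 1\<close> if \<open>\<sigma> = 1\<close> and at \<open>Q m\<close> if
  \<open>\<sigma> = -1\<close>, and the jump \<open>\<sigma>\<^sup>(\<^sup>r\<^sup>)(Q m)\<close> determines the value on the other side.\<close>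

lemma sigma_err_block_lower:
  fixes r y M :: nat and \<sigma> \<mu> :: real
  assumes r: "r \<ge> 1" and y: "y \<ge> 2" and M: "M \<ge> 4 * y" and sg: "\<sigma> = 1 \<or> \<sigma> = -1" and mu: "\<mu> \<ge> 0"
  defines "Q \<equiv> smooth_modulus r y"
  assumes lower: "\<And>n. n \<in> {Q * M..2 * Q * M} \<Longrightarrow> \<sigma> * sigma_err r (real n) \<ge> - \<mu> * real n"
    and size: "Q ^ 4 \<le> Q * M"
  shows "(\<Sum>n\<in>{Q div 2 * (2 * M + 1)..<Q div 2 * (4 * M + 1)}. \<sigma> * sigma_err r (real n))
     \<ge> (real Q * real M) ^ 2 / 2 * (ln (real y) / 8 - 4 * \<mu> - (8 * mean_const r + 10 * g_weight_const r))"
proof -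
  define q where "q = Q div 2"
  define X where "X = real Q * real M"
  define D where "D = mean_const r"
  define C where "C = g_weight_const r"
  define E where "E = (\<lambda>n. sigma_err r (real n))"
  have D0: "D \<ge> 0" using mean_const_nonneg[OF r] by (simp add: D_def)
  have C0: "C \<ge> 0" by (simp add: C_def g_weight_const_nonneg)
  have Qq: "Q = 2 * q" using smooth_modulus_even[OF y, of r] by (simp add: q_def Q_def)
  have Q0: "Q > 0" by (simp add: Q_def smooth_modulus_pos)
  then have q0: "q > 0" using Qq by simp
  have M1: "M \<ge> 1" using M y by linarith
  have X1: "X \<ge> 1"
  proof -
    have "1 * 1 \<le> real Q * real M" using Q0 M1 by (intro mult_mono) auto
    then show ?thesis by (simp add: X_def)
  qed
  let ?B = "{q * (2 * M + 1)..<q * (4 * M + 1)}"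
  define S where "S = (\<Sum>m\<in>{M<..2 * M}. E (Q * m) + E (Q * m - 1))"
  have pair: "\<bar>(\<Sum>n\<in>?B. E n) - real q * S\<bar> \<le> real q * (real Q * (10 * C * X powr (3 / 2) + 4 * D * real M * real Q))"
    using sigma_err_block_pairing[OF r q0 M1] unfolding Qq[symmetric] by (simp only: E_def S_def X_def C_def D_def)
  have "\<sigma> * (E (Q * m) + E (Q * m - 1)) \<ge> real (sigma_ord r (Q * m)) - (2 * D + 2 * \<mu>) * (2 * X)"
    if m: "m \<in> {M<..2 * M}" for m
  proof -
    define a where "a = Q * m"
    have "Q * (M + 1) \<le> a" "a \<le> Q * (2 * M)" unfolding a_def using m by (intro mult_left_mono; simp)+
    then have a: "Q * M + Q \<le> a" "a \<le> 2 * Q * M" by (simp_all add: algebra_simps)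
    obtain b where b: "a = Suc b" using a Q0 by (cases a) auto
    have br: "b \<in> {Q * M..2 * Q * M}" "a \<in> {Q * M..2 * Q * M}" using a b Q0 by auto
    have aX: "real a \<le> 2 * X"
    proof -
      have "real a \<le> real (2 * Q * M)" using a(2) by (simp only: of_nat_le_iff)
      then show ?thesis by (simp add: X_def)
    qed
    have st: "E a = E b + real (sigma_ord r a) - D * (2 * real b + 1)"
      unfolding E_def b D_def by (rule sigma_err_Suc)
    have ea: "real a = real b + 1" using b by simp
    have mb: "\<mu> * real b \<le> \<mu> * real a" using mu ea by (intro mult_left_mono) auto
    have l: "\<sigma> * E b \<ge> - \<mu> * real b" "\<sigma> * E a \<ge> - \<mu> * real a"
      unfolding E_def using lower br by auto
    have Db: "D * (2 * real b + 1) \<le> 2 * D * real a" using D0 ea by (simp add: algebra_simps)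
    have "\<sigma> * (E a + E b) \<ge> real (sigma_ord r a) - 2 * D * real a - 2 * (\<mu> * real a)"
      using sg
    proof
      assume s: "\<sigma> = 1"
      show ?thesis using l(1) mb Db unfolding st s by (simp add: algebra_simps)
    next
      assume s: "\<sigma> = -1"
      have Eb: "E b = E a - real (sigma_ord r a) + D * (2 * real b + 1)" using st by simp
      show ?thesis using l(2) Db unfolding Eb s by (simp add: algebra_simps)
    qed
    moreover have "2 * D * real a + 2 * (\<mu> * real a) \<le> (2 * D + 2 * \<mu>) * (2 * X)"
    proof -
      have "(2 * D + 2 * \<mu>) * real a \<le> (2 * D + 2 * \<mu>) * (2 * X)" using aX D0 mu by (intro mult_left_mono) auto
      then show ?thesis by (simp add: algebra_simps)
    qed
    moreover have "Q * m - 1 = b" using b by (simp add: a_def)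
    ultimately show ?thesis unfolding a_def[symmetric] by (simp only:)
  qed
  then have "(\<Sum>m\<in>{M<..2 * M}. real (sigma_ord r (Q * m)) - (2 * D + 2 * \<mu>) * (2 * X))
      \<le> (\<Sum>m\<in>{M<..2 * M}. \<sigma> * (E (Q * m) + E (Q * m - 1)))" by (intro sum_mono)
  then have "(\<Sum>m\<in>{M<..2 * M}. real (sigma_ord r (Q * m))) - real M * ((2 * D + 2 * \<mu>) * (2 * X)) \<le> \<sigma> * S"
    by (simp add: sum_subtractf S_def sum_distrib_left)
  moreover have "(\<Sum>m\<in>{M<..2 * M}. real (sigma_ord r (Q * m))) \<ge> real Q * real M ^ 2 * ln (real y) / 8"
    unfolding Q_def using y M by (intro sum_sigma_ord_multiples_ge) auto
  ultimately have S: "\<sigma> * S \<ge> real Q * real M ^ 2 * ln (real y) / 8 - real M * ((2 * D + 2 * \<mu>) * (2 * X))" by linarith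
  have abs: "\<bar>\<sigma> * ((\<Sum>n\<in>?B. E n) - real q * S)\<bar> = \<bar>(\<Sum>n\<in>?B. E n) - real q * S\<bar>" using sg by (auto simp: abs_mult)
  have "\<sigma> * (\<Sum>n\<in>?B. E n) \<ge> real q * (\<sigma> * S) - real q * (real Q * (10 * C * X powr (3 / 2) + 4 * D * real M * real Q))"
  proof -
    let ?Z = "\<Sum>n\<in>?B. E n" and ?P = "real q * (real Q * (10 * C * X powr (3 / 2) + 4 * D * real M * real Q))"
    have "\<bar>\<sigma> * (?Z - real q * S)\<bar> \<le> ?P" using abs pair by linarith
    then have "- (\<sigma> * (?Z - real q * S)) \<le> ?P" by (rule abs_le_D2)
    moreover have "\<sigma> * (?Z - real q * S) = \<sigma> * ?Z - real q * (\<sigma> * S)" by (simp only: right_diff_distrib mult.left_commute)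
    ultimately show ?thesis by linarith
  qed
  moreover have "real q * (\<sigma> * S) \<ge> real q * (real Q * real M ^ 2 * ln (real y) / 8 - real M * ((2 * D + 2 * \<mu>) * (2 * X)))"
    using S by (intro mult_left_mono) auto
  ultimately have "\<sigma> * (\<Sum>n\<in>?B. E n) \<ge> real q * (real Q * real M ^ 2 * ln (real y) / 8 - real M * ((2 * D + 2 * \<mu>) * (2 * X)))
      - real q * (real Q * (10 * C * X powr (3 / 2) + 4 * D * real M * real Q))" by linarith
  moreover have "real q * (real Q * real M ^ 2 * ln (real y) / 8 - real M * ((2 * D + 2 * \<mu>) * (2 * X)))
      = X ^ 2 / 2 * (ln (real y) / 8 - 4 * \<mu> - 4 * D)"
    using Qq by (simp add: X_def field_simps power2_eq_square)
  moreover have "real q * (real Q * (10 * C * X powr (3 / 2) + 4 * D * real M * real Q)) \<le> X ^ 2 / 2 * (10 * C + 4 * D)"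
  proof -
    \<comment> \<open>The pairing error has size Q^2 X^(3/2) and the main term X^2, so Q^2 <= sqrt X
      is the required smallness.\<close>
    have "real (Q ^ 4) \<le> real (Q * M)" using size by (simp only: of_nat_le_iff)
    then have "(real Q ^ 2) ^ 2 \<le> X" by (simp add: X_def flip: power_mult)
    then have QX: "real Q ^ 2 \<le> X powr (1 / 2)"
      using X1 by (simp add: powr_half_sqrt real_le_rsqrt)
    have "X powr (1 / 2) * X powr (3 / 2) = X powr (1 / 2 + 3 / 2)" by (rule powr_add[symmetric])
    also have "\<dots> = X ^ 2" using X1 by simp
    finally have pw: "X powr (1 / 2) * X powr (3 / 2) = X ^ 2" .
    have "real Q ^ 2 * X powr (3 / 2) \<le> X powr (1 / 2) * X powr (3 / 2)" using QX by (intro mult_right_mono) auto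
    then have t1: "real Q ^ 2 * X powr (3 / 2) \<le> X ^ 2" using pw by simp
    have "X \<le> X powr (3 / 2)" using powr_mono[of 1 "3 / 2" X] X1 by simp
    then have "real Q ^ 2 * X \<le> real Q ^ 2 * X powr (3 / 2)" by (intro mult_left_mono) auto
    then have t2: "real Q ^ 2 * X \<le> X ^ 2" using t1 by simp
    have "real q * (real Q * (10 * C * X powr (3 / 2) + 4 * D * real M * real Q))
        = 5 * C * (real Q ^ 2 * X powr (3 / 2)) + 2 * D * (real Q ^ 2 * X)"
      using Qq by (simp add: X_def power2_eq_square algebra_simps)
    also have "\<dots> \<le> 5 * C * X ^ 2 + 2 * D * X ^ 2"
      using t1 t2 C0 D0 by (intro add_mono mult_left_mono) auto
    also have "\<dots> = X ^ 2 / 2 * (10 * C + 4 * D)" by (simp add: field_simps)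
    finally show ?thesis .
  qed
  ultimately have "\<sigma> * (\<Sum>n\<in>?B. E n) \<ge> X ^ 2 / 2 * (ln (real y) / 8 - 4 * \<mu> - 4 * D) - X ^ 2 / 2 * (10 * C + 4 * D)"
    by linarith
  moreover have "X ^ 2 / 2 * (ln (real y) / 8 - 4 * \<mu> - 4 * D) - X ^ 2 / 2 * (10 * C + 4 * D)
      = X ^ 2 / 2 * (ln (real y) / 8 - 4 * \<mu> - (8 * D + 10 * C))"
    unfolding right_diff_distrib[symmetric] by simp
  ultimately have "X ^ 2 / 2 * (ln (real y) / 8 - 4 * \<mu> - (8 * D + 10 * C)) \<le> \<sigma> * (\<Sum>n\<in>?B. E n)" by linarith
  then show ?thesis
    unfolding sum_distrib_left[symmetric] q_def[symmetric] X_def[symmetric] D_def[symmetric] C_def[symmetric]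
    by (simp only: E_def)
qed

section \<open>Comparison of the two estimates\<close>

text \<open>There are at most y primes, each at most 2^y. The square is kept because Q^4 <= 4^k has
  to stay below 8^k.\<close>

lemma smooth_modulus_square_le:
  assumes "2 * (r + 1) * y ^ 2 \<le> k"
  shows "smooth_modulus r y ^ 2 \<le> 2 ^ k"
proof -
  have "smooth_modulus r y \<le> (\<Prod>p\<in>primes_upto y. 2 ^ (y * (r + 1)))"
    unfolding smooth_modulus_def
  proof (rule prod_mono)
    fix p assume "p \<in> primes_upto y"
    then have "p \<le> y" by (simp add: primes_upto_def)
    then have "p \<le> 2 ^ y" using less_exp[of y] by linarith
    then have "p ^ (r + 1) \<le> (2 ^ y) ^ (r + 1)" by (intro power_mono) auto
    then show "0 \<le> p ^ (r + 1) \<and> p ^ (r + 1) \<le> 2 ^ (y * (r + 1))" by (simp only: power_mult)  simp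
  qed
  also have "\<dots> = 2 ^ (y * (r + 1) * card (primes_upto y))" by (simp only: prod_constant power_mult)
  also have "\<dots> \<le> 2 ^ (y * (r + 1) * y)" using card_primes_upto_le by (intro power_increasing mult_left_mono) auto
  finally have "smooth_modulus r y ^ 2 \<le> (2 ^ (y * (r + 1) * y)) ^ 2" by (intro power_mono) auto
  also have "\<dots> = 2 ^ (y * (r + 1) * y * 2)" by (simp only: power_mult)
  also have "\<dots> \<le> 2 ^ k" using assms by (intro power_increasing) (auto simp: power2_eq_square algebra_simps)
  finally show ?thesis .
qed

text \<open>The witness is the integer part of sqrt(k / (2 (r+1))). Comparing it with k^(1/4) leaves
  room for the constant and for the rounding.\<close>

lemma eventually_smooth_bound:
  "eventually (\<lambda>k::nat. \<exists>y\<ge>2. 2 * (r + 1) * y ^ 2 \<le> k \<and> ln (real k) / 4 \<le> ln (real y)) sequentially"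
proof -
  define c where "c = 2 * (real r + 1)"
  have c: "c > 0" by (simp add: c_def)
  have "eventually (\<lambda>k::nat. real k powr (1 / 4) \<le> sqrt (real k / c) - 1) sequentially"
    using c by real_asymp
  moreover have "eventually (\<lambda>k::nat. 3 \<le> sqrt (real k / c)) sequentially"
    using c by real_asymp
  ultimately show ?thesis using eventually_gt_at_top[of 0]
  proof eventually_elim
    case (elim k)
    define y where "y = nat \<lfloor>sqrt (real k / c)\<rfloor>"
    have yl: "real y \<le> sqrt (real k / c)" "sqrt (real k / c) - 1 < real y"
      using elim c by (auto simp: y_def)
    have "y \<ge> 2" using yl elim by linarith
    moreover have "2 * (r + 1) * y ^ 2 \<le> k"
    proof -
      have "real y ^ 2 \<le> sqrt (real k / c) ^ 2" using yl by (intro power_mono) auto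
      also have "\<dots> = real k / c" using c by simp
      finally have "c * real y ^ 2 \<le> real k" using c by (simp add: field_simps)
      then have "real (2 * (r + 1) * y ^ 2) \<le> real k" by (simp add: c_def algebra_simps)
      then show ?thesis by (simp only: of_nat_le_iff)
    qed
    moreover have "ln (real k) / 4 \<le> ln (real y)"
    proof -
      have "ln (real k) / 4 = ln (real k powr (1 / 4))" using elim by (simp add: ln_powr)
      also have "\<dots> \<le> ln (real y)" using elim yl by (intro ln_mono) auto
      finally show ?thesis .
    qed
    ultimately show ?case by blast
  qed
qed

text \<open>From ln y / 8 >= ln k / 32 the terms 4 \<mu> and the constants each take at most ln k /
  128. There remains ln k / 64, and half the square of QM > 8^k gives 64^k ln k / 128.\<close>

lemma block_sum_lower:
  fixes \<sigma> \<epsilon> :: real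
  assumes r: "r \<ge> 1" and sg: "\<sigma> = 1 \<or> \<sigma> = -1" and eps: "0 \<le> \<epsilon>" "\<epsilon> \<le> 1 / 1024"
    and k: "k \<ge> 1" and y: "y \<ge> 2" "2 * (r + 1) * y ^ 2 \<le> k" "ln (real k) / 4 \<le> ln (real y)"
    and large: "8 * mean_const r + 10 * g_weight_const r \<le> ln (real k) / 128"
    and lower: "\<And>n. n \<in> {8 ^ k..8 ^ (k + 1)} \<Longrightarrow> \<sigma> * sigma_err r (real n) \<ge> - (2 * \<epsilon> * ln (real k)) * real n"
  shows "(\<Sum>n\<in>{8 ^ k..<8 ^ (k + 1)}. \<sigma> * sigma_err r (real n) + 2 * \<epsilon> * ln (real k) * real n)
     \<ge> 64 ^ k * ln (real k) / 128"
proof -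
  define Q where "Q = smooth_modulus r y"
  \<comment> \<open>The least M with Q M > 8^k; then Q M <= 8^k + Q <= 2 8^k, and the window
    \<open>?B\<close> fits into the block.\<close>
  define M where "M = 8 ^ k div Q + 1"
  define \<mu> where "\<mu> = 2 * \<epsilon> * ln (real k)"
  define K :: nat where "K = 8 ^ k"
  have lnk: "ln (real k) \<ge> 0" using k by simp
  have mu0: "\<mu> \<ge> 0" using eps lnk by (simp add: \<mu>_def)
  have Q0: "Q > 0" by (simp add: Q_def smooth_modulus_pos)
  have Q2: "Q ^ 2 \<le> 2 ^ k" unfolding Q_def by (rule smooth_modulus_square_le[OF y(2)])
  have "Q \<le> Q ^ 2" using Q0 by (simp add: power2_eq_square)
  then have Qk: "Q \<le> 2 ^ k" using Q2 by linarith
  have "(2::nat) ^ k \<le> 8 ^ k" by (intro power_mono) auto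
  then have QK: "Q \<le> K" using Qk by (simp add: K_def)
  have K8: "8 ^ (k + 1) = 8 * K" by (simp add: K_def)
  have QM: "Q * M = K - K mod Q + Q"
    by (simp add: M_def K_def[symmetric] distrib_left minus_mod_eq_mult_div[symmetric])
  have "K mod Q < Q" using Q0 by simp
  then have QM1: "K < Q * M" using QM mod_less_eq_dividend[of K Q] by linarith
  have QM2: "Q * M \<le> K + Q" using QM by linarith
  have "y \<le> y * y" using y by simp
  also have "\<dots> \<le> 2 * (r + 1) * y ^ 2" by (simp add: power2_eq_square)
  finally have yk: "y \<le> k" using y(2) by linarith
  have "4 * y \<le> M"
  proof -
    have "4 * k \<le> 4 ^ k" using k
    proof (induction k rule: nat_induct_at_least)
      case (Suc n)
      then show ?case by simp
    qed simp
    then have y4: "4 * y \<le> 4 ^ k" using yk by linarith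
    have "(8::nat) ^ k = 2 ^ k * 4 ^ k" by (simp flip: power_mult_distrib)
    then have "2 ^ k * 4 ^ k < Q * M" using QM1 by (simp add: K_def)
    also have "\<dots> \<le> 2 ^ k * M" using Qk by (intro mult_right_mono) auto
    finally have "4 ^ k < M" by simp
    then show ?thesis using y4 by linarith
  qed
  have size: "Q ^ 4 \<le> Q * M"
  proof -
    have "Q ^ 4 = (Q ^ 2) ^ 2" by simp
    also have "\<dots> \<le> (2 ^ k) ^ 2" using Q2 by (intro power_mono) auto
    also have "\<dots> = (2 ^ 2) ^ k" by (simp only: power_mult[symmetric] mult.commute)
    also have "\<dots> \<le> 8 ^ k" by (intro power_mono) auto
    finally show ?thesis using QM1 by (simp add: K_def)
  qed
  let ?q = "Q div 2"
  have Qq: "Q = 2 * ?q" using smooth_modulus_even[OF y(1), of r] by (simp add: Q_def)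
  let ?B = "{?q * (2 * M + 1)..<?q * (4 * M + 1)}"
  have e1: "?q * (2 * M + 1) = Q * M + ?q" "?q * (4 * M + 1) = 2 * (Q * M) + ?q"
    using Qq by (simp_all add: distrib_left mult.assoc[symmetric])
  have sub: "?B \<subseteq> {8 ^ k..<8 ^ (k + 1)}"
    unfolding e1 K8 K_def[symmetric] using QM1 QM2 QK by auto
  have low: "\<sigma> * sigma_err r (real n) \<ge> - \<mu> * real n" if "n \<in> {8 ^ k..8 ^ (k + 1)}" for n
    using lower[OF that] by (simp add: \<mu>_def)
  have low': "\<sigma> * sigma_err r (real n) \<ge> - \<mu> * real n" if "n \<in> {Q * M..2 * Q * M}" for n
  proof (rule low)
    show "n \<in> {8 ^ k..8 ^ (k + 1)}"
      unfolding K8 K_def[symmetric] using that QM1 QM2 QK by auto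
  qed
  have "(real Q * real M) ^ 2 / 2 * (ln (real y) / 8 - 4 * \<mu> - (8 * mean_const r + 10 * g_weight_const r))
      \<le> (\<Sum>n\<in>?B. \<sigma> * sigma_err r (real n))"
    unfolding Q_def
    by (rule sigma_err_block_lower[OF r y(1) \<open>4 * y \<le> M\<close> sg mu0])
       (use low' size in \<open>auto simp: Q_def\<close>)
  \<comment> \<open>Adding \<mu> n makes every term of the block nonnegative, which permits
    enlarging the window to the block.\<close>
  also have "\<dots> \<le> (\<Sum>n\<in>?B. \<sigma> * sigma_err r (real n) + \<mu> * real n)"
    using mu0 by (intro sum_mono) auto
  also have "\<dots> \<le> (\<Sum>n\<in>{8 ^ k..<8 ^ (k + 1)}. \<sigma> * sigma_err r (real n) + \<mu> * real n)"
  proof (intro sum_mono2 sub)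
    fix n assume "n \<in> {8 ^ k..<8 ^ (k + 1)} - ?B"
    then have "n \<in> {8 ^ k..8 ^ (k + 1)}" by auto
    from low[OF this] show "0 \<le> \<sigma> * sigma_err r (real n) + \<mu> * real n" by simp
  qed auto
  finally have main: "(real Q * real M) ^ 2 / 2 * (ln (real y) / 8 - 4 * \<mu> - (8 * mean_const r + 10 * g_weight_const r))
      \<le> (\<Sum>n\<in>{8 ^ k..<8 ^ (k + 1)}. \<sigma> * sigma_err r (real n) + \<mu> * real n)" .
  have "\<epsilon> * ln (real k) \<le> (1 / 1024) * ln (real k)" using eps lnk by (intro mult_right_mono) auto
  then have m8: "4 * \<mu> \<le> ln (real k) / 128" by (simp add: \<mu>_def)
  have br: "ln (real k) / 64 \<le> ln (real y) / 8 - 4 * \<mu> - (8 * mean_const r + 10 * g_weight_const r)"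
    using y(3) m8 large by linarith
  have "real K \<le> real (Q * M)" using QM1 by (simp only: of_nat_le_iff)
  then have "real K ^ 2 \<le> (real Q * real M) ^ 2" by (intro power_mono) auto
  moreover have "real K ^ 2 = 64 ^ k"
    by (simp add: K_def power2_eq_square flip: power_mult_distrib)
  ultimately have br2: "64 ^ k / 2 * (ln (real k) / 64) \<le> (real Q * real M) ^ 2 / 2 * (ln (real y) / 8 - 4 * \<mu> - (8 * mean_const r + 10 * g_weight_const r))"
    using br lnk by (intro mult_mono) auto
  have "64 ^ k * ln (real k) / 128 = 64 ^ k / 2 * (ln (real k) / 64)" by simp
  also note br2
  also note main
  finally show ?thesis by (simp only: \<mu>_def)
qed

section \<open>From sums over integers to Mellin integrals over blocks\<close>

lemma sigma_err_measurable [measurable]: "sigma_err r \<in> borel_measurable borel"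
proof -
  have m1: "(\<lambda>x::real. nat \<lfloor>x\<rfloor>) \<in> measurable borel (count_space UNIV)" by measurable
  have m2: "(\<lambda>N. \<Sum>n = 1..N. real (sigma_ord r n)) \<in> measurable (count_space UNIV) borel" by simp
  have [measurable]: "(\<lambda>x::real. \<Sum>n = 1..nat \<lfloor>x\<rfloor>. real (sigma_ord r n)) \<in> borel_measurable borel"
    using measurable_compose[OF m1 m2] .
  show ?thesis unfolding sigma_err_def by measurable
qed

text \<open>Read off from the Mellin integrability at s = 3/2: on [a, b) the weight is at least
  b^(-5/2).\<close>

lemma sigma_err_set_integrable:
  assumes r: "r \<ge> 1" and a: "0 < a"
  shows "set_integrable lborel {a..<b} (sigma_err r)"
  unfolding set_integrable_def
proof (rule Bochner_Integration.integrable_bound)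
  let ?h = "\<lambda>x. indicator {0<..} x * (sigma_err r x * x powr (- (3 / 2) - 1))"
  show "integrable lborel (\<lambda>x. b powr (5 / 2) * ?h x)"
    using sigma_err_mellin(1)[OF r, of "3 / 2"] by (intro integrable_mult_right) auto
  show "AE x in lborel. norm (indicator {a..<b} x *\<^sub>R sigma_err r x) \<le> norm (b powr (5 / 2) * ?h x)"
  proof (rule AE_I2)
    fix x :: real
    show "norm (indicator {a..<b} x *\<^sub>R sigma_err r x) \<le> norm (b powr (5 / 2) * ?h x)"
    proof (cases "x \<in> {a..<b}")
      case True
      then have x: "0 < x" "x \<le> b" using a by auto
      have "x powr (5 / 2) * x powr (- (3 / 2) - 1) = x powr (5 / 2 + (- (3 / 2) - 1))"
        by (rule powr_add[symmetric])
      then have "1 = x powr (5 / 2) * x powr (- (3 / 2) - 1)" using x by simp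
      also have "\<dots> \<le> b powr (5 / 2) * x powr (- (3 / 2) - 1)"
        using x by (intro mult_right_mono powr_mono2) auto
      finally have "\<bar>sigma_err r x\<bar> * 1 \<le> \<bar>sigma_err r x\<bar> * (b powr (5 / 2) * x powr (- (3 / 2) - 1))"
        by (intro mult_left_mono) auto
      then show ?thesis using True x by (simp add: abs_mult mult_ac)
    qed simp
  qed
qed measurable

lemma set_integral_consecutive:
  fixes h :: "real \<Rightarrow> real" and c :: "nat \<Rightarrow> real"
  assumes "\<And>i j. set_integrable lborel {c i..<c j} h" "incseq c" "a \<le> b"
  shows "(LINT x:{c a..<c b}|lborel. h x) = (\<Sum>k\<in>{a..<b}. LINT x:{c k..<c (Suc k)}|lborel. h x)"
  using assms(3)
proof (induction b rule: dec_induct)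
  case base
  then show ?case by (simp add: set_lebesgue_integral_def)
next
  case (step b)
  have "c a \<le> c b" "c b \<le> c (Suc b)" using assms(2) step by (auto simp: incseq_def)
  then have "{c a..<c (Suc b)} = {c a..<c b} \<union> {c b..<c (Suc b)}" by auto
  then have "(LINT x:{c a..<c (Suc b)}|lborel. h x) = (LINT x:{c a..<c b}|lborel. h x) + (LINT x:{c b..<c (Suc b)}|lborel. h x)"
    by (simp only:) (rule set_integral_Un; use assms in auto)
  then show ?case using step by simp
qed

lemma set_integrable_const_Ico: "set_integrable lborel {a..<b::real} (\<lambda>_. c::real)"
proof (cases "a \<le> b")
  case True
  then show ?thesis
    unfolding set_integrable_def by (intro integrable_scaleR_left) (simp add: integrable_indicator_iff)
qed (simp add: set_integrable_def)

text \<open>Between integers E varies only by the smooth term, at most D (2n + 1) <= 2 D b on [n,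
  n+1), while \<mu> x increases.\<close>

lemma block_integral_lower:
  fixes \<sigma> \<mu> :: real and a b :: nat
  assumes r: "r \<ge> 1" and sg: "\<sigma> = 1 \<or> \<sigma> = -1" and mu: "\<mu> \<ge> 0" and ab: "0 < a" "a \<le> b"
  shows "set_integrable lborel {real a..<real b} (\<lambda>x. \<sigma> * sigma_err r x + \<mu> * x)"
    "(LINT x:{real a..<real b}|lborel. \<sigma> * sigma_err r x + \<mu> * x)
     \<ge> (\<Sum>n\<in>{a..<b}. \<sigma> * sigma_err r (real n) + \<mu> * real n) - 2 * mean_const r * real b ^ 2"
proof -
  let ?h = "\<lambda>x. \<sigma> * sigma_err r x + \<mu> * x"
  define D where "D = mean_const r"
  have D0: "D \<ge> 0" using mean_const_nonneg[OF r] by (simp add: D_def)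
  have idi: "set_integrable lborel {c..<d} (\<lambda>x. \<mu> * x)" for c d :: real
  proof -
    have "set_integrable lborel {c..d} (\<lambda>x. \<mu> * x)"
      by (intro borel_integrable_atLeastAtMost' continuous_intros)
    then show ?thesis by (rule set_integrable_subset) auto
  qed
  have hi: "set_integrable lborel {c..<d} ?h" if "0 < c" for c d
    using sigma_err_set_integrable[OF r that] idi by (intro set_integral_add set_integrable_mult_right) auto
  show "set_integrable lborel {real a..<real b} ?h" using ab by (intro hi) simp
  \<comment> \<open>The maximum with a keeps every partition point positive, as the integrability
    required for all pairs of indices demands.\<close>
  define c where "c = (\<lambda>i. real (max a i))"
  have "(LINT x:{c a..<c b}|lborel. ?h x) = (\<Sum>k\<in>{a..<b}. LINT x:{c k..<c (Suc k)}|lborel. ?h x)"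
    using ab by (intro set_integral_consecutive hi) (auto simp: c_def incseq_def)
  also have "\<dots> = (\<Sum>n\<in>{a..<b}. LINT x:{real n..<real n + 1}|lborel. ?h x)"
    by (intro sum.cong) (auto simp: c_def max_def add.commute)
  also have "(LINT x:{c a..<c b}|lborel. ?h x) = (LINT x:{real a..<real b}|lborel. ?h x)"
    using ab by (simp add: c_def max_def)
  finally have eq: "(LINT x:{real a..<real b}|lborel. ?h x) = (\<Sum>n\<in>{a..<b}. LINT x:{real n..<real n + 1}|lborel. ?h x)" .
  have "(\<Sum>n\<in>{a..<b}. ?h (real n) - 2 * D * real b) \<le> (\<Sum>n\<in>{a..<b}. LINT x:{real n..<real n + 1}|lborel. ?h x)"
  proof (rule sum_mono)
    fix n assume n: "n \<in> {a..<b}"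
    let ?I = "{real n..<real n + 1}"
    have "?h (real n) - 2 * D * real b = (LINT x:?I|lborel. ?h (real n) - 2 * D * real b)"
      by (subst set_lborel_integral_const) auto
    also have "\<dots> \<le> (LINT x:?I|lborel. ?h x)"
    proof (rule set_integral_mono)
      show "set_integrable lborel ?I (\<lambda>x. ?h (real n) - 2 * D * real b)" by (rule set_integrable_const_Ico)
      show "set_integrable lborel ?I ?h" using n ab by (intro hi) auto
      fix x assume x: "x \<in> ?I"
      then have "\<lfloor>x\<rfloor> = int n" by (simp add: floor_eq_iff)
      then have df: "sigma_err r x - sigma_err r (real n) = - (D * (x ^ 2 - real n ^ 2))"
        by (simp add: sigma_err_def D_def algebra_simps)
      have "x ^ 2 \<le> (real n + 1) ^ 2" "real n ^ 2 \<le> x ^ 2" using x by (intro power_mono; simp)+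
      moreover have "(real n + 1) ^ 2 - real n ^ 2 \<le> 2 * real b" using n by (simp add: power2_eq_square algebra_simps)
      ultimately have "0 \<le> x ^ 2 - real n ^ 2" "x ^ 2 - real n ^ 2 \<le> 2 * real b" by linarith+
      then have "0 \<le> D * (x ^ 2 - real n ^ 2)" "D * (x ^ 2 - real n ^ 2) \<le> D * (2 * real b)"
        using D0 by (simp, intro mult_left_mono) 
      moreover have "\<mu> * real n \<le> \<mu> * x" using mu x by (intro mult_left_mono) auto
      ultimately show "?h (real n) - 2 * D * real b \<le> ?h x" using sg df by auto
    qed
    finally show "?h (real n) - 2 * D * real b \<le> (LINT x:?I|lborel. ?h x)" .
  qed
  moreover have "real (b - a) * (2 * D * real b) \<le> 2 * D * real b ^ 2"
  proof -
    have "real (b - a) * (2 * D * real b) \<le> real b * (2 * D * real b)" using D0 by (intro mult_right_mono) auto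
    then show ?thesis by (simp add: power2_eq_square mult_ac)
  qed
  ultimately show "(LINT x:{real a..<real b}|lborel. ?h x)
     \<ge> (\<Sum>n\<in>{a..<b}. \<sigma> * sigma_err r (real n) + \<mu> * real n) - 2 * mean_const r * real b ^ 2"
    unfolding eq by (simp add: sum_subtractf D_def[symmetric])
qed

text \<open>The nonnegative part F + \<mu> x receives the least weight of the block, the subtracted
  \<mu> x the greatest. The former gives at least t ln k / 2^17, with t = 8^(-\<delta> k); the
  latter costs at most 8 \<mu> t = 16 \<epsilon> t ln k. With \<epsilon> = 2^-22 this is half of the
  gain.\<close>

lemma block_mellin_lower:
  fixes \<sigma> \<delta> \<epsilon> :: real
  assumes r: "r \<ge> 1" and sg: "\<sigma> = 1 \<or> \<sigma> = -1" and d: "0 < \<delta>" "\<delta> \<le> 1 / 2" and eps: "\<epsilon> = 1 / 2 ^ 22"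
    and k: "k \<ge> 1" and y: "y \<ge> 2" "2 * (r + 1) * y ^ 2 \<le> k" "ln (real k) / 4 \<le> ln (real y)"
    and large: "8 * mean_const r + 10 * g_weight_const r \<le> ln (real k) / 128" "128 * mean_const r \<le> ln (real k) / 256"
    and lower: "\<And>x. x \<in> {8 ^ k..8 ^ (k + 1)} \<Longrightarrow> \<sigma> * sigma_err r x \<ge> - (2 * \<epsilon> * ln (real k)) * x"
  shows "(LINT x:{8 ^ k..<8 ^ (k + 1)}|lborel. \<sigma> * (sigma_err r x * x powr (- \<delta> - 2)))
     \<ge> (8 powr (- \<delta>)) ^ k * (ln (real k) / 2 ^ 18)"
proof -
  let ?I = "{8 ^ k..<8 ^ (k + 1) :: real}"
  define \<mu> where "\<mu> = 2 * \<epsilon> * ln (real k)"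
  define D where "D = mean_const r"
  define F where "F = (\<lambda>x. \<sigma> * sigma_err r x)"
  define a :: real where "a = 8 ^ k"
  have a1: "a \<ge> 1" by (simp add: a_def)
  have I: "?I = {a..<8 * a}" by (simp add: a_def)
  have lnk: "ln (real k) \<ge> 0" using k by simp
  have mu0: "\<mu> \<ge> 0" using lnk by (simp add: \<mu>_def eps)
  have low: "F x \<ge> - \<mu> * x" if "x \<in> {a..8 * a}" for x
    using lower[of x] that by (simp add: F_def \<mu>_def a_def)
  have sumlow: "(\<Sum>n\<in>{8 ^ k..<8 ^ (k + 1)}. \<sigma> * sigma_err r (real n) + \<mu> * real n) \<ge> 64 ^ k * ln (real k) / 128"
    unfolding \<mu>_def
  proof (rule block_sum_lower[OF r sg _ _ k y large(1)])
    fix n :: nat assume n: "n \<in> {8 ^ k..8 ^ (k + 1)}"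
    then have "real (8 ^ k) \<le> real n" "real n \<le> real (8 ^ (k + 1))" by (simp_all only: of_nat_le_iff atLeastAtMost_iff)
    then show "- (2 * \<epsilon> * ln (real k)) * real n \<le> \<sigma> * sigma_err r (real n)" by (intro lower) simp
  qed (simp_all add: eps)
  have bnd: "(0::nat) < 8 ^ k" "(8::nat) ^ k \<le> 8 ^ (k + 1)" by simp_all
  note bi = block_integral_lower[OF r sg mu0 bnd, folded F_def]
  have rI: "{real (8 ^ k)..<real (8 ^ (k + 1))} = {a..<8 * a}" by (simp add: a_def)
  have Fi: "set_integrable lborel {a..<8 * a} (\<lambda>x. F x + \<mu> * x)"
    using bi(1) unfolding rI by (simp add: F_def)
  have a2: "a ^ 2 = 64 ^ k" by (simp add: a_def power2_eq_square flip: power_mult_distrib)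
  have "(LINT x:{a..<8 * a}|lborel. F x + \<mu> * x) \<ge> 64 ^ k * ln (real k) / 128 - 2 * D * (8 * a) ^ 2"
    using bi(2) sumlow unfolding rI by (simp add: F_def D_def a_def)
  moreover have "2 * D * (8 * a) ^ 2 \<le> 64 ^ k * (ln (real k) / 256)"
  proof -
    have "2 * D * (8 * a) ^ 2 = 64 ^ k * (128 * D)" by (simp add: power_mult_distrib a2)
    also have "\<dots> \<le> 64 ^ k * (ln (real k) / 256)" using large(2) by (intro mult_left_mono) (auto simp: D_def)
    finally show ?thesis .
  qed
  ultimately have S1: "(LINT x:{a..<8 * a}|lborel. F x + \<mu> * x) \<ge> a ^ 2 * (ln (real k) / 256)"
    unfolding a2 by simp
  define w1 where "w1 = (8 * a) powr (- \<delta> - 2)"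
  define w2 where "w2 = a powr (- \<delta> - 1)"
  have w0: "w1 \<ge> 0" "w2 \<ge> 0" by (simp_all add: w1_def w2_def)
  have Gi: "set_integrable lborel {a..<8 * a} (\<lambda>x. \<sigma> * (sigma_err r x * x powr (- \<delta> - 2)))"
  proof -
    have "set_integrable lborel {0<..} (\<lambda>x. sigma_err r x * x powr (- \<delta> - 2))"
    proof -
      have e: "- (1 + \<delta>) - 1 = - \<delta> - 2" by simp
      show ?thesis using sigma_err_mellin(1)[OF r, of "1 + \<delta>"] d unfolding e by (simp add: set_integrable_def)
    qed
    then have "set_integrable lborel {a..<8 * a} (\<lambda>x. sigma_err r x * x powr (- \<delta> - 2))"
      by (rule set_integrable_subset) (use a1 in auto)
    then show ?thesis by (intro set_integrable_mult_right) auto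
  qed
  have Ri: "set_integrable lborel {a..<8 * a} (\<lambda>x. w1 * (F x + \<mu> * x) - \<mu> * w2)"
    using Fi set_integrable_const_Ico by (intro set_integral_diff set_integrable_mult_right) auto
  have "(LINT x:{a..<8 * a}|lborel. w1 * (F x + \<mu> * x) - \<mu> * w2)
      \<le> (LINT x:{a..<8 * a}|lborel. \<sigma> * (sigma_err r x * x powr (- \<delta> - 2)))"
  proof (rule set_integral_mono[OF Ri Gi])
    fix x assume x: "x \<in> {a..<8 * a}"
    then have x0: "x > 0" using a1 by simp
    have "w1 \<le> x powr (- \<delta> - 2)" unfolding w1_def using x x0 d by (intro powr_mono2') auto
    moreover have "0 \<le> F x + \<mu> * x" using low[of x] x by simp
    ultimately have 1: "w1 * (F x + \<mu> * x) \<le> x powr (- \<delta> - 2) * (F x + \<mu> * x)" by (intro mult_right_mono)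
    have "x powr (- \<delta> - 2) * x powr 1 = x powr (- \<delta> - 2 + 1)" by (rule powr_add[symmetric])
    also have "- \<delta> - 2 + 1 = - \<delta> - 1" by simp
    finally have "x powr (- \<delta> - 2) * x = x powr (- \<delta> - 1)" using x0 by simp
    moreover have "x powr (- \<delta> - 1) \<le> w2" unfolding w2_def using x a1 d by (intro powr_mono2') auto
    ultimately have "\<mu> * (x powr (- \<delta> - 2) * x) \<le> \<mu> * w2" using mu0 by (intro mult_left_mono) auto
    moreover have "\<sigma> * (sigma_err r x * x powr (- \<delta> - 2)) = x powr (- \<delta> - 2) * (F x + \<mu> * x) - \<mu> * (x powr (- \<delta> - 2) * x)"
      by (simp add: F_def algebra_simps)
    ultimately show "w1 * (F x + \<mu> * x) - \<mu> * w2 \<le> \<sigma> * (sigma_err r x * x powr (- \<delta> - 2))"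
      using 1 by linarith
  qed
  moreover have "(LINT x:{a..<8 * a}|lborel. w1 * (F x + \<mu> * x) - \<mu> * w2)
      = w1 * (LINT x:{a..<8 * a}|lborel. F x + \<mu> * x) - (8 * a - a) * (\<mu> * w2)"
    using Fi a1 set_integrable_const_Ico[of a "8 * a"]
    by (subst set_integral_diff(2)) (auto simp: set_lborel_integral_const)
  moreover have "w1 * (LINT x:{a..<8 * a}|lborel. F x + \<mu> * x) \<ge> w1 * (a ^ 2 * (ln (real k) / 256))"
    using S1 w0 by (intro mult_left_mono)
  moreover have "(8 * a - a) * (\<mu> * w2) \<le> 8 * \<mu> * (a * w2)"
    using a1 mu0 w0 by (simp add: algebra_simps)
  moreover define t where "t = (8 powr (- \<delta>)) ^ k"
  have t: "t = a powr (- \<delta>)" by (simp add: t_def a_def power_powr_eq[of 8 k, simplified])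
  have t0: "t \<ge> 0" by (simp add: t_def)
  have "a powr 1 * a powr (- \<delta> - 1) = a powr (1 + (- \<delta> - 1))" by (rule powr_add[symmetric])
  then have "a * w2 = t" using a1 by (simp add: w2_def t)
  moreover have "w1 * (a ^ 2 * (ln (real k) / 256)) \<ge> t / 512 * (ln (real k) / 256)"
  proof -
    have "a powr (- \<delta> - 2) * a powr 2 = a powr (- \<delta> - 2 + 2)" by (rule powr_add[symmetric])
    then have "a powr (- \<delta> - 2) * a ^ 2 = t" using a1 by (simp add: t)
    then have w: "w1 * a ^ 2 = 8 powr (- \<delta> - 2) * t" using a1 by (simp add: w1_def powr_mult mult.assoc)
    have "(1 / 512 :: real) = 8 powr (- 3)" by (simp add: powr_minus_divide)
    also have "\<dots> \<le> 8 powr (- \<delta> - 2)" using d by (intro powr_mono) auto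
    finally have "1 / 512 * t \<le> 8 powr (- \<delta> - 2) * t" using t0 by (rule mult_right_mono)
    then have "t / 512 \<le> w1 * a ^ 2" using w by simp
    then have "t / 512 * (ln (real k) / 256) \<le> w1 * a ^ 2 * (ln (real k) / 256)" using lnk by (intro mult_right_mono) auto
    then show ?thesis by (simp add: mult.assoc)
  qed
  ultimately have "(LINT x:{a..<8 * a}|lborel. \<sigma> * (sigma_err r x * x powr (- \<delta> - 2)))
      \<ge> t / 512 * (ln (real k) / 256) - 8 * \<mu> * t" by simp
  also have "t / 512 * (ln (real k) / 256) - 8 * \<mu> * t = t * (ln (real k) / 2 ^ 18)"
    by (simp add: \<mu>_def eps field_simps)
  finally show ?thesis unfolding I t_def .
qed

section \<open>Summation over the blocks and the contradiction\<close>

lemma ln_ln_le_block: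
  assumes k: "k \<ge> 4" and x: "8 ^ k \<le> x" "x \<le> 8 ^ (k + 1)"
  shows "ln (ln x) \<le> 2 * ln (real k)"
proof -
  have l8: "ln (8::real) \<le> 3"
  proof -
    have "ln (8::real) = 3 * ln 2" using ln_realpow[of 2 3] by simp
    then show ?thesis using ln_le_minus_one[of "2::real"] by simp
  qed
  have "(8::real) ^ 1 \<le> 8 ^ k" using k by (intro power_increasing) auto
  then have x8: "8 \<le> x" using x by simp
  have "exp 1 < x" using exp_le x8 by linarith
  then have "ln (exp 1) < ln x" using x8 by (subst ln_less_cancel_iff) auto
  then have lx: "ln x > 1" by simp
  have "ln x \<le> ln (8 ^ (k + 1))" using x x8 by (intro ln_mono) auto
  also have "\<dots> = real (k + 1) * ln 8" by (rule ln_realpow)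
  also have "\<dots> \<le> real (k + 1) * 3" using l8 by (intro mult_left_mono) auto
  \<comment> \<open>3 (k + 1) <= k^2 holds from k = 4 on; the square is the source of the factor 2
    in 2 \<epsilon> ln k.\<close>
  also have "\<dots> \<le> real k ^ 2"
  proof -
    have "(k + 1) * 3 \<le> k * 4" using k by simp
    also have "\<dots> \<le> k * k" using k by (intro mult_left_mono) auto
    finally have "real ((k + 1) * 3) \<le> real (k * k)" by (simp only: of_nat_le_iff)
    then show ?thesis by (simp add: power2_eq_square)
  qed
  finally have "ln (ln x) \<le> ln (real k ^ 2)" using lx by (intro ln_mono) auto
  also have "\<dots> = 2 * ln (real k)" using k ln_realpow[of "real k" 2] by simp
  finally show ?thesis .
qed

text \<open>The blocks form a geometric series with sum at least L \<rho>^K / (1 - \<rho>), where 1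
  - \<rho> <= \<delta> ln 8 <= 3 \<delta>. Comparison with the upper bound 2
  \<open>mellin_kernel_bound\<close> / \<delta> and multiplication by 3 \<delta> removes the
  pole.\<close>

lemma mellin_lower_of_blocks:
  fixes \<sigma> \<delta> L :: real
  assumes r: "r \<ge> 1" and sg: "\<sigma> = 1 \<or> \<sigma> = -1" and d: "0 < \<delta>" "\<delta> \<le> 1 / 2" and L: "L \<ge> 0"
    and blocks: "\<And>k. k \<ge> K \<Longrightarrow>
      (LINT x:{8 ^ k..<8 ^ (k + 1)}|lborel. \<sigma> * (sigma_err r x * x powr (- \<delta> - 2))) \<ge> (8 powr (- \<delta>)) ^ k * L"
  shows "L * (8 powr (- \<delta>)) ^ K \<le> 6 * mellin_kernel_bound
    + 3 * \<delta> * (8 ^ K * (LINT x|lborel. \<bar>indicator {0<..} x * (sigma_err r x * x powr (- (3 / 2) - 1))\<bar>))"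
proof -
  define c :: "nat \<Rightarrow> real" where "c = (\<lambda>k. 8 ^ k)"
  define h where "h = (\<lambda>s x. indicator {0<..} x * (sigma_err r x * x powr (- s - 1)))"
  define g where "g = (\<lambda>x. \<sigma> * h (1 + \<delta>) x)"
  define \<rho> where "\<rho> = (8::real) powr (- \<delta>)"
  define A where "A = c K * (LINT x|lborel. \<bar>h (3 / 2) x\<bar>)"
  have hi: "integrable lborel (h s)" if "1 < s" "s < 2" for s
    unfolding h_def by (rule sigma_err_mellin(1)[OF r that])
  have gi: "integrable lborel g" unfolding g_def using d by (intro integrable_mult_right hi) auto
  have gs: "set_integrable lborel S g" if "S \<in> sets borel" for S
    unfolding set_integrable_def using gi that by (intro integrable_mult_indicator) auto
  have c1: "c K \<ge> 1" by (simp add: c_def)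
  have inc: "incseq c" unfolding c_def incseq_def by (intro allI impI power_increasing) auto
  have U: "(UNIV::real set) = {..<c K} \<union> {c K..}" by auto
  have "integral\<^sup>L lborel g = (LINT x:{..<c K} \<union> {c K..}|lborel. g x)"
    unfolding U[symmetric] by (simp add: set_lebesgue_integral_def)
  also have "\<dots> = (LINT x:{..<c K}|lborel. g x) + (LINT x:{c K..}|lborel. g x)"
    by (intro set_integral_Un gs) auto
  finally have split: "integral\<^sup>L lborel g = (LINT x:{..<c K}|lborel. g x) + (LINT x:{c K..}|lborel. g x)" .
  \<comment> \<open>For x < 8^K the weight x^(-\<delta>-2) = x^(1/2-\<delta>) x^(-5/2) is at most
    8^K x^(-5/2), so the initial part has a bound independent of \<delta>.\<close>
  have first: "\<bar>LINT x:{..<c K}|lborel. g x\<bar> \<le> A"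
  proof -
    have "\<bar>LINT x:{..<c K}|lborel. g x\<bar> \<le> (LINT x|lborel. norm (indicator {..<c K} x *\<^sub>R g x))"
      unfolding set_lebesgue_integral_def real_norm_def[symmetric] by (rule integral_norm_bound)
    also have "\<dots> \<le> (LINT x|lborel. c K * \<bar>h (3 / 2) x\<bar>)"
    proof (rule integral_mono)
      show "integrable lborel (\<lambda>x. norm (indicator {..<c K} x *\<^sub>R g x))"
        using gs[of "{..<c K}"] unfolding set_integrable_def by (intro integrable_norm) auto
      show "integrable lborel (\<lambda>x. c K * \<bar>h (3 / 2) x\<bar>)"
        by (intro integrable_mult_right integrable_abs hi) auto
      fix x :: real
      show "norm (indicator {..<c K} x *\<^sub>R g x) \<le> c K * \<bar>h (3 / 2) x\<bar>"
      proof (cases "0 < x \<and> x < c K")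
        case True
        have "x powr (1 / 2 - \<delta>) \<le> c K powr (1 / 2 - \<delta>)" using True d by (intro powr_mono2) auto
        also have "\<dots> \<le> c K powr 1" using c1 d by (intro powr_mono) auto
        finally have p: "x powr (1 / 2 - \<delta>) \<le> c K" using c1 by simp
        have "x powr (1 / 2 - \<delta>) * x powr (- (3 / 2) - 1) = x powr (1 / 2 - \<delta> + (- (3 / 2) - 1))"
          by (rule powr_add[symmetric])
        also have "1 / 2 - \<delta> + (- (3 / 2) - 1) = - (1 + \<delta>) - 1" by simp
        finally have "x powr (- (1 + \<delta>) - 1) \<le> c K * x powr (- (3 / 2) - 1)"
          using mult_right_mono[OF p, of "x powr (- (3 / 2) - 1)"] by simp
        then have "\<bar>sigma_err r x\<bar> * x powr (- (1 + \<delta>) - 1) \<le> \<bar>sigma_err r x\<bar> * (c K * x powr (- (3 / 2) - 1))"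
          by (rule mult_left_mono) simp
        moreover have "norm (indicator {..<c K} x *\<^sub>R g x) = \<bar>sigma_err r x\<bar> * x powr (- (1 + \<delta>) - 1)"
          using True sg by (auto simp: g_def h_def abs_mult)
        moreover have "\<bar>h (3 / 2) x\<bar> = \<bar>sigma_err r x\<bar> * x powr (- (3 / 2) - 1)"
          using True by (simp add: h_def abs_mult)
        ultimately show ?thesis by (simp only: mult.left_commute)
      next
        case False
        then have z: "indicator {..<c K} x *\<^sub>R g x = 0" by (auto simp: g_def h_def indicator_def)
        show ?thesis unfolding z using c1 by simp
      qed
    qed
    also have "\<dots> = A" by (simp add: A_def)
    finally show ?thesis .
  qed
  have second: "L * \<rho> ^ K * (1 / (1 - \<rho>)) \<le> (LINT x:{c K..}|lborel. g x)"
  proof (rule LIMSEQ_le)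
    have un: "(\<Union>N. {c K..<c (K + N)}) = {c K..}"
    proof (intro equalityI subsetI)
      fix x assume x: "x \<in> {c K..}"
      obtain N where "x < 8 ^ N" using real_arch_pow[of 8 x] by auto
      also have "(8::real) ^ N \<le> c (K + N)" unfolding c_def by (intro power_increasing) auto
      finally show "x \<in> (\<Union>N. {c K..<c (K + N)})" using x by auto
    qed auto
    show "(\<lambda>N. LINT x:{c K..<c (K + N)}|lborel. g x) \<longlonglongrightarrow> (LINT x:{c K..}|lborel. g x)"
      unfolding un[symmetric]
    proof (rule set_integral_cont_up)
      show "incseq (\<lambda>N. {c K..<c (K + N)})"
        using inc by (auto simp: incseq_def intro: less_le_trans)
    qed (auto intro: gs simp: un)
    have rho: "0 < \<rho>" "\<rho> < 1" using d by (auto simp: \<rho>_def powr_less_one)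
    have "(\<lambda>N. \<Sum>k<N. \<rho> ^ k) \<longlonglongrightarrow> 1 / (1 - \<rho>)"
      using geometric_sums[of \<rho>] rho by (simp add: sums_def)
    then show "(\<lambda>N. L * \<rho> ^ K * (\<Sum>k<N. \<rho> ^ k)) \<longlonglongrightarrow> L * \<rho> ^ K * (1 / (1 - \<rho>))"
      by (intro tendsto_mult_left)
    have "L * \<rho> ^ K * (\<Sum>k<N. \<rho> ^ k) \<le> (LINT x:{c K..<c (K + N)}|lborel. g x)" for N
    proof -
      have "L * \<rho> ^ K * (\<Sum>k<N. \<rho> ^ k) = (\<Sum>k<N. \<rho> ^ (K + k) * L)"
        by (simp add: sum_distrib_left power_add mult_ac)
      also have "\<dots> = (\<Sum>k\<in>{K..<K + N}. \<rho> ^ k * L)"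
        by (rule sum.reindex_bij_witness[where i = "\<lambda>k. k - K" and j = "\<lambda>k. K + k"]) auto
      also have "\<dots> \<le> (\<Sum>k\<in>{K..<K + N}. LINT x:{c k..<c (Suc k)}|lborel. g x)"
      proof (rule sum_mono)
        fix k assume k: "k \<in> {K..<K + N}"
        have "(LINT x:{c k..<c (Suc k)}|lborel. g x)
            = (LINT x:{8 ^ k..<8 ^ (k + 1)}|lborel. \<sigma> * (sigma_err r x * x powr (- \<delta> - 2)))"
        proof -
          have e: "- (1 + \<delta>) - 1 = - \<delta> - 2" by simp
          have cI: "{c k..<c (Suc k)} = {8 ^ k..<8 ^ (k + 1)}" by (simp add: c_def)
          show ?thesis unfolding cI
          proof (rule set_lebesgue_integral_cong)
            show "\<forall>x. x \<in> {8 ^ k..<8 ^ (k + 1)} \<longrightarrow> g x = \<sigma> * (sigma_err r x * x powr (- \<delta> - 2))"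
            proof (intro allI impI)
              fix x :: real assume "x \<in> {8 ^ k..<8 ^ (k + 1)}"
              then have "8 ^ k \<le> x" by simp
              moreover have "(0::real) < 8 ^ k" by simp
              ultimately have "0 < x" by linarith
              then show "g x = \<sigma> * (sigma_err r x * x powr (- \<delta> - 2))" unfolding g_def h_def e by simp
            qed
          qed auto
        qed
        then show "\<rho> ^ k * L \<le> (LINT x:{c k..<c (Suc k)}|lborel. g x)"
          using blocks[of k] k by (simp add: \<rho>_def)
      qed
      also have "\<dots> = (LINT x:{c K..<c (K + N)}|lborel. g x)"
        by (intro set_integral_consecutive[symmetric] gs inc) auto
      finally show ?thesis .
    qed
    then show "\<exists>N0. \<forall>N\<ge>N0. L * \<rho> ^ K * (\<Sum>k<N. \<rho> ^ k) \<le> (LINT x:{c K..<c (K + N)}|lborel. g x)" by blast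
  qed
  have total: "integral\<^sup>L lborel g \<le> 2 * mellin_kernel_bound / \<delta>"
  proof -
    have "integral\<^sup>L lborel g = \<sigma> * integral\<^sup>L lborel (h (1 + \<delta>))" unfolding g_def by simp
    also have "\<dots> \<le> \<bar>integral\<^sup>L lborel (h (1 + \<delta>))\<bar>" using sg by auto
    also have "\<dots> \<le> 2 * mellin_kernel_bound / (1 + \<delta> - 1)"
      unfolding h_def using d by (intro sigma_err_mellin_bound r) auto
    finally show ?thesis by simp
  qed
  have rho: "1 - \<rho> \<le> 3 * \<delta>" "\<rho> < 1"
  proof -
    have "ln (8::real) \<le> 3"
      using ln_realpow[of 2 3] ln_le_minus_one[of "2::real"] by simp
    then have "\<delta> * ln 8 \<le> \<delta> * 3" using d by (intro mult_left_mono) auto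
    moreover have "\<rho> = exp (- (\<delta> * ln 8))" by (simp add: \<rho>_def powr_def)
    moreover have "1 + - (\<delta> * ln 8) \<le> exp (- (\<delta> * ln 8))" by (rule exp_ge_add_one_self)
    ultimately show "1 - \<rho> \<le> 3 * \<delta>" by linarith
    show "\<rho> < 1" using d by (auto simp: \<rho>_def powr_less_one)
  qed
  have "L * \<rho> ^ K * (1 / (3 * \<delta>)) \<le> L * \<rho> ^ K * (1 / (1 - \<rho>))"
    using rho L d by (intro mult_left_mono divide_left_mono) (auto simp: \<rho>_def)
  also have "\<dots> \<le> integral\<^sup>L lborel g + A" using second first split by (simp add: abs_le_iff)
  also have "\<dots> \<le> 2 * mellin_kernel_bound / \<delta> + A" using total by simp
  finally have "L * \<rho> ^ K * (1 / (3 * \<delta>)) * (3 * \<delta>) \<le> (2 * mellin_kernel_bound / \<delta> + A) * (3 * \<delta>)"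
    using d by (intro mult_right_mono) auto
  then have "L * \<rho> ^ K \<le> 6 * mellin_kernel_bound + 3 * \<delta> * A"
  proof -
    have "L * \<rho> ^ K * (1 / (3 * \<delta>)) * (3 * \<delta>) = L * \<rho> ^ K" using d by simp
    moreover have "(2 * mellin_kernel_bound / \<delta> + A) * (3 * \<delta>) = 6 * mellin_kernel_bound + 3 * \<delta> * A"
      using d by (simp add: field_simps)
    ultimately show ?thesis using \<open>L * \<rho> ^ K * (1 / (3 * \<delta>)) * (3 * \<delta>) \<le> (2 * mellin_kernel_bound / \<delta> + A) * (3 * \<delta>)\<close>
      by (simp only:)
  qed
  then show ?thesis by (simp add: \<rho>_def A_def c_def h_def)
qed

text \<open>K is fixed before \<delta> tends to 0, so the initial part disappears in the limit and L
  <= 6 \<open>mellin_kernel_bound\<close> remains. As L grows with ln K, the choice of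
  \<open>C3\<close> makes this false.\<close>

lemma sigma_err_not_one_sided:
  fixes \<sigma> :: real
  assumes r: "r \<ge> 1" and sg: "\<sigma> = 1 \<or> \<sigma> = -1"
  shows "\<not> eventually (\<lambda>x. \<sigma> * sigma_err r x \<ge> - (1 / 2 ^ 22) * (x * ln (ln x))) at_top"
proof
  assume "eventually (\<lambda>x. \<sigma> * sigma_err r x \<ge> - (1 / 2 ^ 22) * (x * ln (ln x))) at_top"
  then obtain x0 where x0: "\<And>x. x \<ge> x0 \<Longrightarrow> \<sigma> * sigma_err r x \<ge> - (1 / 2 ^ 22) * (x * ln (ln x))"
    by (auto simp: eventually_at_top_linorder)
  define \<epsilon> :: real where "\<epsilon> = 1 / 2 ^ 22"
  define C1 where "C1 = 128 * (8 * mean_const r + 10 * g_weight_const r)"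
  define C2 where "C2 = 256 * (128 * mean_const r)"
  define C3 where "C3 = (6 * mellin_kernel_bound + 1) * 2 ^ 18"
  define good where "good = (\<lambda>k::nat. 4 \<le> k \<and> x0 \<le> 8 ^ k \<and>
     (\<exists>y\<ge>2. 2 * (r + 1) * y ^ 2 \<le> k \<and> ln (real k) / 4 \<le> ln (real y)) \<and> C1 \<le> ln (real k) \<and> C2 \<le> ln (real k) \<and> C3 \<le> ln (real k))"
  have lnt: "eventually (\<lambda>k::nat. C \<le> ln (real k)) sequentially" for C by real_asymp
  have "eventually (\<lambda>k::nat. x0 \<le> 8 ^ k) sequentially" by real_asymp
  then have "eventually good sequentially"
    unfolding good_def
    by (intro eventually_conj eventually_smooth_bound lnt eventually_ge_at_top)
  then obtain K where K: "\<And>k. k \<ge> K \<Longrightarrow> good k" by (auto simp: eventually_at_top_linorder)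
  define L where "L = ln (real K) / 2 ^ 18"
  have gK: "4 \<le> K" "C3 \<le> ln (real K)" using K[of K] by (auto simp: good_def)
  have L0: "L \<ge> 0" using gK by (simp add: L_def)
  have L6: "L \<ge> 6 * mellin_kernel_bound + 1" using gK(2) by (simp add: L_def C3_def field_simps)
  define A where "A = 8 ^ K * (LINT x|lborel. \<bar>indicator {0<..} x * (sigma_err r x * x powr (- (3 / 2) - 1))\<bar>)"
  have key: "L * (8 powr (- \<delta>)) ^ K \<le> 6 * mellin_kernel_bound + 3 * \<delta> * A" if d: "0 < \<delta>" "\<delta> \<le> 1 / 2" for \<delta>
    unfolding A_def
  proof (rule mellin_lower_of_blocks[OF r sg d L0])
    fix k assume k: "k \<ge> K"
    have g: "4 \<le> k" "x0 \<le> 8 ^ k" "C1 \<le> ln (real k)" "C2 \<le> ln (real k)"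
      using K[OF k] by (auto simp: good_def)
    obtain y where y: "y \<ge> 2" "2 * (r + 1) * y ^ 2 \<le> k" "ln (real k) / 4 \<le> ln (real y)"
      using K[OF k] by (auto simp: good_def)
    have "(8 powr (- \<delta>)) ^ k * L \<le> (8 powr (- \<delta>)) ^ k * (ln (real k) / 2 ^ 18)"
      using k gK by (intro mult_left_mono) (auto simp: L_def divide_right_mono)
    also have "\<dots> \<le> (LINT x:{8 ^ k..<8 ^ (k + 1)}|lborel. \<sigma> * (sigma_err r x * x powr (- \<delta> - 2)))"
    proof (rule block_mellin_lower[OF r sg d \<epsilon>_def _ y])
      show "k \<ge> 1" using g by simp
      show "8 * mean_const r + 10 * g_weight_const r \<le> ln (real k) / 128" using g(3) by (simp add: C1_def)
      show "128 * mean_const r \<le> ln (real k) / 256" using g(4) by (simp add: C2_def)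
      fix x :: real assume x: "x \<in> {8 ^ k..8 ^ (k + 1)}"
      then have "x0 \<le> x" using g(2) by simp
      have "x \<ge> 0" using x zero_le_power[of "8::real" k] by (simp del: zero_le_power) 
      have "ln (ln x) \<le> 2 * ln (real k)" using x g(1) by (intro ln_ln_le_block) auto
      then have "\<epsilon> * (x * ln (ln x)) \<le> \<epsilon> * (x * (2 * ln (real k)))"
        using \<open>x \<ge> 0\<close> by (intro mult_left_mono) (auto simp: \<epsilon>_def)
      moreover have "\<epsilon> * (x * (2 * ln (real k))) = 2 * \<epsilon> * ln (real k) * x" by simp
      moreover have "- (\<epsilon> * (x * ln (ln x))) \<le> \<sigma> * sigma_err r x" using x0[OF \<open>x0 \<le> x\<close>] by (simp add: \<epsilon>_def)
      ultimately show "- (2 * \<epsilon> * ln (real k)) * x \<le> \<sigma> * sigma_err r x" by simp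
    qed
    finally show "(8 powr (- \<delta>)) ^ k * L \<le> (LINT x:{8 ^ k..<8 ^ (k + 1)}|lborel. \<sigma> * (sigma_err r x * x powr (- \<delta> - 2)))" .
  qed
  have "((\<lambda>\<delta>::real. L * (8 powr (- \<delta>)) ^ K) \<longlongrightarrow> L * (8 powr (- 0)) ^ K) (at_right 0)"
    by (intro tendsto_intros) auto
  moreover have "((\<lambda>\<delta>. 6 * mellin_kernel_bound + 3 * \<delta> * A) \<longlongrightarrow> 6 * mellin_kernel_bound + 3 * 0 * A) (at_right 0)"
    by (intro tendsto_intros)
  moreover have "eventually (\<lambda>\<delta>::real. \<delta> \<in> {0<..<1 / 2}) (at_right 0)"
    by (rule eventually_at_right_real) simp
  then have "eventually (\<lambda>\<delta>. L * (8 powr (- \<delta>)) ^ K \<le> 6 * mellin_kernel_bound + 3 * \<delta> * A) (at_right 0)"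
    by eventually_elim (intro key; simp)
  ultimately have "L * (8 powr (- 0)) ^ K \<le> 6 * mellin_kernel_bound + 3 * 0 * A"
    by (intro tendsto_le[OF _ _ _, of "at_right (0::real)"]) auto
  then show False using L6 by simp
qed

theorem theorem5:
  fixes r :: nat
  assumes "r \<ge> 1"
  shows "Limsup at_top (\<lambda>x::real. ereal
           (((\<Sum>n = 1..nat \<lfloor>x\<rfloor>. real (sigma_ord r n)) - mean_const r * x ^ 2)
              / (x * ln (ln x)))) > 0 \<and>
         Liminf at_top (\<lambda>x::real. ereal
           (((\<Sum>n = 1..nat \<lfloor>x\<rfloor>. real (sigma_ord r n)) - mean_const r * x ^ 2)
              / (x * ln (ln x)))) < 0"
proof -
  let ?f = "\<lambda>x::real. ereal (sigma_err r x / (x * ln (ln x)))"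
  have pos: "eventually (\<lambda>x::real. 0 < x * ln (ln x)) at_top" by real_asymp
  have "\<not> Limsup at_top ?f \<le> 0"
  proof
    assume "Limsup at_top ?f \<le> 0"
    \<comment> \<open>A fixed positive threshold suffices: an eventual upper bound for E is the
      one-sided bound for -E.\<close>
    then have "eventually (\<lambda>x. ?f x < ereal (1 / 2 ^ 22)) at_top"
      unfolding Limsup_le_iff by (elim allE[of _ "ereal (1 / 2 ^ 22)"]) simp
    then have "eventually (\<lambda>x. -1 * sigma_err r x \<ge> - (1 / 2 ^ 22) * (x * ln (ln x))) at_top"
      using pos by eventually_elim (simp add: field_simps)
    then show False using sigma_err_not_one_sided[OF assms, of "-1"] by simp
  qed
  moreover have "\<not> Liminf at_top ?f \<ge> 0"
  proof
    assume "Liminf at_top ?f \<ge> 0"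
    then have "eventually (\<lambda>x. ereal (- 1 / 2 ^ 22) < ?f x) at_top"
      unfolding le_Liminf_iff by (elim allE[of _ "ereal (- 1 / 2 ^ 22)"]) simp
    then have "eventually (\<lambda>x. 1 * sigma_err r x \<ge> - (1 / 2 ^ 22) * (x * ln (ln x))) at_top"
      using pos by eventually_elim (simp add: field_simps)
    then show False using sigma_err_not_one_sided[OF assms, of 1] by simp
  qed
  ultimately show ?thesis unfolding sigma_err_def by (simp add: not_le)
qed

end
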